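(* Let $\alpha$ be an endomorphism of a unital $C^*$-algebra $A$, and let $L$ be a transfer operator for $(A,\alpha)$. Let $K_\alpha:=\overline{A\alpha(A)A}\cap J(M_L)$. Then the canonical map $j_A:A\to A\rtimes_{\alpha,L}\mathbb{N}$ is injective if and only if $L$ is almost faithful on $K_\alpha$.
   Context: Endomorphisms are $*$-homomorphisms $\alpha:A\to A$, not assumed unital or injective. A transfer operator for $(A,\alpha)$ is a continuous linear map $L:A\to A$ that is positive ($a\ge 0\Rightarrow L(a)\ge 0$) and satisfies $L(\alpha(a)b)=aL(b)$ for all $a,b\in A$. $L$ is almost faithful on an ideal $I$ of $A$ if: whenever $a\in I$ and $L((ab)^*ab)=0$ for all $b\in A$, then $a=0$. Toeplitz algebra: $\mathcal{T}(A,\alpha,L)$ is the universal unital $C^*$-algebra generated by a copy of $A$ (via a unital homomorphism $i_A:A\to\mathcal{T}(A,\alpha,L)$, which is injective) and an element $S$ with $S\,i_A(a)=i_A(\alpha(a))S$ and $S^*i_A(a)S=i_A(L(a))$ for all $a\in A$. The bimodule $M_L$: let $A_L$ be a copy of the vector space $A$ with right action $m\cdot a=m\alpha(a)$ and $A$-valued form $\langle m,n\rangle_L=L(m^*n)$; let $N=\{a\in A_L:\langle a,a\rangle_L=0\}$, let $q:A_L\to A_L/N$ be the quotient map, and let $M_L$ be the right Hilbert $A$-module obtained by completing $A_L/N$. Left multiplication induces a homomorphism $\phi:A\to\mathcal{L}(M_L)$ (adjointable operators), $\phi(a)q(b)=q(ab)$. $\mathcal{K}(M_L)$ denotes the compact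 operators (closed span of $\Theta_{x,y}:z\mapsto x\cdot\langle y,z\rangle$), and $J(M_L):=\phi^{-1}(\mathcal{K}(M_L))$. $\overline{A\alpha(A)A}$ denotes the closed linear span of the products $a\alpha(b)c$, $a,b,c\in A$. Crossed product: a redundancy is a pair $(i_A(a),k)$ with $a\in A$, $k\in\overline{i_A(A)SS^*i_A(A)}$ (closed linear span) and $i_A(a)i_A(b)S=k\,i_A(b)S$ for all $b\in A$. Exel's crossed product $A\rtimes_{\alpha,L}\mathbb{N}$ is the quotient of $\mathcal{T}(A,\alpha,L)$ by the closed two-sided ideal generated by $\{i_A(a)-k: (i_A(a),k)\text{ is a redundancy with } a\in\overline{A\alpha(A)A}\}$; $Q$ denotes the quotient map, and $j_A:=Q\circ i_A$. *)

theory Defs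
  imports "HOL-Analysis.Analysis" "HOL-Library.Poly_Mapping"
begin

section \<open>Complex Banach spaces and unital C*-algebras\<close>

class scaleC =
  fixes scaleC :: "complex \<Rightarrow> 'a \<Rightarrow> 'a"  (infixr \<open>*\<^sub>C\<close> 75)

class complex_vector = scaleC + real_vector +
  assumes scaleC_add_right: "c *\<^sub>C (x + y) = c *\<^sub>C x + c *\<^sub>C y"
    and scaleC_add_left: "(c + d) *\<^sub>C x = c *\<^sub>C x + d *\<^sub>C x"
    and scaleC_scaleC: "c *\<^sub>C d *\<^sub>C x = (c * d) *\<^sub>C x"
    and scaleC_one: "1 *\<^sub>C x = x"
    and scaleR_scaleC: "r *\<^sub>R x = complex_of_real r *\<^sub>C x"

global_interpretation complex_vector: vector_space "scaleC :: complex \<Rightarrow> 'a \<Rightarrow> 'a::complex_vector"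
  by unfold_locales (simp_all add: scaleC_add_right scaleC_add_left scaleC_scaleC scaleC_one)

class complex_normed_vector = complex_vector + real_normed_vector +
  assumes norm_scaleC: "norm (c *\<^sub>C x) = cmod c * norm x"

class complex_banach = complex_normed_vector + banach

class star =
  fixes star :: "'a \<Rightarrow> 'a"

text \<open>The class \<open>monoid_mult\<close> is used for the unit, rather than \<open>ring_1\<close>, because the latter
  excludes the zero algebra. A crossed product may be zero.\<close>

class unital_cstar_algebra = complex_banach + real_normed_algebra + monoid_mult + star +
  assumes scaleC_mult_left: "(c *\<^sub>C x) * y = c *\<^sub>C (x * y)"
    and scaleC_mult_right: "x * (c *\<^sub>C y) = c *\<^sub>C (x * y)"
    and star_add: "star (x + y) = star x + star y"
    and star_scaleC: "star (c *\<^sub>C x) = cnj c *\<^sub>C star x"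
    and star_mult: "star (x * y) = star y * star x"
    and star_star: "star (star x) = x"
    and cstar_identity: "norm (star x * x) = (norm x)\<^sup>2"

abbreviation clinear :: "('a::complex_vector \<Rightarrow> 'b::complex_vector) \<Rightarrow> bool" where
  "clinear \<equiv> Vector_Spaces.linear scaleC scaleC"

definition closed_span :: "'a::complex_normed_vector set \<Rightarrow> 'a set" where
  "closed_span X = closure (complex_vector.span X)"

definition positive :: "'a::unital_cstar_algebra \<Rightarrow> bool" where
  "positive a \<longleftrightarrow> (\<exists>b. a = star b * b)"

definition star_hom :: "('a::unital_cstar_algebra \<Rightarrow> 'b::unital_cstar_algebra) \<Rightarrow> bool" where
  "star_hom f \<longleftrightarrow> clinear f \<and> (\<forall>x y. f (x * y) = f x * f y) \<and> (\<forall>x. f (star x) = star (f x))"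

definition unital_star_hom :: "('a::unital_cstar_algebra \<Rightarrow> 'b::unital_cstar_algebra) \<Rightarrow> bool" where
  "unital_star_hom f \<longleftrightarrow> star_hom f \<and> f 1 = 1"

definition closed_ideal :: "'a::unital_cstar_algebra set \<Rightarrow> bool" where
  "closed_ideal I \<longleftrightarrow> closed I \<and> complex_vector.subspace I \<and>
     (\<forall>x\<in>I. \<forall>y. x * y \<in> I \<and> y * x \<in> I)"

definition closed_ideal_generated :: "'a::unital_cstar_algebra set \<Rightarrow> 'a set" where
  "closed_ideal_generated X = \<Inter>{I. closed_ideal I \<and> X \<subseteq> I}"

definition cstar_subalgebra :: "'a::unital_cstar_algebra set \<Rightarrow> bool" where
  "cstar_subalgebra B \<longleftrightarrow> closed B \<and> complex_vector.subspace B \<and> 1 \<in> B \<and>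
     (\<forall>x\<in>B. \<forall>y\<in>B. x * y \<in> B) \<and> (\<forall>x\<in>B. star x \<in> B)"

definition cstar_generates :: "'a::unital_cstar_algebra set \<Rightarrow> bool" where
  "cstar_generates X \<longleftrightarrow> (\<forall>B. cstar_subalgebra B \<and> X \<subseteq> B \<longrightarrow> B = UNIV)"

instantiation blinfun :: (complex_normed_vector, complex_normed_vector) complex_normed_vector
begin

definition scaleC_blinfun :: "complex \<Rightarrow> 'a \<Rightarrow>\<^sub>L 'b \<Rightarrow> 'a \<Rightarrow>\<^sub>L 'b" where
  "scaleC_blinfun c T = Blinfun (\<lambda>x. c *\<^sub>C blinfun_apply T x)"

lemma bounded_linear_scaleC: "bounded_linear (\<lambda>x::'c::complex_normed_vector. c *\<^sub>C x)"
  by (rule bounded_linear_intro[where K = "cmod c"])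
     (simp_all add: scaleC_add_right scaleR_scaleC scaleC_scaleC norm_scaleC mult.commute)

lemma scaleC_blinfun_apply:
  "blinfun_apply (c *\<^sub>C T) x = c *\<^sub>C blinfun_apply (T :: 'a \<Rightarrow>\<^sub>L 'b) x"
  unfolding scaleC_blinfun_def
  by (subst bounded_linear_Blinfun_apply)
     (auto intro: bounded_linear_compose[OF bounded_linear_scaleC] blinfun.bounded_linear_right)

instance
proof
  fix c d :: complex and r :: real and S T :: "'a \<Rightarrow>\<^sub>L 'b"
  show "c *\<^sub>C (S + T) = c *\<^sub>C S + c *\<^sub>C T"
    by (rule blinfun_eqI) (simp add: scaleC_blinfun_apply blinfun.add_left scaleC_add_right)
  show "(c + d) *\<^sub>C T = c *\<^sub>C T + d *\<^sub>C T"
    by (rule blinfun_eqI) (simp add: scaleC_blinfun_apply blinfun.add_left scaleC_add_left)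
  show "c *\<^sub>C d *\<^sub>C T = (c * d) *\<^sub>C T"
    by (rule blinfun_eqI) (simp add: scaleC_blinfun_apply scaleC_scaleC)
  show "1 *\<^sub>C T = T"
    by (rule blinfun_eqI) (simp add: scaleC_blinfun_apply scaleC_one)
  show "r *\<^sub>R T = complex_of_real r *\<^sub>C T"
    by (rule blinfun_eqI) (simp add: scaleC_blinfun_apply blinfun.scaleR_left scaleR_scaleC)
  have le: "norm (c *\<^sub>C T) \<le> cmod c * norm T" for c and T :: "'a \<Rightarrow>\<^sub>L 'b"
  proof (rule norm_blinfun_bound)
    fix x
    show "norm (blinfun_apply (c *\<^sub>C T) x) \<le> cmod c * norm T * norm x"
      using mult_left_mono[OF norm_blinfun[of T x] norm_ge_zero[of c]]
      by (simp add: scaleC_blinfun_apply norm_scaleC mult.assoc)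
  qed simp
  show "norm (c *\<^sub>C T) = cmod c * norm T"
  proof (cases "c = 0")
    case True
    then show ?thesis using le[of c T] by simp
  next
    case False
    have "T = inverse c *\<^sub>C c *\<^sub>C T"
      using False by (intro blinfun_eqI) (simp add: scaleC_blinfun_apply scaleC_scaleC scaleC_one)
    then have "norm T \<le> cmod (inverse c) * norm (c *\<^sub>C T)"
      using le[of "inverse c" "c *\<^sub>C T"] by simp
    then have "cmod c * norm T \<le> norm (c *\<^sub>C T)"
      using False by (simp add: norm_inverse norm_divide field_simps)
    then show ?thesis using le[of c T] by simp
  qed
qed

end


section \<open>Transfer operators\<close>

definition transfer_operator ::
    "('a::unital_cstar_algebra \<Rightarrow> 'a) \<Rightarrow> ('a \<Rightarrow> 'a) \<Rightarrow> bool" where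
  "transfer_operator \<alpha> L \<longleftrightarrow> clinear L \<and> continuous_on UNIV L \<and>
     (\<forall>a. positive a \<longrightarrow> positive (L a)) \<and> (\<forall>a b. L (\<alpha> a * b) = a * L b)"

definition almost_faithful_on ::
    "('a::unital_cstar_algebra \<Rightarrow> 'a) \<Rightarrow> 'a set \<Rightarrow> bool" where
  "almost_faithful_on L I \<longleftrightarrow> (\<forall>a\<in>I. (\<forall>b. L (star (a * b) * (a * b)) = 0) \<longrightarrow> a = 0)"


section \<open>Hilbert modules and the bimodule of a transfer operator\<close>

text \<open>A right Hilbert module with form \<open>ip\<close>, conjugate linear in the first variable, and
  right action \<open>act\<close>. Completeness is part of the class \<open>complex_banach\<close>.\<close>

locale hilbert_module =
  fixes ip :: "'m::complex_banach \<Rightarrow> 'm \<Rightarrow> 'a::unital_cstar_algebra"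
    and act :: "'m \<Rightarrow> 'a \<Rightarrow> 'm"
  assumes act_linear_left: "clinear (\<lambda>x. act x a)"
    and act_linear_right: "clinear (\<lambda>a. act x a)"
    and act_act: "act (act x a) b = act x (a * b)"
    and act_one: "act x 1 = x"
    and ip_linear: "clinear (\<lambda>y. ip x y)"
    and ip_act: "ip x (act y a) = ip x y * a"
    and star_ip: "star (ip x y) = ip y x"
    and ip_positive: "positive (ip x x)"
    and norm_ip: "norm x = sqrt (norm (ip x x))"

definition adjointable ::
    "('m::complex_banach \<Rightarrow> 'm \<Rightarrow> 'a::unital_cstar_algebra) \<Rightarrow> ('m \<Rightarrow>\<^sub>L 'm) \<Rightarrow> bool" where
  "adjointable ip T \<longleftrightarrow>
     (\<exists>T' :: 'm \<Rightarrow>\<^sub>L 'm. \<forall>x y. ip (blinfun_apply T x) y = ip x (blinfun_apply T' y))"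

definition rank_one ::
    "('m::complex_banach \<Rightarrow> 'm \<Rightarrow> 'a::unital_cstar_algebra) \<Rightarrow> ('m \<Rightarrow> 'a \<Rightarrow> 'm) \<Rightarrow> 'm \<Rightarrow> 'm \<Rightarrow> 'm \<Rightarrow>\<^sub>L 'm" where
  "rank_one ip act x y = Blinfun (\<lambda>z. act x (ip y z))"

definition compact_operators ::
    "('m::complex_banach \<Rightarrow> 'm \<Rightarrow> 'a::unital_cstar_algebra) \<Rightarrow> ('m \<Rightarrow> 'a \<Rightarrow> 'm) \<Rightarrow> ('m \<Rightarrow>\<^sub>L 'm) set" where
  "compact_operators ip act = closed_span {rank_one ip act x y | x y. True}"

text \<open>\<open>(ip, act)\<close> together with \<open>q\<close> is the Hilbert module \<open>M\<^sub>L\<close>, which is determined up to unique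
  isomorphism. Since the form of a Hilbert module is definite, \<open>ip_q\<close> says that the kernel
  \<open>N\<close> of \<open>q\<close> is the null space of the form on \<open>A\<^sub>L\<close>, and that \<open>q\<close> embeds \<open>A\<^sub>L/N\<close> isometrically;
  its range is dense by \<open>dense_q\<close>.\<close>

locale transfer_module = hilbert_module ip act
  for ip :: "'m::complex_banach \<Rightarrow> 'm \<Rightarrow> 'a::unital_cstar_algebra"
    and act :: "'m \<Rightarrow> 'a \<Rightarrow> 'm" +
  fixes \<alpha> L :: "'a \<Rightarrow> 'a" and q :: "'a \<Rightarrow> 'm"
  assumes q_linear: "clinear q"
    and act_q: "act (q m) a = q (m * \<alpha> a)"
    and ip_q: "ip (q m) (q n) = L (star m * n)"
    and dense_q: "closure (range q) = UNIV"

definition left_action ::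
    "('m::complex_banach \<Rightarrow> 'm \<Rightarrow> 'a::unital_cstar_algebra) \<Rightarrow> ('a \<Rightarrow> 'm) \<Rightarrow> 'a \<Rightarrow> 'm \<Rightarrow>\<^sub>L 'm" where
  "left_action ip q a =
     (THE T. adjointable ip T \<and> (\<forall>b. blinfun_apply T (q b) = q (a * b)))"

definition J_ideal ::
    "('m::complex_banach \<Rightarrow> 'm \<Rightarrow> 'a::unital_cstar_algebra) \<Rightarrow> ('m \<Rightarrow> 'a \<Rightarrow> 'm) \<Rightarrow> ('a \<Rightarrow> 'm) \<Rightarrow> 'a set" where
  "J_ideal ip act q = {a. left_action ip q a \<in> compact_operators ip act}"

definition A_alpha_A :: "('a::unital_cstar_algebra \<Rightarrow> 'a) \<Rightarrow> 'a set" where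
  "A_alpha_A \<alpha> = closed_span {a * \<alpha> b * c | a b c. True}"

definition K_alpha ::
    "('a::unital_cstar_algebra \<Rightarrow> 'a) \<Rightarrow> ('m::complex_banach \<Rightarrow> 'm \<Rightarrow> 'a) \<Rightarrow>
     ('m \<Rightarrow> 'a \<Rightarrow> 'm) \<Rightarrow> ('a \<Rightarrow> 'm) \<Rightarrow> 'a set" where
  "K_alpha \<alpha> ip act q = A_alpha_A \<alpha> \<inter> J_ideal ip act q"


section \<open>The free *-algebra on a copy of the algebra and one further generator\<close>

text \<open>Words in the letters \<open>Elt a\<close>, \<open>Gen\<close> (for \<open>S\<close>) and \<open>Gen_star\<close>. The involution on letters sends the letter
  \<open>Elt a\<close> to \<open>Elt (star a)\<close>, so the relation \<open>i (star a) = star (i a)\<close> is built in. The finitely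
  supported functions on words, with the convolution product of \<open>Poly_Mapping\<close>, form the free
  unital complex algebra; a scalar \<open>c\<close> is the element \<open>Poly_Mapping.single 0 c\<close>.\<close>

datatype 'a letter = Elt 'a | Gen | Gen_star

datatype 'a free_word = Word (letters: "'a letter list")

instantiation free_word :: (type) monoid_add
begin
definition zero_free_word :: "'a free_word" where "0 = Word []"
definition plus_free_word :: "'a free_word \<Rightarrow> 'a free_word \<Rightarrow> 'a free_word" where
  "v + w = Word (letters v @ letters w)"
instance
  by standard (simp_all add: zero_free_word_def plus_free_word_def)
end

type_synonym 'a free_alg = "'a free_word \<Rightarrow>\<^sub>0 complex"

fun star_letter :: "'a::star letter \<Rightarrow> 'a letter" where
  "star_letter (Elt a) = Elt (star a)"
| "star_letter Gen = Gen_star"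
| "star_letter Gen_star = Gen"

definition star_word :: "'a::star free_word \<Rightarrow> 'a free_word" where
  "star_word w = Word (rev (map star_letter (letters w)))"

definition star_free :: "'a::star free_alg \<Rightarrow> 'a free_alg" where
  "star_free f = (\<Sum>w\<in>Poly_Mapping.keys f.
     Poly_Mapping.single (star_word w) (cnj (Poly_Mapping.lookup f w)))"

definition free_const :: "complex \<Rightarrow> 'a free_alg" where
  "free_const c = Poly_Mapping.single 0 c"

definition free_elt :: "'a \<Rightarrow> 'a free_alg" where
  "free_elt a = Poly_Mapping.single (Word [Elt a]) 1"

definition free_gen :: "'a free_alg" where
  "free_gen = Poly_Mapping.single (Word [Gen]) 1"

fun eval_letter :: "('a \<Rightarrow> 'b) \<Rightarrow> 'b \<Rightarrow> 'a letter \<Rightarrow> 'b::unital_cstar_algebra" where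
  "eval_letter \<pi> V (Elt a) = \<pi> a"
| "eval_letter \<pi> V Gen = V"
| "eval_letter \<pi> V Gen_star = star V"

definition eval_free :: "('a \<Rightarrow> 'b) \<Rightarrow> 'b \<Rightarrow> 'a free_alg \<Rightarrow> 'b::unital_cstar_algebra" where
  "eval_free \<pi> V f = (\<Sum>w\<in>Poly_Mapping.keys f.
     Poly_Mapping.lookup f w *\<^sub>C prod_list (map (eval_letter \<pi> V) (letters w)))"

definition cstar_seminorm :: "('a::star free_alg \<Rightarrow> real) \<Rightarrow> bool" where
  "cstar_seminorm p \<longleftrightarrow>
     (\<forall>f g. p (f + g) \<le> p f + p g) \<and> (\<forall>c f. p (free_const c * f) = cmod c * p f) \<and>
     (\<forall>f g. p (f * g) \<le> p f * p g) \<and> (\<forall>f. p (star_free f * f) = (p f)\<^sup>2)"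


section \<open>The Toeplitz algebra\<close>

definition toeplitz_rep ::
    "('a::unital_cstar_algebra \<Rightarrow> 'a) \<Rightarrow> ('a \<Rightarrow> 'a) \<Rightarrow> ('a \<Rightarrow> 'b::unital_cstar_algebra) \<Rightarrow> 'b \<Rightarrow> bool" where
  "toeplitz_rep \<alpha> L \<pi> V \<longleftrightarrow> unital_star_hom \<pi> \<and>
     (\<forall>a. V * \<pi> a = \<pi> (\<alpha> a) * V) \<and> (\<forall>a. star V * \<pi> a * V = \<pi> (L a))"

text \<open>The elements of the free *-algebra that must vanish for its two families of generators to
  satisfy \<open>toeplitz_rep\<close>.\<close>

definition toeplitz_relations ::
    "('a::unital_cstar_algebra \<Rightarrow> 'a) \<Rightarrow> ('a \<Rightarrow> 'a) \<Rightarrow> 'a free_alg set" where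
  "toeplitz_relations \<alpha> L =
     {free_elt (a + b) - (free_elt a + free_elt b) | a b. True} \<union>
     {free_elt (c *\<^sub>C a) - free_const c * free_elt a | c a. True} \<union>
     {free_elt (a * b) - free_elt a * free_elt b | a b. True} \<union>
     {free_elt 1 - 1} \<union>
     {free_gen * free_elt a - free_elt (\<alpha> a) * free_gen | a. True} \<union>
     {star_free free_gen * free_elt a * free_gen - free_elt (L a) | a. True}"

text \<open>\<open>(i, S)\<close> makes the C*-algebra \<open>'t\<close> the universal unital C*-algebra of the relations. HOL
  cannot quantify over all C*-algebras \<open>'b\<close> inside a definition, so universality is expressed,
  as in the usual construction of C*-algebras from generators and relations, by
  C*-seminorms on the free *-algebra: these are the functions \<open>\<lambda>f. norm (eval_free \<pi> V f)\<close> for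
  representations \<open>(\<pi>, V)\<close> in C*-algebras, and \<open>'t\<close> is the completion of the free *-algebra in
  the largest of those that kill the relations. The lemma \<open>toeplitz_universal\<close> below is the
  universal property with respect to C*-algebras of every type (it asks for continuity of the
  induced map, which is automatic for *-homomorphisms of C*-algebras).\<close>

definition toeplitz_algebra ::
    "('a::unital_cstar_algebra \<Rightarrow> 'a) \<Rightarrow> ('a \<Rightarrow> 'a) \<Rightarrow> ('a \<Rightarrow> 't::unital_cstar_algebra) \<Rightarrow> 't \<Rightarrow> bool" where
  "toeplitz_algebra \<alpha> L i S \<longleftrightarrow>
     toeplitz_rep \<alpha> L i S \<and> cstar_generates (insert S (range i)) \<and>
     (\<forall>p. cstar_seminorm p \<and> (\<forall>r\<in>toeplitz_relations \<alpha> L. p r = 0) \<longrightarrow>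
        (\<forall>f. p f \<le> norm (eval_free i S f)))"

lemma star_hom_simps:
  assumes "star_hom f"
  shows "f (x + y) = f x + f y" "f (c *\<^sub>C x) = c *\<^sub>C f x" "f (x * y) = f x * f y"
    "f (star x) = star (f x)"
  using assms by (auto simp: star_hom_def Vector_Spaces.linear_iff)

lemma star_1: "star (1::'a::unital_cstar_algebra) = 1"
  by (metis mult_1_left mult_1_right star_mult star_star)

lemma star_0: "star (0::'a::unital_cstar_algebra) = 0"
  by (metis add_cancel_right_right star_add)

lemma norm_star: "norm (star x) = norm (x::'a::unital_cstar_algebra)"
proof -
  have le: "norm y \<le> norm (star y)" for y :: 'a
    using norm_mult_ineq[of "star y" y]
    by (cases "y = 0") (simp_all add: cstar_identity power2_eq_square)
  show ?thesis
    using le[of x] le[of "star x"] by (simp add: star_star)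
qed

lemma star_sum: "star (sum f X) = (\<Sum>x\<in>X. star (f x :: 'a::unital_cstar_algebra))"
  by (induction X rule: infinite_finite_induct) (simp_all add: star_0 star_add)

lemma star_prod_list:
  "star (prod_list xs) = prod_list (rev (map star xs))" for xs :: "'a::unital_cstar_algebra list"
  by (induction xs) (simp_all add: star_1 star_mult)

definition eval_word where
  "eval_word \<pi> V w = prod_list (map (eval_letter \<pi> V) (letters w))"

lemma eval_word_add: "eval_word \<pi> V (v + w) = eval_word \<pi> V v * eval_word \<pi> V w"
  by (simp add: eval_word_def plus_free_word_def)

lemma eval_word_star:
  assumes "star_hom \<pi>"
  shows "eval_word \<pi> V (star_word w) = star (eval_word \<pi> V w)"
proof -
  have "eval_letter \<pi> V (star_letter l) = star (eval_letter \<pi> V l)" for l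
    by (cases l) (simp_all add: star_hom_simps[OF assms] star_star)
  then show ?thesis
    by (simp add: eval_word_def star_word_def star_prod_list rev_map comp_def)
qed

lemma eval_free_superset:
  assumes "finite X" "Poly_Mapping.keys f \<subseteq> X"
  shows "eval_free \<pi> V f = (\<Sum>w\<in>X. Poly_Mapping.lookup f w *\<^sub>C eval_word \<pi> V w)"
  unfolding eval_free_def eval_word_def
  using assms by (intro sum.mono_neutral_left) (auto simp: in_keys_iff)

lemma eval_free_add: "eval_free \<pi> V (f + g) = eval_free \<pi> V f + eval_free \<pi> V g"
proof -
  let ?X = "Poly_Mapping.keys f \<union> Poly_Mapping.keys g"
  have "finite ?X" by simp
  then show ?thesis
    using keys_add[of f g]
    by (simp add: eval_free_superset[of ?X] lookup_add scaleC_add_left sum.distrib)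
qed

lemma eval_free_0: "eval_free \<pi> V 0 = 0"
  by (simp add: eval_free_def)

lemma eval_free_sum: "eval_free \<pi> V (sum f X) = (\<Sum>x\<in>X. eval_free \<pi> V (f x))"
  by (induction X rule: infinite_finite_induct) (simp_all add: eval_free_0 eval_free_add)

lemma eval_free_diff: "eval_free \<pi> V (f - g) = eval_free \<pi> V f - eval_free \<pi> V g"
  using eval_free_add[of \<pi> V "f - g" g] by simp

lemma eval_free_single:
  "eval_free \<pi> V (Poly_Mapping.single w c) = c *\<^sub>C eval_word \<pi> V w"
  by (simp add: eval_free_superset[of "{w}"])

lemma free_alg_expand:
  "f = (\<Sum>w\<in>Poly_Mapping.keys f. Poly_Mapping.single w (Poly_Mapping.lookup f w))"
  for f :: "'a free_alg"
proof (rule poly_mapping_eqI)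
  fix k
  show "Poly_Mapping.lookup f k = Poly_Mapping.lookup
      (\<Sum>w\<in>Poly_Mapping.keys f. Poly_Mapping.single w (Poly_Mapping.lookup f w)) k"
    by (simp add: lookup_sum lookup_single when_def in_keys_iff)
qed

lemma eval_free_mult: "eval_free \<pi> V (f * g) = eval_free \<pi> V f * eval_free \<pi> V g"
proof -
  have "eval_free \<pi> V (f * g) =
      (\<Sum>v\<in>Poly_Mapping.keys f. \<Sum>w\<in>Poly_Mapping.keys g.
         (Poly_Mapping.lookup f v * Poly_Mapping.lookup g w) *\<^sub>C
         (eval_word \<pi> V v * eval_word \<pi> V w))"
    by (subst (1) free_alg_expand[of f], subst (1) free_alg_expand[of g])
       (simp add: sum_product mult_single eval_free_sum eval_free_single eval_word_add)
  also have "\<dots> = eval_free \<pi> V f * eval_free \<pi> V g"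
    by (simp add: eval_free_superset[OF finite_keys order_refl] sum_product
        scaleC_mult_left scaleC_mult_right scaleC_scaleC mult.commute[of "Poly_Mapping.lookup f _"])
  finally show ?thesis .
qed

lemma eval_free_star:
  assumes "star_hom \<pi>"
  shows "eval_free \<pi> V (star_free f) = star (eval_free \<pi> V f)"
  unfolding star_free_def eval_free_sum eval_free_single eval_word_star[OF assms]
    eval_free_superset[OF finite_keys order_refl, of \<pi> V f] star_sum star_scaleC ..

lemma eval_free_gens:
  fixes \<pi> :: "'a \<Rightarrow> 'b::unital_cstar_algebra"
  shows "eval_free \<pi> V (free_const c) = c *\<^sub>C 1" "eval_free \<pi> V 1 = 1"
  "eval_free \<pi> V (free_elt a) = \<pi> a" "eval_free \<pi> V free_gen = V"
proof -
  have 1: "(1 :: 'a free_alg) = Poly_Mapping.single 0 1" by simp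
  show "eval_free \<pi> V (free_const c) = c *\<^sub>C 1"
    by (simp add: free_const_def eval_free_single eval_word_def zero_free_word_def)
  show "eval_free \<pi> V 1 = 1"
    by (subst 1, subst eval_free_single) (simp add: eval_word_def zero_free_word_def scaleC_one)
  show "eval_free \<pi> V (free_elt a) = \<pi> a"
    by (simp add: free_elt_def eval_free_single eval_word_def scaleC_one)
  show "eval_free \<pi> V free_gen = V"
    by (simp add: free_gen_def eval_free_single eval_word_def scaleC_one)
qed

lemma eval_free_scaleC: "eval_free \<pi> V (free_const c * f) = c *\<^sub>C eval_free \<pi> V f"
  by (simp add: eval_free_mult eval_free_gens scaleC_mult_left)

lemma cstar_seminorm_rep:
  assumes "toeplitz_rep \<alpha> L \<pi> V"
  shows "cstar_seminorm (\<lambda>f. norm (eval_free \<pi> V f))"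
    and "r \<in> toeplitz_relations \<alpha> L \<Longrightarrow> norm (eval_free \<pi> V r) = 0"
proof -
  have \<pi>: "star_hom \<pi>" "\<pi> 1 = 1"
    using assms by (auto simp: toeplitz_rep_def unital_star_hom_def)
  show "cstar_seminorm (\<lambda>f. norm (eval_free \<pi> V f))"
    by (simp add: cstar_seminorm_def eval_free_add norm_triangle_ineq eval_free_gens scaleC_mult_left norm_scaleC
        eval_free_mult norm_mult_ineq eval_free_star[OF \<pi>(1)] cstar_identity)
  show "norm (eval_free \<pi> V r) = 0" if "r \<in> toeplitz_relations \<alpha> L"
    using that assms
    by (auto simp: toeplitz_relations_def toeplitz_rep_def eval_free_diff eval_free_add
        eval_free_mult scaleC_mult_left eval_free_gens eval_free_star[OF \<pi>(1)] \<pi>(2)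
        star_hom_simps[OF \<pi>(1)])
qed

lemma continuous_star: "continuous_on X (star :: 'a \<Rightarrow> 'a::unital_cstar_algebra)"
proof -
  have "bounded_linear (star :: 'a \<Rightarrow> 'a)"
    by (rule bounded_linear_intro[where K = 1])
       (simp_all add: star_add scaleR_scaleC star_scaleC norm_star)
  then show ?thesis by (rule linear_continuous_on)
qed

lemma closed_map_image:
  assumes "continuous_on UNIV f" "\<And>x. x \<in> X \<Longrightarrow> f x \<in> closure X" "x \<in> closure X"
  shows "f x \<in> closure X"
proof -
  have "f ` closure X \<subseteq> closure X"
    using assms(2) by (intro image_closure_subset continuous_on_subset[OF assms(1)]) auto
  then show ?thesis using assms(3) by blast
qed

lemma closure_range_eval_free:
  assumes "star_hom \<pi>" "cstar_generates (insert V (range \<pi>))"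
  shows "closure (range (eval_free \<pi> V)) = UNIV"
proof -
  define R where "R = range (eval_free \<pi> V)"
  have R: "x + y \<in> R" "x * y \<in> R" "c *\<^sub>C x \<in> R" "star x \<in> R" if "x \<in> R" "y \<in> R" for x y c
    using that unfolding R_def
    by (auto simp flip: eval_free_add eval_free_mult eval_free_scaleC eval_free_star[OF assms(1)])
  have gen: "0 \<in> R" "1 \<in> R" "V \<in> R" "\<pi> a \<in> R" for a
    unfolding R_def by (metis eval_free_0 eval_free_gens rangeI)+
  have cl: "x \<in> closure R" if "x \<in> R" for x
    using that closure_subset by blast
  have add1: "x + y \<in> closure R" if "x \<in> R" "y \<in> closure R" for x y
    by (rule closed_map_image[where f = "\<lambda>y. x + y", OF _ _ that(2)])
       (auto intro!: continuous_intros cl R(1) that(1))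
  have add: "x + y \<in> closure R" if "x \<in> closure R" "y \<in> closure R" for x y
    by (rule closed_map_image[where f = "\<lambda>x. x + y", OF _ _ that(1)])
       (auto intro!: continuous_intros add1 that(2))
  have mult1: "x * y \<in> closure R" if "x \<in> R" "y \<in> closure R" for x y
    by (rule closed_map_image[where f = "\<lambda>y. x * y", OF _ _ that(2)])
       (auto intro!: continuous_intros cl R(2) that(1))
  have mult: "x * y \<in> closure R" if "x \<in> closure R" "y \<in> closure R" for x y
    by (rule closed_map_image[where f = "\<lambda>x. x * y", OF _ _ that(1)])
       (auto intro!: continuous_intros mult1 that(2))
  have scale: "c *\<^sub>C x \<in> closure R" if "x \<in> closure R" for c x
    by (rule closed_map_image[where f = "\<lambda>x. c *\<^sub>C x", OF _ _ that])
       (auto intro: cl R(3) linear_continuous_on[OF bounded_linear_scaleC])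
  have star: "star x \<in> closure R" if "x \<in> closure R" for x
    by (rule closed_map_image[where f = star, OF _ _ that])
       (auto intro: cl R(4) continuous_star)
  have "cstar_subalgebra (closure R)"
    unfolding cstar_subalgebra_def complex_vector.subspace_def
    using gen(1,2) add mult scale star by (simp add: cl)
  moreover have "insert V (range \<pi>) \<subseteq> closure R"
    using gen(3,4) cl by blast
  ultimately show ?thesis
    using assms(2) by (simp add: cstar_generates_def R_def)
qed

lemma toeplitz_universal:
  fixes i :: "'a::unital_cstar_algebra \<Rightarrow> 't::unital_cstar_algebra"
    and \<pi> :: "'a \<Rightarrow> 'b::unital_cstar_algebra"
  assumes T: "toeplitz_algebra \<alpha> L i S" and B: "toeplitz_rep \<alpha> L \<pi> V"
  shows "\<exists>!\<phi>. unital_star_hom \<phi> \<and> continuous_on UNIV \<phi> \<and> (\<forall>a. \<phi> (i a) = \<pi> a) \<and> \<phi> S = V"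
proof -
  let ?e = "eval_free i S" and ?d = "eval_free \<pi> V"
  have i: "star_hom i" "i 1 = 1" and \<pi>: "star_hom \<pi>" "\<pi> 1 = 1"
    using T B by (auto simp: toeplitz_algebra_def toeplitz_rep_def unital_star_hom_def)
  have dense: "closure (range ?e) = UNIV"
    using T i(1) closure_range_eval_free by (auto simp: toeplitz_algebra_def)
  have le: "norm (?d f) \<le> norm (?e f)" for f
    using T cstar_seminorm_rep[OF B] by (auto simp: toeplitz_algebra_def)
  have le': "norm (?d f - ?d g) \<le> norm (?e f - ?e g)" for f g
    using le[of "f - g"] by (simp add: eval_free_diff)
  define h where "h x = ?d (SOME f. ?e f = x)" for x
  have h: "h (?e f) = ?d f" for f
    using le'[of "SOME g. ?e g = ?e f" f] someI[of "\<lambda>g. ?e g = ?e f" f] by (simp add: h_def)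
  have "uniformly_continuous_on (range ?e) h"
    unfolding uniformly_continuous_on_def
    using le' by (auto simp: dist_norm h intro!: exI intro: le_less_trans)
  from uniformly_continuous_on_extension_on_closure[OF this]
  obtain \<phi> where "uniformly_continuous_on UNIV \<phi>" and \<phi>h: "\<And>x. x \<in> range ?e \<Longrightarrow> h x = \<phi> x"
    using dense by metis
  then have cont: "continuous_on UNIV \<phi>"
    by (simp add: uniformly_continuous_imp_continuous)
  have \<phi>: "\<phi> (?e f) = ?d f" for f
    using \<phi>h[of "?e f"] h by simp
  have cont': "continuous_on UNIV (\<lambda>x. \<phi> (k x))" if "continuous_on UNIV k" for k :: "'t \<Rightarrow> 't"
    using continuous_on_compose2[OF cont that] by simp
  have agree: "k x = l x"
    if "continuous_on UNIV k" "continuous_on UNIV l" "\<And>f. k (?e f) = l (?e f)"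
    for k l :: "'t \<Rightarrow> 'b" and x
  proof -
    have "closed {x. k x = l x}"
      using closed_Collect_eq[OF that(1,2)] .
    then have "closure (range ?e) \<subseteq> {x. k x = l x}"
      using that(3) by (intro closure_minimal) auto
    then show ?thesis using dense by auto
  qed
  have sc: "continuous_on X (\<lambda>x. c *\<^sub>C (x::'t))" "continuous_on Y (\<lambda>x. c *\<^sub>C (x::'b))" for c X Y
    by (rule linear_continuous_on[OF bounded_linear_scaleC])+
  have add1: "\<phi> (?e f + y) = \<phi> (?e f) + \<phi> y" for f y
    by (rule agree[of "\<lambda>y. \<phi> (?e f + y)" "\<lambda>y. \<phi> (?e f) + \<phi> y"])
       (auto intro!: continuous_intros cont cont' simp: \<phi> simp flip: eval_free_add)
  have add: "\<phi> (x + y) = \<phi> x + \<phi> y" for x y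
    by (rule agree[of "\<lambda>x. \<phi> (x + y)" "\<lambda>x. \<phi> x + \<phi> y"])
       (auto intro!: continuous_intros cont cont' simp: add1)
  have mult1: "\<phi> (?e f * y) = \<phi> (?e f) * \<phi> y" for f y
    by (rule agree[of "\<lambda>y. \<phi> (?e f * y)" "\<lambda>y. \<phi> (?e f) * \<phi> y"])
       (auto intro!: continuous_intros cont cont' simp: \<phi> simp flip: eval_free_mult)
  have mult: "\<phi> (x * y) = \<phi> x * \<phi> y" for x y
    by (rule agree[of "\<lambda>x. \<phi> (x * y)" "\<lambda>x. \<phi> x * \<phi> y"])
       (auto intro!: continuous_intros cont cont' simp: mult1)
  have scale: "\<phi> (c *\<^sub>C x) = c *\<^sub>C \<phi> x" for c x
    by (rule agree[of "\<lambda>x. \<phi> (c *\<^sub>C x)" "\<lambda>x. c *\<^sub>C \<phi> x"])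
       (auto intro!: cont' sc continuous_on_compose2[OF sc(2) cont] simp: \<phi>
        simp flip: eval_free_scaleC)
  have star: "\<phi> (star x) = star (\<phi> x)" for x
    by (rule agree[of "\<lambda>x. \<phi> (star x)" "\<lambda>x. star (\<phi> x)"])
       (auto intro!: cont' continuous_star continuous_on_compose2[OF continuous_star cont] simp: \<phi>
        simp flip: eval_free_star[OF i(1)] eval_free_star[OF \<pi>(1)])
  have lin: "clinear \<phi>"
    by (simp add: Vector_Spaces.linear_iff complex_vector.vector_space_axioms add scale)
  show ?thesis
  proof (rule ex1I[of _ \<phi>])
    have "\<phi> (i a) = \<pi> a" "\<phi> S = V" "\<phi> 1 = 1" for a
      using \<phi>[of "free_elt a"] \<phi>[of free_gen] \<phi>[of 1] by (simp_all add: eval_free_gens)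
    then show "unital_star_hom \<phi> \<and> continuous_on UNIV \<phi> \<and> (\<forall>a. \<phi> (i a) = \<pi> a) \<and> \<phi> S = V"
      using lin mult star cont by (simp add: unital_star_hom_def star_hom_def)
  next
    fix \<psi>
    assume \<psi>: "unital_star_hom \<psi> \<and> continuous_on UNIV \<psi> \<and> (\<forall>a. \<psi> (i a) = \<pi> a) \<and> \<psi> S = V"
    then have \<psi>s: "star_hom \<psi>" "\<psi> 1 = 1" by (auto simp: unital_star_hom_def)
    have letter: "\<psi> (eval_letter i S l) = eval_letter \<pi> V l" for l
      using \<psi> by (cases l) (simp_all add: star_hom_simps[OF \<psi>s(1)])
    have "\<psi> (prod_list (map (eval_letter i S) ls)) = prod_list (map (eval_letter \<pi> V) ls)" for ls
      by (induction ls) (simp_all add: \<psi>s(2) letter star_hom_simps[OF \<psi>s(1)])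
    moreover have "\<psi> 0 = 0"
      using star_hom_simps(1)[OF \<psi>s(1), of 0 0] by simp
    then have "\<psi> (sum k X) = (\<Sum>x\<in>X. \<psi> (k x))" for k and X :: "'a free_word set"
      by (induction X rule: infinite_finite_induct) (simp_all add: star_hom_simps[OF \<psi>s(1)])
    ultimately have "\<psi> (?e f) = ?d f" for f
      by (simp add: eval_free_def star_hom_simps[OF \<psi>s(1)])
    then have eq: "\<psi> (?e f) = \<phi> (?e f)" for f
      by (simp only: \<phi>)
    have "continuous_on UNIV \<psi>" using \<psi> by blast
    from agree[OF this cont eq] show "\<psi> = \<phi>" by (rule ext)
  qed
qed

section \<open>Exel's crossed product\<close>

definition redundancy :: "('a::unital_cstar_algebra \<Rightarrow> 't::unital_cstar_algebra) \<Rightarrow> 't \<Rightarrow> 'a \<Rightarrow> 't \<Rightarrow> bool" where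
  "redundancy i S a k \<longleftrightarrow> k \<in> closed_span {i b * S * star S * i c | b c. True} \<and>
     (\<forall>b. i a * i b * S = k * i b * S)"

definition redundancy_ideal ::
    "('a::unital_cstar_algebra \<Rightarrow> 'a) \<Rightarrow> ('a \<Rightarrow> 't::unital_cstar_algebra) \<Rightarrow> 't \<Rightarrow> 't set" where
  "redundancy_ideal \<alpha> i S =
     closed_ideal_generated {i a - k | a k. redundancy i S a k \<and> a \<in> A_alpha_A \<alpha>}"

text \<open>\<open>Q\<close> is the quotient map of the Toeplitz algebra onto the crossed product \<open>'c\<close>. The norm of
  \<open>'c\<close> is then necessarily the quotient norm.\<close>

definition exel_quotient ::
    "('a::unital_cstar_algebra \<Rightarrow> 'a) \<Rightarrow> ('a \<Rightarrow> 't::unital_cstar_algebra) \<Rightarrow> 't \<Rightarrow>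
     ('t \<Rightarrow> 'c::unital_cstar_algebra) \<Rightarrow> bool" where
  "exel_quotient \<alpha> i S Q \<longleftrightarrow> unital_star_hom Q \<and> surj Q \<and> {x. Q x = 0} = redundancy_ideal \<alpha> i S"

end

theory Submission
  imports Defs
begin

text \<open>
  If \<open>a \<in> K\<^sub>\<alpha>\<close> acts as zero on \<open>M\<^sub>L\<close>, then \<open>(i\<^sub>A a, 0)\<close> is a redundancy, so almost faithfulness
  is necessary. For the converse, the Toeplitz algebra acts on the Fock module of \<open>M\<^sub>L\<close>, where
  \<open>i\<^sub>A a - k\<close>, for a redundancy \<open>(i\<^sub>A a, k)\<close>, becomes the action of \<open>a\<close> on the vacuum summand. Hence
  every \<open>x\<close> in the redundancy ideal has matrix coefficients in the closure of the redundant
  elements, a subset of \<open>K\<^sub>\<alpha>\<close>, and its norm on the \<open>n\<close>-th summand tends to zero. On the other hand,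
  if \<open>L\<close> is almost faithful on \<open>K\<^sub>\<alpha>\<close>, then an \<open>a\<close> with \<open>i\<^sub>A a\<close> in the redundancy ideal that
  acts as zero on the \<open>n\<close>-th summand acts as zero on the one before, and so vanishes. Applied to
  \<open>p\<^sup>2 h\<close>, where \<open>h = star a * a\<close> and \<open>p\<close> is a multiple of the positive part of \<open>h - \<parallel>h\<parallel>/2\<close>, this
  shows that \<open>h\<close> acts with norm at least \<open>\<parallel>h\<parallel>/2\<close> on every summand, a contradiction unless \<open>a = 0\<close>.

  No operator algebra is built on the Fock module: by the universal property, it is enough that the
  operator norm is a C*-seminorm on the free *-algebra. All bounds are inequalities in
  the order of \<open>A\<close>, which makes the Cauchy--Schwarz inequality unnecessary.
\<close>

section \<open>Positivity in C*-algebras\<close>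

text \<open>Almost faithfulness passes only an exact zero from one summand to the one before, while
  membership in a closed ideal yields mere smallness in high degree. The cut-off at
  \<open>s = norm h / 2\<close> bridges the two: on the part of \<open>h\<close> above
  \<open>s\<close>, acting with bound at most \<open>s\<close> forces an exact zero. The factor
  \<open>h\<close> in \<open>p * p * h\<close> keeps the element in the ideal, so that the descent
  has its matrix coefficients at its disposal. Membership in the auxiliary ideals is tested on a
  single approximant. This loses nothing: \<open>fock_norm f\<close> is at most
  \<open>norm (eval f)\<close>, so two approximants that are close in the Toeplitz algebra have
  nearly the same Fock operator. The order theory rests on the C*-identity and completeness alone.
  Positivity is handled through the condition that \<open>t *\<^sub>R 1 - h\<close> has norm at most
  \<open>t\<close>, which adds up, survives limits and is visible in any isometric image. Norm
  estimates come from viewing a selfadjoint element as the real part of a normal one.\<close>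

lemma star_minus: "star (- x) = - star (x::'a::unital_cstar_algebra)"
  by (metis add_eq_0_iff star_0 star_add)

lemma star_diff: "star (x - y) = star x - star (y::'a::unital_cstar_algebra)"
  by (metis diff_conv_add_uminus star_add star_minus)

lemma star_scaleR: "star (r *\<^sub>R x) = r *\<^sub>R star (x::'a::unital_cstar_algebra)"
  by (simp add: scaleR_scaleC star_scaleC)

lemmas star_simps = star_add star_mult star_star star_0 star_1 star_minus star_diff star_scaleR

text \<open>Only an inequality, because the unit of the zero algebra has norm 0.\<close>

lemma norm_one_le: "norm (1::'a::unital_cstar_algebra) \<le> 1"
  using cstar_identity[of "1::'a"] by (auto simp: star_1 power2_eq_square)

lemma star_mult_self_eq_0: "star x * x = 0 \<longleftrightarrow> x = (0::'a::unital_cstar_algebra)"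
  using cstar_identity[of x] by auto

lemma selfadjoint_square_eq_0: "star x = x \<Longrightarrow> x * x = 0 \<longleftrightarrow> x = (0::'a::unital_cstar_algebra)"
  using star_mult_self_eq_0[of x] by simp

lemma norm_selfadjoint_square:
  "star x = x \<Longrightarrow> norm (x * x) = (norm (x::'a::unital_cstar_algebra))\<^sup>2"
  using cstar_identity[of x] by simp

text \<open>The normal element \<open>u = h + \<i> *\<^sub>C c\<close> has
  \<open>star u * u = h * h + c * c\<close> and real part \<open>h\<close>, and a real part is no
  larger in norm than the element. The norm bounds for \<open>psd\<close> below come from choosing
  \<open>c\<close> so that \<open>h * h + c * c\<close> is known.\<close>

lemma norm_selfadjoint_le:
  fixes h c :: "'a::unital_cstar_algebra"
  assumes "star h = h" "star c = c" "h * c = c * h"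
  shows "(norm h)\<^sup>2 \<le> norm (h * h + c * c)"
proof -
  define u where "u = h + \<i> *\<^sub>C c"
  have su: "star u = h - \<i> *\<^sub>C c"
    by (simp add: u_def star_simps star_scaleC assms)
  have "star u * u = h * h + c * c"
    unfolding su unfolding u_def
    by (simp add: algebra_simps scaleC_mult_left scaleC_mult_right scaleC_scaleC assms(3)
        complex_vector.scale_minus_left scaleC_one)
  then have u: "(norm u)\<^sup>2 = norm (h * h + c * c)"
    by (metis cstar_identity)
  have "2 *\<^sub>R h = u + star u"
    unfolding su by (simp add: u_def scaleR_2)
  then have "2 * norm h \<le> norm u + norm (star u)"
    by (metis norm_triangle_ineq norm_scaleR abs_numeral)
  then have "norm h \<le> norm u" by (simp add: norm_star)
  then show ?thesis using u by (metis norm_ge_zero power_mono)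
qed

text \<open>Visser's iteration \<open>y \<mapsto> (t + y\<^sup>2) / 2\<close> is dominated by its scalar case \<open>t = 1\<close>, and
  its limit is \<open>1 - \<surd>(1 - t)\<close>.\<close>

lemma sqrt_one_minus:
  fixes t :: "'a::unital_cstar_algebra"
  assumes t: "star t = t" "norm t \<le> 1"
  obtains k where "star k = k" "k * k = 1 - t" "norm (1 - k) \<le> 1"
    "\<And>z. t * z = z * t \<Longrightarrow> k * z = z * k"
proof -
  define y where "y = rec_nat (0::'a) (\<lambda>_ u. (1/2) *\<^sub>R (t + u * u))"
  define r where "r = rec_nat (0::real) (\<lambda>_ u. (1/2) * (1 + u * u))"
  have y: "y 0 = 0" "\<And>n. y (Suc n) = (1/2) *\<^sub>R (t + y n * y n)" by (simp_all add: y_def)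
  have r: "r 0 = 0" "\<And>n. r (Suc n) = (1/2) * (1 + r n * r n)" by (simp_all add: r_def)
  have r01: "0 \<le> r n \<and> r n \<le> 1" for n
    by (induction n) (auto simp: r intro: mult_le_one)
  have yc: "y n * z = z * y n" if "t * z = z * t" for n z
  proof (induction n)
    case (Suc n)
    have "y n * y n * z = z * (y n * y n)" by (metis Suc mult.assoc)
    then show ?case using that by (simp add: y algebra_simps)
  qed (simp add: y)
  have yy: "y n * y m = y m * y n" for n m
    by (rule yc, rule yc[symmetric]) simp
  have yn: "norm (y n) \<le> r n" for n
  proof (induction n)
    case (Suc n)
    have "norm (t + y n * y n) \<le> 1 + r n * r n"
      by (intro order_trans[OF norm_triangle_ineq] add_mono t order_trans[OF norm_mult_ineq]
          mult_mono Suc) (use r01 in auto)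
    then show ?case by (simp add: y r)
  qed (simp add: y r)
  have step: "norm (y (Suc n) - y n) \<le> r (Suc n) - r n" for n
  proof (induction n)
    case (Suc n)
    \<comment> \<open>The factorisation of the difference of squares needs the iterates to commute.
      The same identity for \<open>r\<close> turns the estimate into an increment of
      \<open>r\<close>.\<close>
    have "y (Suc (Suc n)) - y (Suc n) = (1/2) *\<^sub>R ((y (Suc n) + y n) * (y (Suc n) - y n))"
      unfolding y(2)[of "Suc n"] y(2)[of n, symmetric]
      by (subst (3) y(2)) (simp add: algebra_simps yy[of n "Suc n"])
    also have "norm \<dots> \<le> (1/2) * ((r (Suc n) + r n) * (r (Suc n) - r n))"
      using r01 Suc by (auto intro!: order_trans[OF norm_mult_ineq] mult_mono
          order_trans[OF norm_triangle_ineq] add_mono yn add_nonneg_nonneg)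
    also have "\<dots> = r (Suc (Suc n)) - r (Suc n)"
      by (simp add: r(2)[of "Suc n"]) (simp add: algebra_simps r(2)[of n])
    finally show ?case .
  qed (use t in \<open>simp add: y r\<close>)
  have diff: "norm (y (m + d) - y m) \<le> r (m + d) - r m" for m d
  proof (induction d)
    case (Suc d)
    have "norm ((y (Suc (m + d)) - y (m + d)) + (y (m + d) - y m))
        \<le> (r (Suc (m + d)) - r (m + d)) + (r (m + d) - r m)"
      by (intro order_trans[OF norm_triangle_ineq] add_mono step Suc)
    then show ?case by simp
  qed simp
  have "incseq r"
    using order_trans[OF norm_ge_zero step] by (intro incseq_SucI) simp
  then have "Cauchy r"
    using r01 by (meson incseq_convergent LIMSEQ_imp_Cauchy)
  have "Cauchy y"
    unfolding Cauchy_altdef2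
  proof (intro allI impI)
    fix e :: real assume "e > 0"
    then obtain N where N: "\<forall>n\<ge>N. dist (r n) (r N) < e"
      using \<open>Cauchy r\<close> unfolding Cauchy_altdef2 by blast
    have "dist (y n) (y N) < e" if "n \<ge> N" for n
      using diff[of N "n - N"] N that by (force simp: dist_norm)
    then show "\<exists>N. \<forall>n\<ge>N. dist (y n) (y N) < e" by blast
  qed
  then obtain l where l: "y \<longlonglongrightarrow> l"
    using Cauchy_convergent_iff convergentD by blast
  have "(\<lambda>n. y (Suc n)) \<longlonglongrightarrow> (1/2) *\<^sub>R (t + l * l)"
    unfolding y by (intro tendsto_intros l)
  then have leq: "l = (1/2) *\<^sub>R (t + l * l)"
    using LIMSEQ_Suc[OF l] LIMSEQ_unique by blast
  then have "2 *\<^sub>R l = t + l * l"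
    by (metis divide_self_if mult.commute scaleR_scaleR scaleR_one times_divide_eq_right
        zero_neq_numeral mult_1)
  then have ll: "l * l = l + l - t" by (simp add: scaleR_2 algebra_simps)
  have "star (y n) = y n" for n
    by (induction n) (simp_all add: y star_simps t)
  then have "star l = l"
    using l LIMSEQ_unique continuous_on_tendsto_compose[OF continuous_star l, of UNIV] by simp
  moreover have "l * z = z * l" if "t * z = z * t" for z
  proof (rule LIMSEQ_unique)
    show "(\<lambda>n. y n * z) \<longlonglongrightarrow> l * z" "(\<lambda>n. y n * z) \<longlonglongrightarrow> z * l"
      by (intro tendsto_intros l) (simp add: yc[OF that], intro tendsto_intros l)
  qed
  moreover have "norm l \<le> 1"
    by (rule LIMSEQ_le_const2[OF tendsto_norm[OF l]]) (meson order_trans yn r01)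
  ultimately show ?thesis
    by (intro that[of "1 - l"]) (simp_all add: star_simps algebra_simps ll)
qed

text \<open>A more convenient form of positivity, to which it is equivalent by \<open>positive_iff_psd\<close> below.\<close>

definition psd :: "'a::unital_cstar_algebra \<Rightarrow> bool" where
  "psd h \<longleftrightarrow> (\<exists>k. star k = k \<and> h = k * k)"

lemma psd_selfadjoint: "psd h \<Longrightarrow> star h = h"
  by (auto simp: psd_def star_simps)

lemma psd_square: "star k = k \<Longrightarrow> psd (k * k)"
  by (auto simp: psd_def)

lemma psd_scaleR: "psd h \<Longrightarrow> 0 \<le> r \<Longrightarrow> psd (r *\<^sub>R h)"
proof -
  assume "psd h" "0 \<le> r"
  then obtain k where k: "star k = k" "h = k * k" by (auto simp: psd_def)
  show ?thesis
    unfolding psd_def using k \<open>0 \<le> r\<close>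
    by (intro exI[of _ "sqrt r *\<^sub>R k"]) (simp add: star_simps)
qed

lemma psd_0: "psd 0"
  using psd_square[of 0] by (simp add: star_0)

text \<open>Rescaling to \<open>g = 1 - (1/t) *\<^sub>R h\<close> puts \<open>g\<close> in the unit
  ball. The bound on \<open>sqrt t *\<^sub>R 1 - k\<close> is kept because it is the hypothesis
  again, now for \<open>k\<close>: it makes the root itself positive in
  \<open>psd_sqrt\<close>.\<close>

lemma psd_sqrt_aux:
  fixes h :: "'a::unital_cstar_algebra"
  assumes h: "star h = h" and t: "norm (t *\<^sub>R 1 - h) \<le> t" "0 < t"
  obtains k where "star k = k" "k * k = h" "norm (sqrt t *\<^sub>R 1 - k) \<le> sqrt t"
    "\<And>z. h * z = z * h \<Longrightarrow> k * z = z * k"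
proof -
  define g where "g = 1 - (1/t) *\<^sub>R h"
  have "t *\<^sub>R g = t *\<^sub>R 1 - h" using t by (simp add: g_def algebra_simps)
  then have "t * norm g \<le> t" using t by (metis norm_scaleR abs_of_pos)
  then have "norm g \<le> 1" using t by simp
  moreover have "star g = g" by (simp add: g_def star_simps h)
  ultimately obtain k where k: "star k = k" "k * k = 1 - g" "norm (1 - k) \<le> 1"
    "\<And>z. g * z = z * g \<Longrightarrow> k * z = z * k"
    using sqrt_one_minus by blast
  show ?thesis
  proof (rule that[of "sqrt t *\<^sub>R k"])
    show "star (sqrt t *\<^sub>R k) = sqrt t *\<^sub>R k" by (simp add: star_simps k)
    show "sqrt t *\<^sub>R k * sqrt t *\<^sub>R k = h" using t by (simp add: k(2) g_def)
    show "norm (sqrt t *\<^sub>R 1 - sqrt t *\<^sub>R k) \<le> sqrt t"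
      unfolding scaleR_diff_right[symmetric] using k(3) t by simp
    show "sqrt t *\<^sub>R k * z = z * sqrt t *\<^sub>R k" if "h * z = z * h" for z
    proof -
      have "g * z = z * g" using that by (simp add: g_def algebra_simps)
      from k(4)[OF this] show ?thesis by simp
    qed
  qed
qed

lemma psd_if_norm_le:
  fixes h :: "'a::unital_cstar_algebra"
  assumes "star h = h" "norm (t *\<^sub>R 1 - h) \<le> t"
  shows "psd h"
proof (cases "t = 0")
  case True
  then show ?thesis using assms psd_0 by simp
next
  case False
  have "0 < t" using False assms(2) norm_ge_zero order_trans order_less_le by metis
  then show ?thesis using psd_sqrt_aux[OF assms] psd_def by metis
qed

text \<open>Converse of \<open>psd_if_norm_le\<close>. With \<open>g = (1/t) *\<^sub>R h\<close> a
  square and \<open>c\<close> a root of \<open>1 - g\<close>, the two squares add up to 1, so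
  \<open>norm c\<close> is at most 1, and \<open>norm (1 - g)\<close> is the square of
  \<open>norm c\<close>.\<close>

lemma psd_norm_le:
  fixes h :: "'a::unital_cstar_algebra"
  assumes "psd h" "norm h \<le> t"
  shows "norm (t *\<^sub>R 1 - h) \<le> t"
proof (cases "t = 0")
  case False
  then have t: "0 < t" using assms(2) norm_ge_zero order_trans order_less_le by metis
  obtain k where k: "star k = k" "h = k * k" using assms by (auto simp: psd_def)
  define g where "g = (1/t) *\<^sub>R h"
  have g: "g = ((1/sqrt t) *\<^sub>R k) * ((1/sqrt t) *\<^sub>R k)"
    using t by (simp add: g_def k)
  have "norm g \<le> 1" using assms t by (simp add: g_def)
  moreover have "star g = g" by (simp add: g_def k star_simps)
  ultimately obtain c where c: "star c = c" "c * c = 1 - g"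
    "\<And>z. g * z = z * g \<Longrightarrow> c * z = z * c"
    using sqrt_one_minus by blast
  have "(norm c)\<^sup>2 \<le> norm (c * c + (1/sqrt t) *\<^sub>R k * (1/sqrt t) *\<^sub>R k)"
    by (rule norm_selfadjoint_le) (auto simp: star_simps c k g mult.assoc intro!: c(3))
  then have "(norm c)\<^sup>2 \<le> 1" unfolding g[symmetric] c using norm_one_le[where 'a='a] by auto
  then have "norm (1 - g) \<le> 1" using norm_selfadjoint_square[OF c(1)] c(2) by simp
  moreover have "t *\<^sub>R 1 - h = t *\<^sub>R (1 - g)" using t by (simp add: g_def algebra_simps)
  ultimately show ?thesis using t by simp
qed (use assms in simp)

text \<open>The ball conditions for \<open>h\<close> and \<open>k\<close>, with radii
  \<open>norm h\<close> and \<open>norm k\<close>, add up by the triangle inequality; square roots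
  give no direct access to a sum.\<close>

lemma psd_add:
  fixes h k :: "'a::unital_cstar_algebra"
  assumes "psd h" "psd k"
  shows "psd (h + k)"
proof (rule psd_if_norm_le)
  show "star (h + k) = h + k" using assms by (simp add: star_simps psd_selfadjoint)
  have "(norm h + norm k) *\<^sub>R 1 - (h + k) = (norm h *\<^sub>R 1 - h) + (norm k *\<^sub>R 1 - k)"
    by (simp add: algebra_simps)
  then show "norm ((norm h + norm k) *\<^sub>R 1 - (h + k)) \<le> norm h + norm k"
    using norm_triangle_mono psd_norm_le assms by (metis order_refl)
qed

lemma psd_sqrt:
  fixes h :: "'a::unital_cstar_algebra"
  assumes "psd h"
  obtains k where "psd k" "k * k = h" "\<And>z. h * z = z * h \<Longrightarrow> k * z = z * k"
proof -
  have "norm ((norm h + 1) *\<^sub>R 1 - h) \<le> norm h + 1"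
    by (intro psd_norm_le assms) simp
  then obtain k where k: "star k = k" "k * k = h"
      "norm (sqrt (norm h + 1) *\<^sub>R 1 - k) \<le> sqrt (norm h + 1)"
      "\<And>z. h * z = z * h \<Longrightarrow> k * z = z * k"
    using psd_sqrt_aux[OF psd_selfadjoint[OF assms]]
    by (metis add_nonneg_pos norm_ge_zero zero_less_one)
  then show ?thesis using that psd_if_norm_le by blast
qed

lemma psd_mult_commute:
  fixes h k :: "'a::unital_cstar_algebra"
  assumes "psd h" "psd k" "h * k = k * h"
  shows "psd (h * k)"
proof -
  obtain a where a: "psd a" "a * a = h" "\<And>z. h * z = z * h \<Longrightarrow> a * z = z * a"
    using psd_sqrt[OF assms(1)] by blast
  obtain b where b: "psd b" "b * b = k" "\<And>z. k * z = z * k \<Longrightarrow> b * z = z * b"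
    using psd_sqrt[OF assms(2)] by blast
  have ab: "b * a = a * b" using a(3)[of k] assms(3) b(3)[of a] by simp
  have "star (a * b) = a * b" by (simp add: star_simps psd_selfadjoint a b ab)
  moreover have "h * k = (a * b) * (a * b)"
    by (metis ab a(2) b(2) mult.assoc)
  ultimately show ?thesis by (simp add: psd_square)
qed

text \<open>The commuting product \<open>- h * h\<close> is positive. Its root \<open>m\<close>
  satisfies \<open>h * h + m * m = 0\<close>, and \<open>norm_selfadjoint_le\<close> then gives
  \<open>h = 0\<close>.\<close>

lemma psd_antisym:
  fixes h :: "'a::unital_cstar_algebra"
  assumes "psd h" "psd (- h)"
  shows "h = 0"
proof -
  have "psd (- h * h)"
    by (rule psd_mult_commute) (simp_all add: assms)
  then obtain m where m: "star m = m" "m * m = - h * h" "\<And>z. - h * h * z = z * (- h * h) \<Longrightarrow> m * z = z * m"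
    using psd_sqrt psd_selfadjoint by metis
  have "h * m = m * h"
    by (rule m(3)[symmetric]) (simp add: mult.assoc)
  with norm_selfadjoint_le[OF psd_selfadjoint[OF assms(1)] m(1)]
  show ?thesis using m(2) by simp
qed

text \<open>Centring at \<open>s/2\<close>: for \<open>h = (s/2) *\<^sub>R 1 - a\<close> and a root
  \<open>k\<close> of \<open>a * (s *\<^sub>R 1 - a)\<close>, the sum \<open>h * h + k * k\<close>
  is the scalar \<open>(s/2)\<^sup>2\<close>, whence \<open>norm h \<le> s/2\<close>.\<close>

lemma norm_le_if_psd:
  fixes a :: "'a::unital_cstar_algebra"
  assumes "psd a" "psd (s *\<^sub>R 1 - a)" "0 \<le> s"
  shows "norm a \<le> s"
proof -
  define h where "h = (s/2) *\<^sub>R 1 - a"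
  have sa: "star a = a" using assms psd_selfadjoint by blast
  have h: "star h = h" by (simp add: h_def star_simps sa)
  have "psd (a * (s *\<^sub>R 1 - a))"
    by (rule psd_mult_commute) (auto simp: assms algebra_simps)
  then obtain k where k: "star k = k" "k * k = a * (s *\<^sub>R 1 - a)"
      "\<And>z. a * (s *\<^sub>R 1 - a) * z = z * (a * (s *\<^sub>R 1 - a)) \<Longrightarrow> k * z = z * k"
    using psd_sqrt psd_selfadjoint by metis
  have "a * (s *\<^sub>R 1 - a) * a = a * (a * (s *\<^sub>R 1 - a))" by (simp add: algebra_simps)
  from k(3)[OF this] have "h * k = k * h" by (simp add: h_def algebra_simps)
  from norm_selfadjoint_le[OF h k(1) this]
  have "(norm h)\<^sup>2 \<le> norm (h * h + k * k)" .
  also have "h * h + k * k = (s/2)\<^sup>2 *\<^sub>R 1"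
    unfolding k(2) by (simp add: h_def algebra_simps power2_eq_square)
      (simp add: scaleR_left_distrib[symmetric])
  also have "norm \<dots> \<le> (s/2)\<^sup>2"
    using norm_one_le[where 'a='a] by (simp add: mult_left_le)
  finally have "norm h \<le> s/2" using assms(3) by (simp add: power2_le_iff_abs_le)
  moreover have "a = (s/2) *\<^sub>R 1 - h" by (simp add: h_def)
  moreover have "norm ((s/2) *\<^sub>R (1::'a)) \<le> s/2"
    using norm_one_le[where 'a='a] assms(3) by (simp add: mult_left_le)
  ultimately show ?thesis using norm_triangle_ineq4[of "(s/2) *\<^sub>R 1" h] by simp
qed

lemma psd_norm_diff:
  fixes h :: "'a::unital_cstar_algebra"
  assumes "star h = h" "norm h \<le> s"
  shows "psd (s *\<^sub>R 1 - h)"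
  by (rule psd_if_norm_le[where t = s]) (use assms in \<open>simp_all add: star_simps\<close>)

text \<open>With \<open>k = |h|\<close>, the element \<open>p = k + h\<close> is twice the positive part of \<open>h\<close>. The relation
  \<open>p\<^sup>3 = 2 k p\<^sup>2\<close> replaces its positivity.\<close>

lemma positive_part:
  fixes h :: "'a::unital_cstar_algebra"
  assumes "star h = h"
  obtains k p where "psd k" "p = k + h" "h * p = p * h" "2 *\<^sub>R (h * p) = p * p" "star p = p" "psd (p * p * p)"
proof -
  obtain k where k: "psd k" "k * k = h * h" "\<And>z. h * h * z = z * (h * h) \<Longrightarrow> k * z = z * k"
    using psd_sqrt[OF psd_square[OF assms]] by blast
  have hk: "k * h = h * k" by (rule k(3)) (simp add: mult.assoc)
  define p where "p = k + h"
  have p: "star p = p" by (simp add: p_def star_simps assms psd_selfadjoint k)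
  have kp: "k * p = p * k" by (simp add: p_def algebra_simps hk)
  have "p * p = 2 *\<^sub>R (k * p)" by (simp add: p_def algebra_simps hk k(2) scaleR_2)
  then have "p * p * p = (2 *\<^sub>R k) * (p * p)" by (metis mult.assoc mult_scaleR_left)
  moreover have "psd ((2 *\<^sub>R k) * (p * p))"
    by (rule psd_mult_commute) (auto intro: psd_scaleR psd_square p k simp: kp mult.assoc, metis kp mult.assoc)
  ultimately show ?thesis
    using k(1) p hk by (intro that[of k p]) (simp_all add: p_def algebra_simps k(2) scaleR_2)
qed

text \<open>Normalise \<open>c\<close> to \<open>d\<close>, and put \<open>X = star d * d\<close>,
  \<open>Y = d * star d\<close>. Half the sum of the squares of \<open>x\<close> and
  \<open>y\<close>, which are twice the real and imaginary parts of \<open>d\<close> up to sign, is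
  \<open>X + Y\<close>; as \<open>- X\<close> is positive, so is \<open>Y\<close>. Now
  \<open>D n = d * (1 + X) ^ n * star d\<close> stays bounded because
  \<open>norm (1 + X) \<le> 1\<close>, but it equals \<open>Y * (1 + Y) ^ n\<close>, which dominates
  \<open>real n *\<^sub>R (Y * Y)\<close>. Hence \<open>Y = 0\<close>. This growth argument stands
  in for comparing the spectra of \<open>X\<close> and \<open>Y\<close>.\<close>

lemma psd_uminus_star_mult_self:
  fixes c :: "'a::unital_cstar_algebra"
  assumes c: "psd (- (star c * c))"
  shows "c = 0"
proof (rule ccontr)
  assume "c \<noteq> 0"
  define d where "d = (1 / norm c) *\<^sub>R c"
  have d1: "norm d = 1" using \<open>c \<noteq> 0\<close> by (simp add: d_def)
  define X Y where "X = star d * d" and "Y = d * star d"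
  have "X = (1 / (norm c)\<^sup>2) *\<^sub>R (star c * c)"
    by (simp add: X_def d_def star_simps power2_eq_square)
  then have X: "psd (- X)" using psd_scaleR[OF c, of "1 / (norm c)\<^sup>2"] by simp
  have "norm X \<le> 1" using d1 by (simp add: X_def cstar_identity)
  then have X1: "norm (1 + X) \<le> 1" using psd_norm_le[OF X, of 1] by simp
  define x y where "x = d + star d" and "y = \<i> *\<^sub>C (d - star d)"
  have "y * y = - ((d - star d) * (d - star d))"
    by (simp add: y_def scaleC_mult_left scaleC_mult_right scaleC_scaleC
        complex_vector.scale_minus_left scaleC_one)
  then have "x * x + y * y = (Y + X) + (Y + X)"
    by (simp add: X_def Y_def x_def algebra_simps)
  then have "Y + X = (1/2) *\<^sub>R (x * x + y * y)"
    by (metis scaleR_half_double)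
  moreover have "psd ((1/2) *\<^sub>R (x * x + y * y))"
    by (intro psd_scaleR psd_add psd_square)
      (simp_all add: x_def y_def star_simps star_scaleC add.commute complex_vector.scale_right_diff_distrib
        complex_vector.scale_minus_left)
  ultimately have "psd ((Y + X) + - X)" using X psd_add by metis
  then have Y: "psd Y" by simp
  define D where "D n = d * (1 + X) ^ n * star d" for n
  have Xp: "norm ((1 + X) ^ n) \<le> 1" for n
  proof (induction n)
    case (Suc n)
    have "norm ((1 + X) * (1 + X) ^ n) \<le> 1"
      by (rule order_trans[OF norm_mult_ineq mult_le_one[OF X1 norm_ge_zero Suc]])
    then show ?case by simp
  qed (simp add: norm_one_le)
  have D1: "norm (D n) \<le> 1" for n
    unfolding D_def
    by (intro order_trans[OF norm_mult_ineq] mult_le_one Xp norm_ge_zero) (simp_all add: d1 norm_star)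
  have DS: "D (Suc n) = D n + Y * D n" for n
    by (simp add: D_def X_def Y_def algebra_simps)
  have D0: "D 0 = Y" by (simp add: D_def Y_def)
  \<comment> \<open>The remainder of \<open>Y * (1 + Y) ^ n\<close> after the first two terms of its
    binomial expansion.\<close>
  define E where "E n = D n - Y - real n *\<^sub>R (Y * Y)" for n
  have E: "psd (E n) \<and> Y * E n = E n * Y" for n
  proof (induction n)
    case (Suc n)
    have ES: "E (Suc n) = E n + Y * E n + real n *\<^sub>R (Y * (Y * Y))"
      by (simp add: E_def DS algebra_simps)
    have "psd (E (Suc n))"
      unfolding ES using Suc Y
      by (intro psd_add psd_scaleR psd_mult_commute) (auto simp: mult.assoc psd_selfadjoint)
    moreover have "Y * E (Suc n) = E (Suc n) * Y"
      unfolding ES using Suc by (simp add: algebra_simps) (metis mult.assoc)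
    ultimately show ?case by blast
  qed (simp add: E_def D0 psd_0)
  have YY: "real n * norm (Y * Y) \<le> 1" for n
  proof -
    have eq: "D n = E n + Y + real n *\<^sub>R (Y * Y)" by (simp add: E_def)
    have nY: "psd (real n *\<^sub>R (Y * Y))" using Y by (simp add: psd_scaleR psd_square psd_selfadjoint)
    then have "psd (D n)" unfolding eq using E Y by (simp add: psd_add)
    then have "psd (1 *\<^sub>R 1 - D n)"
      using psd_norm_diff psd_selfadjoint D1 by blast
    then have "psd ((1 *\<^sub>R 1 - D n) + (E n + Y))"
      using E Y by (simp add: psd_add)
    then have "psd (1 *\<^sub>R 1 - real n *\<^sub>R (Y * Y))" by (simp add: eq)
    from norm_le_if_psd[OF nY this] show ?thesis by simp
  qed
  have "norm (Y * Y) = 0"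
  proof (rule ccontr)
    assume "norm (Y * Y) \<noteq> 0"
    then have "norm (Y * Y) > 0" by simp
    then obtain n where "real n * norm (Y * Y) > 1"
      using reals_Archimedean3 by blast
    then show False using YY[of n] by simp
  qed
  then have "Y = 0" using Y psd_selfadjoint selfadjoint_square_eq_0 by auto
  then have "star d = 0" using star_mult_self_eq_0[of "star d"] by (simp add: Y_def star_simps)
  then show False using d1 norm_star[of d] by simp
qed

text \<open>Let \<open>p\<close> be twice the positive part of \<open>- (star b * b)\<close>.
  Compression by \<open>p\<close> gives
  \<open>- (star (b * p) * (b * p)) = (1/2) *\<^sub>R (p * p * p)\<close>, which is positive, so the
  preceding lemma forces \<open>b * p = 0\<close>. Then \<open>p\<close> is nilpotent and
  selfadjoint, hence zero, and \<open>star b * b\<close> equals the positive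
  \<open>k\<close>.\<close>

theorem psd_star_mult_self:
  fixes b :: "'a::unital_cstar_algebra"
  shows "psd (star b * b)"
proof -
  let ?h = "- (star b * b)"
  have "star ?h = ?h" by (simp add: star_simps)
  then obtain k p where kp: "psd k" "p = k + ?h" "?h * p = p * ?h" "2 *\<^sub>R (?h * p) = p * p" "star p = p" "psd (p * p * p)"
    by (rule positive_part)
  have "2 *\<^sub>R (- (star (b * p) * (b * p))) = p * (2 *\<^sub>R (?h * p))"
    by (simp add: star_simps kp(5) mult.assoc)
  also have "\<dots> = p * p * p" unfolding kp(4) by (simp add: mult.assoc)
  finally have eq: "- (star (b * p) * (b * p)) = (1/2) *\<^sub>R (p * p * p)"
    by (metis scaleR_half_double scaleR_2)
  then have "psd (- (star (b * p) * (b * p)))" using kp by (simp add: psd_scaleR)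
  then have "b * p = 0" by (rule psd_uminus_star_mult_self)
  then have "p * p * p = 0" using eq by (metis mult_zero_right neg_equal_0_iff_equal scaleR_eq_0_iff
      divide_eq_0_iff zero_neq_numeral one_neq_zero)
  then have "p = 0"
    using selfadjoint_square_eq_0[OF kp(5)] selfadjoint_square_eq_0[of "p * p"]
    by (simp add: star_simps kp(5) mult.assoc[symmetric])
  then show ?thesis using kp by (metis add_eq_0_iff minus_minus)
qed

section \<open>The order on a C*-algebra\<close>

lemma positive_iff_psd: "positive a \<longleftrightarrow> psd a"
  using psd_star_mult_self by (auto simp: positive_def) (metis psd_def)

lemma scaleR_4: "4 *\<^sub>R z = z + (z + (z + z))" for z :: "'a::real_vector"
  using scaleR_left_distrib[of 2 2 z] by (simp add: scaleR_2 add.assoc)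

lemma positive_star_mult_self: "positive (star b * b)"
  by (auto simp: positive_def)

lemma positive_selfadjoint: "positive a \<Longrightarrow> star a = a"
  by (simp add: positive_iff_psd psd_selfadjoint)

lemma positive_0: "positive 0"
  by (simp add: positive_iff_psd psd_0)

lemma positive_add: "positive a \<Longrightarrow> positive b \<Longrightarrow> positive (a + b)"
  by (simp add: positive_iff_psd psd_add)

lemma positive_scaleR: "positive a \<Longrightarrow> 0 \<le> r \<Longrightarrow> positive (r *\<^sub>R a)"
  by (simp add: positive_iff_psd psd_scaleR)

lemma positive_sum: "(\<And>x. x \<in> X \<Longrightarrow> positive (f x)) \<Longrightarrow> positive (sum f X)"
  by (induction X rule: infinite_finite_induct) (auto intro: positive_0 positive_add)

lemma positive_conj: "positive a \<Longrightarrow> positive (star x * a * x)"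
  unfolding positive_def by (metis mult.assoc star_mult)

text \<open>The inequality \<open>norm (norm a *\<^sub>R 1 - a) \<le> norm a\<close> is a closed
  condition, so no square roots need to converge.\<close>

lemma positive_tendsto:
  fixes a :: "'a::unital_cstar_algebra"
  assumes f: "(f \<longlongrightarrow> a) F" "F \<noteq> bot" "\<And>n. positive (f n)"
  shows "positive a"
  unfolding positive_iff_psd
proof (rule psd_if_norm_le)
  have "((\<lambda>n. star (f n)) \<longlongrightarrow> star a) F"
    using continuous_on_tendsto_compose[OF continuous_star f(1), of UNIV] by simp
  then have "(f \<longlongrightarrow> star a) F"
    by (simp add: positive_selfadjoint[OF f(3)])
  from tendsto_unique[OF f(2) this f(1)] show "star a = a" .
  show "norm (norm a *\<^sub>R 1 - a) \<le> norm a"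
  proof (rule tendsto_le[OF f(2)])
    show "((\<lambda>n. norm (f n)) \<longlongrightarrow> norm a) F"
      "((\<lambda>n. norm (norm (f n) *\<^sub>R 1 - f n)) \<longlongrightarrow> norm (norm a *\<^sub>R 1 - a)) F"
      by (intro tendsto_intros f)+
    show "\<forall>\<^sub>F n in F. norm (norm (f n) *\<^sub>R 1 - f n) \<le> norm (f n)"
      using psd_norm_le[OF f(3)[unfolded positive_iff_psd] order_refl] by simp
  qed
qed

abbreviation positive_le :: "'a::unital_cstar_algebra \<Rightarrow> 'a \<Rightarrow> bool" (infix \<open>\<preceq>\<close> 50) where
  "a \<preceq> b \<equiv> positive (b - a)"

lemma positive_le_trans: "a \<preceq> b \<Longrightarrow> b \<preceq> c \<Longrightarrow> a \<preceq> c"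
  using positive_add[of "c - b" "b - a"] by simp

lemma positive_le_antisym: "a \<preceq> b \<Longrightarrow> b \<preceq> a \<Longrightarrow> a = b"
  using psd_antisym[of "b - a"] by (simp add: positive_iff_psd)

lemma positive_le_add: "a \<preceq> b \<Longrightarrow> c \<preceq> d \<Longrightarrow> a + c \<preceq> b + d"
  using positive_add[of "b - a" "d - c"] by (simp add: algebra_simps)

lemma positive_le_scaleR: "a \<preceq> b \<Longrightarrow> 0 \<le> r \<Longrightarrow> r *\<^sub>R a \<preceq> r *\<^sub>R b"
  using positive_scaleR[of "b - a" r] by (simp add: algebra_simps)

lemma positive_le_scaleR_left: "positive a \<Longrightarrow> r \<le> s \<Longrightarrow> r *\<^sub>R a \<preceq> s *\<^sub>R a"
  using positive_scaleR[of a "s - r"] by (simp add: algebra_simps)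

lemma positive_le_conj: "a \<preceq> b \<Longrightarrow> star x * a * x \<preceq> star x * b * x"
  using positive_conj[of "b - a" x] by (simp add: algebra_simps)

lemma selfadjoint_le_norm: "star h = h \<Longrightarrow> norm h \<le> s \<Longrightarrow> h \<preceq> s *\<^sub>R 1"
  by (simp add: positive_iff_psd psd_norm_diff)

lemma positive_norm_le: "positive a \<Longrightarrow> a \<preceq> s *\<^sub>R 1 \<Longrightarrow> 0 \<le> s \<Longrightarrow> norm a \<le> s"
  by (simp add: positive_iff_psd norm_le_if_psd)

lemma positive_norm_mono:
  assumes "positive a" "a \<preceq> b"
  shows "norm a \<le> norm b"
proof -
  have "star b = b"
    using positive_selfadjoint[OF positive_add[OF assms]] by simp
  then show ?thesis
    using assms selfadjoint_le_norm positive_le_trans positive_norm_le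
    by (metis norm_ge_zero order_refl)
qed

lemma star_mult_self_le: "norm a \<le> s \<Longrightarrow> star a * a \<preceq> s\<^sup>2 *\<^sub>R 1"
  by (rule selfadjoint_le_norm) (simp_all add: star_simps cstar_identity power_mono)

lemma star_mult_self_mult_le: "norm a \<le> s \<Longrightarrow> star (a * x) * (a * x) \<preceq> s\<^sup>2 *\<^sub>R (star x * x)"
  using positive_le_conj[OF star_mult_self_le, of a s x] by (simp add: star_simps mult.assoc)

section \<open>Homomorphisms and the order\<close>

lemma star_hom_0: "star_hom f \<Longrightarrow> f 0 = 0"
  using star_hom_simps(1)[of f 0 0] by simp

lemma star_hom_scaleR: "star_hom f \<Longrightarrow> f (r *\<^sub>R x) = r *\<^sub>R f x"
  by (simp add: scaleR_scaleC star_hom_simps)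

lemma star_hom_diff: "star_hom f \<Longrightarrow> f (x - y) = f x - f y"
  using star_hom_simps(1)[of f "x - y" y] by simp

lemma star_hom_sum: "star_hom f \<Longrightarrow> f (sum g X) = (\<Sum>x\<in>X. f (g x))"
  by (induction X rule: infinite_finite_induct) (simp_all add: star_hom_0 star_hom_simps)

lemma star_hom_positive: "star_hom f \<Longrightarrow> positive a \<Longrightarrow> positive (f a)"
  by (auto simp: positive_def star_hom_simps)

lemma unital_star_hom_norm_le:
  assumes "unital_star_hom f"
  shows "norm (f a) \<le> norm a"
proof -
  have f: "star_hom f" "f 1 = 1" using assms by (auto simp: unital_star_hom_def)
  have "positive (f ((norm a)\<^sup>2 *\<^sub>R 1 - star a * a))"
    by (rule star_hom_positive[OF f(1) star_mult_self_le]) simp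
  then have "star (f a) * f a \<preceq> (norm a)\<^sup>2 *\<^sub>R 1"
    by (simp add: star_hom_diff star_hom_scaleR star_hom_simps f)
  then have "norm (star (f a) * f a) \<le> (norm a)\<^sup>2"
    by (intro positive_norm_le positive_star_mult_self) simp_all
  then show ?thesis by (simp add: cstar_identity)
qed

text \<open>A root of \<open>f a\<close> is not known to lie in the range of \<open>f\<close>, but
  the ball criterion involves norms only and so transfers back. Through \<open>i\<close>, this
  brings inequalities proved in the Toeplitz algebra down to \<open>A\<close>.\<close>

lemma isometric_star_hom_reflects_positive:
  assumes f: "unital_star_hom f" and iso: "\<And>a. norm (f a) = norm a" and a: "positive (f a)"
  shows "positive a"
proof -
  have f': "star_hom f" "f 1 = 1" using f by (auto simp: unital_star_hom_def)
  have "f (star a - a) = 0"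
    using positive_selfadjoint[OF a] by (simp add: star_hom_diff star_hom_simps f')
  then have "star a = a" using iso[of "star a - a"] by simp
  moreover have "f (norm a *\<^sub>R 1 - a) = norm (f a) *\<^sub>R 1 - f a"
    by (simp add: star_hom_diff star_hom_scaleR f' iso)
  then have "norm (norm a *\<^sub>R 1 - a) \<le> norm a"
    using psd_norm_le[of "f a" "norm (f a)"] a iso by (metis positive_iff_psd order_refl)
  ultimately show ?thesis by (simp add: positive_iff_psd psd_if_norm_le)
qed

section \<open>Powers of a transfer operator\<close>

locale transfer_system =
  fixes \<alpha> L :: "'a::unital_cstar_algebra \<Rightarrow> 'a"
  assumes star_hom: "star_hom \<alpha>" and transfer: "transfer_operator \<alpha> L"
begin

lemma L_add: "L (x + y) = L x + L y" and L_scaleC: "L (c *\<^sub>C x) = c *\<^sub>C L x"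
  and L_positive: "positive x \<Longrightarrow> positive (L x)" and L_alpha: "L (\<alpha> x * y) = x * L y"
  using transfer by (auto simp: transfer_operator_def Vector_Spaces.linear_iff)

lemma L_0: "L 0 = 0"
  using L_add[of 0 0] by simp

lemma L_diff: "L (x - y) = L x - L y"
  using L_add[of "x - y" y] by simp

lemma L_scaleR: "L (r *\<^sub>R x) = r *\<^sub>R L x"
  by (simp add: scaleR_scaleC L_scaleC)

text \<open>For selfadjoint \<open>h\<close>, both \<open>norm h *\<^sub>R 1\<close> and
  \<open>norm h *\<^sub>R 1 - h\<close> are positive, so \<open>L h\<close> is a difference of
  selfadjoint elements. Real and imaginary parts give the rest.\<close>

lemma L_star: "L (star x) = star (L x)"
proof -
  have sa: "star (L h) = L h" if "star h = h" for h
  proof -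
    have "positive (L (norm h *\<^sub>R 1 - h))" "positive (L (norm h *\<^sub>R (star 1 * 1)))"
      by (intro L_positive selfadjoint_le_norm positive_scaleR positive_star_mult_self that; simp)+
    then have "star (L (norm h *\<^sub>R 1) - L h) = L (norm h *\<^sub>R 1) - L h"
      "star (L (norm h *\<^sub>R 1)) = L (norm h *\<^sub>R 1)"
      using positive_selfadjoint by (fastforce simp: L_diff star_1)+
    then show ?thesis by (simp add: star_simps)
  qed
  define u v where "u = x + star x" and "v = \<i> *\<^sub>C (x - star x)"
  have uv: "star u = u" "star v = v"
    by (simp_all add: u_def v_def star_simps star_scaleC add.commute
        complex_vector.scale_right_diff_distrib complex_vector.scale_minus_left)
  have x: "2 *\<^sub>R x = u - \<i> *\<^sub>C v" "2 *\<^sub>R star x = u + \<i> *\<^sub>C v"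
    by (simp_all add: u_def v_def scaleR_2 scaleC_scaleC complex_vector.scale_minus_left scaleC_one)
  have "2 *\<^sub>R L (star x) = L u + \<i> *\<^sub>C L v"
    by (metis x(2) L_scaleR L_add L_scaleC)
  also have "\<dots> = star (L u - \<i> *\<^sub>C L v)"
    by (simp add: star_simps star_scaleC sa uv complex_vector.scale_minus_left)
  also have "\<dots> = 2 *\<^sub>R star (L x)"
    by (metis x(1) L_scaleR L_diff L_scaleC star_scaleR)
  finally show ?thesis by simp
qed

lemma L_alpha_right: "L (y * \<alpha> x) = L y * x"
proof -
  have "L (star (\<alpha> (star x) * star y)) = star (star x * L (star y))"
    by (simp add: L_star L_alpha)
  then show ?thesis by (simp add: star_simps L_star star_hom_simps[OF star_hom])
qed

lemma Ln_add: "(L ^^ n) (x + y) = (L ^^ n) x + (L ^^ n) y"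
  and Ln_diff: "(L ^^ n) (x - y) = (L ^^ n) x - (L ^^ n) y"
  and Ln_scaleC: "(L ^^ n) (c *\<^sub>C x) = c *\<^sub>C (L ^^ n) x"
  and Ln_scaleR: "(L ^^ n) (r *\<^sub>R x) = r *\<^sub>R (L ^^ n) x"
  and Ln_star: "(L ^^ n) (star x) = star ((L ^^ n) x)"
  and Ln_0: "(L ^^ n) 0 = 0"
  and Ln_positive: "positive x \<Longrightarrow> positive ((L ^^ n) x)"
  by (induction n) (simp_all add: L_add L_diff L_scaleC L_scaleR L_star L_0 L_positive)

text \<open>\<open>L ^^ n\<close> is related to \<open>\<alpha> ^^ n\<close> as \<open>L\<close> is
  to \<open>\<alpha>\<close>. In the descent this lets a factor outside \<open>L ^^ n\<close> be
  absorbed into its argument.\<close>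

lemma Ln_alpha: "(L ^^ n) ((\<alpha> ^^ n) x * y) = x * (L ^^ n) y"
proof (induction n arbitrary: y)
  case (Suc n)
  have "(L ^^ Suc n) ((\<alpha> ^^ Suc n) x * y) = (L ^^ n) (L (\<alpha> ((\<alpha> ^^ n) x) * y))"
    by (simp add: funpow_swap1)
  also have "\<dots> = x * (L ^^ n) (L y)" by (simp add: L_alpha Suc)
  finally show ?case by (simp add: funpow_swap1)
qed simp

lemma alphan_star: "(\<alpha> ^^ n) (star x) = star ((\<alpha> ^^ n) x)"
  by (induction n) (simp_all add: star_hom_simps[OF star_hom])

lemma Ln_alpha_right: "(L ^^ n) (y * (\<alpha> ^^ n) x) = (L ^^ n) y * x"
proof -
  have "(L ^^ n) (star ((\<alpha> ^^ n) (star x) * star y)) = star (star x * (L ^^ n) (star y))"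
    by (simp only: Ln_star Ln_alpha)
  then show ?thesis by (simp add: star_simps Ln_star alphan_star)
qed

lemma Ln_mono: "x \<preceq> y \<Longrightarrow> (L ^^ n) x \<preceq> (L ^^ n) y"
  using Ln_positive[of "y - x" n] by (simp add: Ln_diff)

section \<open>The Fock module\<close>

text \<open>The \<open>n\<close>-th tensor power of \<open>M\<^sub>L\<close> is the completion of \<open>A\<close> in the form
  \<open>L\<^sup>n (star x * y)\<close>, because \<open>q(a) \<otimes> q(b) = q(a \<alpha>(b)) \<otimes> q(1)\<close>. The Fock module is therefore
  represented by the finitely supported sequences in \<open>A\<close>.\<close>

definition fin :: "(nat \<Rightarrow> 'a) \<Rightarrow> bool" where
  "fin x \<longleftrightarrow> finite {n. x n \<noteq> 0}"

text \<open>Summing over the support of the first argument makes linearity in the second one hold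
  without finiteness conditions.\<close>

definition form :: "(nat \<Rightarrow> 'a) \<Rightarrow> (nat \<Rightarrow> 'a) \<Rightarrow> 'a" where
  "form x y = (\<Sum>n | x n \<noteq> 0. (L ^^ n) (star (x n) * y n))"

lemma form_eq:
  assumes "finite N" "{n. x n \<noteq> 0} \<subseteq> N"
  shows "form x y = (\<Sum>n\<in>N. (L ^^ n) (star (x n) * y n))"
  unfolding form_def using assms by (intro sum.mono_neutral_left) (auto simp: star_0 Ln_0)

lemma fin_add: "fin x \<Longrightarrow> fin y \<Longrightarrow> fin (\<lambda>n. x n + y n)"
  and fin_diff: "fin x \<Longrightarrow> fin y \<Longrightarrow> fin (\<lambda>n. x n - y n)"
  unfolding fin_def by (rule finite_subset[of _ "{n. x n \<noteq> 0} \<union> {n. y n \<noteq> 0}"], auto)+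

lemma fin_0: "fin (\<lambda>n. 0)"
  by (simp add: fin_def)

lemma fin_sum: "(\<And>i. i \<in> X \<Longrightarrow> fin (x i)) \<Longrightarrow> fin (\<lambda>n. \<Sum>i\<in>X. x i n)"
  by (induction X rule: infinite_finite_induct) (auto intro: fin_0 fin_add)

lemma fin_map: "fin x \<Longrightarrow> (\<And>n. x n = 0 \<Longrightarrow> g n = 0) \<Longrightarrow> fin g"
  unfolding fin_def by (rule finite_subset[of _ "{n. x n \<noteq> 0}"]) auto

lemma fin_scaleC: "fin x \<Longrightarrow> fin (\<lambda>n. c *\<^sub>C x n)"
  by (erule fin_map) simp

lemma fin_scaleR: "fin x \<Longrightarrow> fin (\<lambda>n. r *\<^sub>R x n)"
  by (erule fin_map) simp

lemma form_star: "fin x \<Longrightarrow> fin y \<Longrightarrow> star (form x y) = form y x"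
  by (simp add: fin_def form_eq[of "{n. x n \<noteq> 0} \<union> {n. y n \<noteq> 0}"] star_sum star_simps
      flip: Ln_star)

lemma form_positive: "positive (form x x)"
  unfolding form_def by (intro positive_sum Ln_positive positive_star_mult_self)

lemma form_add_right: "form x (\<lambda>n. y n + z n) = form x y + form x z"
  by (simp add: form_def distrib_left Ln_add sum.distrib)

lemma form_diff_right: "form x (\<lambda>n. y n - z n) = form x y - form x z"
  by (simp add: form_def right_diff_distrib Ln_diff sum_subtractf)

lemma form_scaleC_right: "form x (\<lambda>n. c *\<^sub>C y n) = c *\<^sub>C form x y"
  by (simp add: form_def scaleC_mult_right Ln_scaleC complex_vector.scale_sum_right)

lemma form_sum_right: "form x (\<lambda>n. \<Sum>i\<in>X. y i n) = (\<Sum>i\<in>X. form x (y i))"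
proof (induction X rule: infinite_finite_induct)
  case (insert i X)
  then show ?case by (simp add: form_add_right)
qed (simp_all add: form_def Ln_0)

lemma form_scaleR_right: "form x (\<lambda>n. r *\<^sub>R y n) = r *\<^sub>R form x y"
  using form_scaleC_right[of x "complex_of_real r" y] by (simp add: scaleR_scaleC)

lemma form_add_left:
  "fin x \<Longrightarrow> fin y \<Longrightarrow> fin z \<Longrightarrow> form (\<lambda>n. x n + y n) z = form x z + form y z"
  by (subst form_star[symmetric]) (simp_all add: fin_add form_add_right star_add form_star)

lemma form_diff_left:
  "fin x \<Longrightarrow> fin y \<Longrightarrow> fin z \<Longrightarrow> form (\<lambda>n. x n - y n) z = form x z - form y z"
  by (subst form_star[symmetric]) (simp_all add: fin_diff form_diff_right star_diff form_star)

lemma form_scaleC_left: "fin x \<Longrightarrow> fin z \<Longrightarrow> form (\<lambda>n. c *\<^sub>C x n) z = cnj c *\<^sub>C form x z"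
  by (subst form_star[symmetric]) (simp_all add: fin_scaleC form_scaleC_right star_scaleC form_star)

lemma form_scaleR_left: "fin x \<Longrightarrow> fin z \<Longrightarrow> form (\<lambda>n. r *\<^sub>R x n) z = r *\<^sub>R form x z"
  by (subst form_star[symmetric]) (simp_all add: fin_scaleR form_scaleR_right star_scaleR form_star)

lemma form_sum_left:
  assumes "\<And>i. i \<in> X \<Longrightarrow> fin (x i)" "fin z"
  shows "form (\<lambda>n. \<Sum>i\<in>X. x i n) z = (\<Sum>i\<in>X. form (x i) z)"
  using assms
proof (induction X rule: infinite_finite_induct)
  case (insert i X)
  then show ?case by (simp add: form_add_left fin_sum)
qed (simp_all add: form_def)

lemmas form_simps = form_add_right form_diff_right form_scaleR_right form_scaleC_right
  form_add_left form_diff_left form_scaleR_left form_scaleC_left fin_add fin_diff fin_scaleC fin_scaleR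

text \<open>Positivity of the form at
  \<open>sqrt t *\<^sub>R x n - (1 / sqrt t) *\<^sub>R y n\<close> bounds the cross terms. The
  weight \<open>t\<close> is left free so that it can be adapted to given operator bounds.\<close>

lemma form_triangle:
  assumes x: "fin x" "fin y" and t: "t > 0"
  shows "form (\<lambda>n. x n + y n) (\<lambda>n. x n + y n) \<preceq> (1 + t) *\<^sub>R form x x + (1 + 1/t) *\<^sub>R form y y"
proof -
  have "positive (form (\<lambda>n. sqrt t *\<^sub>R x n - (1 / sqrt t) *\<^sub>R y n) (\<lambda>n. sqrt t *\<^sub>R x n - (1 / sqrt t) *\<^sub>R y n))"
    by (rule form_positive)
  then show ?thesis
    using t by (simp add: form_simps x algebra_simps)
qed

text \<open>Polarisation: \<open>4 *\<^sub>R form x y\<close> is a combination of the values at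
  \<open>x + c y\<close> for the four fourth roots of unity \<open>c\<close>. The bound is not
  homogeneous in \<open>x\<close> and \<open>y\<close>; \<open>form_small\<close> repairs this by
  scaling.\<close>

lemma form_norm_le:
  assumes x: "fin x" "fin y"
  shows "norm (form x y) \<le> 2 * (norm (form x x) + norm (form y y))"
proof -
  have le: "norm (form (\<lambda>n. x n + c *\<^sub>C y n) (\<lambda>n. x n + c *\<^sub>C y n)) \<le> 2 * (norm (form x x) + norm (form y y))"
    if "cmod c = 1" for c
  proof -
    have "c * cnj c = 1"
      using that by (simp flip: complex_norm_square)
    then have "form (\<lambda>n. c *\<^sub>C y n) (\<lambda>n. c *\<^sub>C y n) = form y y"
      by (simp add: form_simps x scaleC_scaleC scaleC_one)
    then have "form (\<lambda>n. x n + c *\<^sub>C y n) (\<lambda>n. x n + c *\<^sub>C y n) \<preceq> 2 *\<^sub>R form x x + 2 *\<^sub>R form y y"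
      using form_triangle[of x "\<lambda>n. c *\<^sub>C y n" 1] x by (simp add: fin_scaleC)
    from positive_norm_mono[OF form_positive this]
    show ?thesis using norm_triangle_ineq[of "2 *\<^sub>R form x x" "2 *\<^sub>R form y y"] by simp
  qed
  let ?f = "\<lambda>c. form (\<lambda>n. x n + c *\<^sub>C y n) (\<lambda>n. x n + c *\<^sub>C y n)"
  have "4 *\<^sub>R form x y = ?f 1 + (-1) *\<^sub>C ?f (-1) + (- \<i>) *\<^sub>C ?f \<i> + \<i> *\<^sub>C ?f (- \<i>)"
    by (simp add: form_simps x algebra_simps scaleC_scaleC scaleC_one complex_vector.scale_minus_left
        scaleC_add_right scaleR_4)
  then have "norm (4 *\<^sub>R form x y) \<le> norm (?f 1) + norm (?f (-1)) + norm (?f \<i>) + norm (?f (- \<i>))"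
    by (simp only:) (intro order_trans[OF norm_triangle_ineq] add_mono; simp add: norm_scaleC)
  moreover have "norm (?f 1) \<le> 2 * (norm (form x x) + norm (form y y))"
    "norm (?f (-1)) \<le> 2 * (norm (form x x) + norm (form y y))"
    "norm (?f \<i>) \<le> 2 * (norm (form x x) + norm (form y y))"
    "norm (?f (- \<i>)) \<le> 2 * (norm (form x x) + norm (form y y))"
    by (rule le, simp)+
  ultimately show ?thesis
    unfolding norm_scaleR by linarith
qed

section \<open>Order bounds for operators on the Fock module\<close>

definition bounded_by :: "real \<Rightarrow> ((nat \<Rightarrow> 'a) \<Rightarrow> (nat \<Rightarrow> 'a)) \<Rightarrow> bool" where
  "bounded_by C T \<longleftrightarrow> (\<forall>x. fin x \<longrightarrow> form (T x) (T x) \<preceq> C\<^sup>2 *\<^sub>R form x x)"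

lemma bounded_by_mono: "bounded_by C T \<Longrightarrow> 0 \<le> C \<Longrightarrow> C \<le> D \<Longrightarrow> bounded_by D T"
  unfolding bounded_by_def
  by (meson form_positive positive_le_scaleR_left positive_le_trans power_mono)

lemma bounded_by_comp:
  assumes "bounded_by C T" "bounded_by D U" "\<And>x. fin x \<Longrightarrow> fin (U x)"
  shows "bounded_by (C * D) (\<lambda>x. T (U x))"
  unfolding bounded_by_def
proof (intro allI impI)
  fix x assume x: "fin x"
  have "form (T (U x)) (T (U x)) \<preceq> C\<^sup>2 *\<^sub>R form (U x) (U x)"
    using assms x by (auto simp: bounded_by_def)
  moreover have "C\<^sup>2 *\<^sub>R form (U x) (U x) \<preceq> C\<^sup>2 *\<^sub>R (D\<^sup>2 *\<^sub>R form x x)"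
    using assms x by (intro positive_le_scaleR) (auto simp: bounded_by_def)
  ultimately show "form (T (U x)) (T (U x)) \<preceq> (C * D)\<^sup>2 *\<^sub>R form x x"
    using positive_le_trans by (fastforce simp: power_mult_distrib)
qed

text \<open>The positive cone is closed. This allows constants to be enlarged slightly where a proof
  divides by them, and shows that the infimum \<open>fock_norm\<close> is itself a bound.\<close>

lemma bounded_by_limit:
  assumes "0 \<le> C" "\<And>D. C < D \<Longrightarrow> bounded_by D T"
  shows "bounded_by C T"
  unfolding bounded_by_def
proof (intro allI impI)
  fix x assume x: "fin x"
  have "(\<lambda>n. (C + 1 / real (Suc n))\<^sup>2 *\<^sub>R form x x - form (T x) (T x)) \<longlonglongrightarrow> (C + 0)\<^sup>2 *\<^sub>R form x x - form (T x) (T x)"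
    by (intro tendsto_intros LIMSEQ_Suc[OF lim_1_over_n])
  then show "form (T x) (T x) \<preceq> C\<^sup>2 *\<^sub>R form x x"
    using assms(2) x by (simp add: bounded_by_def) (rule positive_tendsto, assumption, simp_all)
qed

lemma bounded_by_add:
  assumes "bounded_by C T" "bounded_by D U" "0 \<le> C" "0 \<le> D" "\<And>x. fin x \<Longrightarrow> fin (T x)" "\<And>x. fin x \<Longrightarrow> fin (U x)"
  shows "bounded_by (C + D) (\<lambda>x n. T x n + U x n)"
proof -
  have pos: "bounded_by (c + d) (\<lambda>x n. T x n + U x n)"
    if cd: "0 < c" "0 < d" "bounded_by c T" "bounded_by d U" for c d
    unfolding bounded_by_def
  proof (intro allI impI)
    fix x assume x: "fin x"
    \<comment> \<open>The weight \<open>d/c\<close> minimises the resulting constant, and the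
      minimum is exactly \<open>(c + d)\<^sup>2\<close>.\<close>
    have 1: "form (\<lambda>n. T x n + U x n) (\<lambda>n. T x n + U x n)
        \<preceq> (1 + d/c) *\<^sub>R form (T x) (T x) + (1 + 1/(d/c)) *\<^sub>R form (U x) (U x)"
      by (rule form_triangle) (use x cd assms in auto)
    have 2: "(1 + d/c) *\<^sub>R form (T x) (T x) + (1 + 1/(d/c)) *\<^sub>R form (U x) (U x)
        \<preceq> (1 + d/c) *\<^sub>R (c\<^sup>2 *\<^sub>R form x x) + (1 + 1/(d/c)) *\<^sub>R (d\<^sup>2 *\<^sub>R form x x)"
      using x cd by (intro positive_le_add positive_le_scaleR) (auto simp: bounded_by_def)
    have "(1 + d/c) * c\<^sup>2 + (1 + 1/(d/c)) * d\<^sup>2 = (c + d)\<^sup>2"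
      using cd by (simp add: field_simps power2_eq_square)
    then have 3: "(1 + d/c) *\<^sub>R (c\<^sup>2 *\<^sub>R form x x) + (1 + 1/(d/c)) *\<^sub>R (d\<^sup>2 *\<^sub>R form x x) = (c + d)\<^sup>2 *\<^sub>R form x x"
      by (simp flip: scaleR_left_distrib)
    show "form (\<lambda>n. T x n + U x n) (\<lambda>n. T x n + U x n) \<preceq> (c + d)\<^sup>2 *\<^sub>R form x x"
      using positive_le_trans[OF 1 2] unfolding 3 .
  qed
  show ?thesis
  proof (rule bounded_by_limit)
    fix E assume E: "C + D < E"
    define e where "e = (E - (C + D)) / 2"
    have "0 < e" using E by (simp add: e_def)
    then have "bounded_by ((C + e) + (D + e)) (\<lambda>x n. T x n + U x n)"
      using assms(3,4) by (intro pos bounded_by_mono[OF assms(1)] bounded_by_mono[OF assms(2)]) linarith+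
    then show "bounded_by E (\<lambda>x n. T x n + U x n)" by (simp add: e_def)
  qed (use assms in simp)
qed

lemma bounded_by_scaleC:
  assumes "bounded_by C T" "\<And>x. fin x \<Longrightarrow> fin (T x)"
  shows "bounded_by (cmod c * C) (\<lambda>x n. c *\<^sub>C T x n)"
  unfolding bounded_by_def
proof (intro allI impI)
  fix x assume x: "fin x"
  have "form (\<lambda>n. c *\<^sub>C T x n) (\<lambda>n. c *\<^sub>C T x n) = (cmod c)\<^sup>2 *\<^sub>R form (T x) (T x)"
    using x assms(2) by (simp add: form_simps scaleC_scaleC scaleR_scaleC complex_norm_square flip: of_real_power)
  then show "form (\<lambda>n. c *\<^sub>C T x n) (\<lambda>n. c *\<^sub>C T x n) \<preceq> (cmod c * C)\<^sup>2 *\<^sub>R form x x"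
    using x assms positive_le_scaleR[of "C\<^sup>2 *\<^sub>R form x x" "form (T x) (T x)" "(cmod c)\<^sup>2"]
    by (simp add: bounded_by_def power_mult_distrib)
qed

lemma bounded_by_sum:
  assumes "\<And>i. i \<in> X \<Longrightarrow> bounded_by (C i) (T i)" "\<And>i. i \<in> X \<Longrightarrow> 0 \<le> C i"
    "\<And>i x. i \<in> X \<Longrightarrow> fin x \<Longrightarrow> fin (T i x)"
  shows "bounded_by (\<Sum>i\<in>X. C i) (\<lambda>x n. \<Sum>i\<in>X. T i x n)"
  using assms
proof (induction X rule: infinite_finite_induct)
  case (insert i X)
  then show ?case
    by (simp add: bounded_by_add fin_sum sum_nonneg)
qed (simp_all add: bounded_by_def form_def positive_0)

section \<open>Adjoints and the C*-identity for order bounds\<close>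

text \<open>A relation and not an operation, because the form may be degenerate and \<open>T\<close>
  need not determine \<open>T'\<close>.\<close>

definition adj :: "((nat \<Rightarrow> 'a) \<Rightarrow> (nat \<Rightarrow> 'a)) \<Rightarrow> ((nat \<Rightarrow> 'a) \<Rightarrow> (nat \<Rightarrow> 'a)) \<Rightarrow> bool" where
  "adj T T' \<longleftrightarrow> (\<forall>x. fin x \<longrightarrow> fin (T x) \<and> fin (T' x)) \<and>
     (\<forall>x y. fin x \<longrightarrow> fin y \<longrightarrow> form (T x) y = form x (T' y))"

lemma adj_sym: "adj T T' \<Longrightarrow> adj T' T"
  unfolding adj_def by (metis form_star)

text \<open>Divide the bound for \<open>T\<close> at the vector \<open>T' x\<close> by
  \<open>D\<^sup>2\<close> and add the positivity of the form at
  \<open>D x - (1/D) T (T' x)\<close>. The terms in \<open>T (T' x)\<close> cancel, and the cross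
  terms leave one copy of \<open>form (T' x) (T' x)\<close> with a negative sign.\<close>

lemma adj_bounded_by:
  assumes "adj T T'" "bounded_by C T" "0 \<le> C"
  shows "bounded_by C T'"
proof (rule bounded_by_limit)
  fix D assume "C < D"
  then have D: "bounded_by D T" "0 < D" using assms bounded_by_mono by auto
  show "bounded_by D T'"
    unfolding bounded_by_def
  proof (intro allI impI)
    fix x assume x: "fin x"
    have fin: "fin (T' x)" "fin (T (T' x))" using assms x by (auto simp: adj_def)
    have eq: "form x (T (T' x)) = form (T' x) (T' x)" "form (T (T' x)) x = form (T' x) (T' x)"
      using assms(1) adj_sym[OF assms(1)] x fin by (auto simp: adj_def)
    have "form (T (T' x)) (T (T' x)) \<preceq> D\<^sup>2 *\<^sub>R form (T' x) (T' x)"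
      using D fin by (auto simp: bounded_by_def)
    then have "positive ((1/D\<^sup>2) *\<^sub>R (D\<^sup>2 *\<^sub>R form (T' x) (T' x) - form (T (T' x)) (T (T' x))))"
      by (rule positive_scaleR) simp
    moreover have "positive (form (\<lambda>n. D *\<^sub>R x n - (1/D) *\<^sub>R T (T' x) n) (\<lambda>n. D *\<^sub>R x n - (1/D) *\<^sub>R T (T' x) n))"
      by (rule form_positive)
    ultimately have "positive ((1/D\<^sup>2) *\<^sub>R (D\<^sup>2 *\<^sub>R form (T' x) (T' x) - form (T (T' x)) (T (T' x))) +
      form (\<lambda>n. D *\<^sub>R x n - (1/D) *\<^sub>R T (T' x) n) (\<lambda>n. D *\<^sub>R x n - (1/D) *\<^sub>R T (T' x) n))"
      by (rule positive_add)
    then show "form (T' x) (T' x) \<preceq> D\<^sup>2 *\<^sub>R form x x"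
      using D(2) by (simp add: form_simps x fin eq algebra_simps power2_eq_square)
  qed
qed (use assms in simp)

text \<open>The nontrivial half of the C*-identity. With \<open>y = T' (T x)\<close>, the form at
  \<open>D x - y\<close> and the bound
  \<open>form y y \<preceq> D\<^sup>2 *\<^sub>R form x x\<close> add up to \<open>2 * D\<close>
  times the claim, since both cross terms equal \<open>form (T x) (T x)\<close>.\<close>

lemma adj_cstar_bound:
  assumes "adj T T'" "bounded_by C (\<lambda>x. T' (T x))" "0 \<le> C"
  shows "bounded_by (sqrt C) T"
proof (rule bounded_by_limit)
  fix E assume "sqrt C < E"
  define D where "D = E\<^sup>2"
  have "C < D" using real_less_rsqrt power_strict_mono[OF \<open>sqrt C < E\<close>, of 2] assms(3) by (simp add: D_def)
  then have D: "bounded_by D (\<lambda>x. T' (T x))" "0 < D" using assms bounded_by_mono by auto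
  show "bounded_by E T"
    unfolding bounded_by_def D_def[symmetric]
  proof (intro allI impI)
    fix x assume x: "fin x"
    define y where "y = T' (T x)"
    have fin: "fin (T x)" "fin y" using assms x by (auto simp: adj_def y_def)
    have eq: "form x y = form (T x) (T x)" "form y x = form (T x) (T x)"
      using assms(1) adj_sym[OF assms(1)] x fin by (auto simp: adj_def y_def)
    have "form y y \<preceq> D\<^sup>2 *\<^sub>R form x x"
      using D x by (auto simp: bounded_by_def y_def)
    then have "positive ((1/D) *\<^sub>R (D\<^sup>2 *\<^sub>R form x x - form y y))"
      using D by (intro positive_scaleR) simp_all
    moreover have "positive ((1/D) *\<^sub>R form (\<lambda>n. D *\<^sub>R x n - y n) (\<lambda>n. D *\<^sub>R x n - y n))"
      using D by (intro positive_scaleR form_positive) simp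
    ultimately have "positive ((1/2) *\<^sub>R ((1/D) *\<^sub>R (D\<^sup>2 *\<^sub>R form x x - form y y) +
      (1/D) *\<^sub>R form (\<lambda>n. D *\<^sub>R x n - y n) (\<lambda>n. D *\<^sub>R x n - y n)))"
      by (rule positive_scaleR[OF positive_add]) simp
    moreover have "(1/2) *\<^sub>R ((1/D) *\<^sub>R (D\<^sup>2 *\<^sub>R form x x - form y y) +
      (1/D) *\<^sub>R form (\<lambda>n. D *\<^sub>R x n - y n) (\<lambda>n. D *\<^sub>R x n - y n)) = D *\<^sub>R form x x - form (T x) (T x)"
      using D(2) by (simp add: form_simps x fin eq algebra_simps power2_eq_square)
        (simp flip: scaleR_left_distrib)
    ultimately show "form (T x) (T x) \<preceq> D *\<^sub>R form x x" by simp
  qed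
qed (use assms in simp)

section \<open>Multiplication, creation and annihilation operators\<close>

definition single :: "nat \<Rightarrow> 'a \<Rightarrow> nat \<Rightarrow> 'a" where
  "single k a = (\<lambda>n. if n = k then a else 0)"

lemma fin_single: "fin (single k a)"
  unfolding fin_def single_def by (rule finite_subset[of _ "{k}"]) auto

lemma form_single: "form (single k a) y = (L ^^ k) (star a * y k)"
  by (subst form_eq[of "{k}"]) (auto simp: single_def)

text \<open>\<open>Gen\<close> is creation by \<open>q(1)\<close>: tensoring \<open>x\<close> on the
  left with \<open>q(1)\<close> gives the vector represented by \<open>\<alpha> x\<close> one degree
  higher. \<open>Gen_star\<close> is the matching annihilation operator and is zero on the vacuum
  summand.\<close>

primrec letter_op :: "'a letter \<Rightarrow> (nat \<Rightarrow> 'a) \<Rightarrow> nat \<Rightarrow> 'a" where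
  "letter_op (Elt a) x = (\<lambda>n. a * x n)"
| "letter_op Gen x = case_nat 0 (\<lambda>n. \<alpha> (x n))"
| "letter_op Gen_star x = (\<lambda>n. L (x (Suc n)))"

lemma letter_op_add: "letter_op l (\<lambda>n. x n + y n) = (\<lambda>n. letter_op l x n + letter_op l y n)"
  by (cases l) (auto simp: distrib_left star_hom_simps[OF star_hom] L_add fun_eq_iff split: nat.split)

lemma letter_op_scaleC: "letter_op l (\<lambda>n. c *\<^sub>C x n) = (\<lambda>n. c *\<^sub>C letter_op l x n)"
  by (cases l) (auto simp: scaleC_mult_right star_hom_simps[OF star_hom] L_scaleC fun_eq_iff split: nat.split)

lemma support_Gen: "{n. letter_op Gen x n \<noteq> 0} \<subseteq> Suc ` {n. x n \<noteq> 0}"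
proof
  fix n assume n: "n \<in> {n. letter_op Gen x n \<noteq> 0}"
  then obtain m where "n = Suc m" by (cases n) auto
  with n show "n \<in> Suc ` {n. x n \<noteq> 0}"
    by (cases "x m = 0") (auto simp: star_hom_0[OF star_hom])
qed

lemma fin_letter_op:
  assumes "fin x"
  shows "fin (letter_op l x)"
proof (cases l)
  case (Elt a)
  then show ?thesis using assms by (auto intro: fin_map)
next
  case Gen
  then show ?thesis using assms finite_subset[OF support_Gen[of x]] unfolding fin_def by blast
next
  case Gen_star
  have "{n. letter_op Gen_star x n \<noteq> 0} \<subseteq> Suc -` {n. x n \<noteq> 0}"
    using L_0 by auto
  moreover have "finite (Suc -` {n. x n \<noteq> 0})"
    using assms by (intro finite_vimageI) (auto simp: fin_def)
  ultimately show ?thesis using Gen_star finite_subset unfolding fin_def by blast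
qed

lemma form_Gen:
  assumes "fin x" "fin y"
  shows "form (letter_op Gen x) y = form x (letter_op Gen_star y)"
proof -
  have "form (letter_op Gen x) y = (\<Sum>n\<in>Suc ` {n. x n \<noteq> 0}. (L ^^ n) (star (letter_op Gen x n) * y n))"
    using assms by (intro form_eq support_Gen) (simp add: fin_def)
  also have "\<dots> = form x (letter_op Gen_star y)"
    unfolding form_def
    by (simp add: sum.reindex funpow_swap1 L_alpha flip: star_hom_simps(4)[OF star_hom])
  finally show ?thesis .
qed

lemma adj_letter_op: "adj (letter_op l) (letter_op (star_letter l))"
proof (cases l)
  case (Elt a)
  have "form (letter_op (Elt a) x) y = form x (letter_op (Elt (star a)) y)" if "fin x" for x y
    using that by (subst form_eq[of "{n. x n \<noteq> 0}"]) (auto simp: form_def[of x] fin_def star_simps mult.assoc)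
  then show ?thesis using Elt by (simp add: adj_def fin_letter_op del: letter_op.simps)
next
  case Gen
  then show ?thesis by (simp add: adj_def fin_letter_op form_Gen del: letter_op.simps)
next
  case Gen_star
  have "adj (letter_op Gen) (letter_op Gen_star)"
    by (simp add: adj_def fin_letter_op form_Gen del: letter_op.simps)
  then show ?thesis using Gen_star adj_sym by simp
qed

lemma bounded_by_Elt: "bounded_by (norm a) (letter_op (Elt a))"
  unfolding bounded_by_def
proof (intro allI impI)
  fix x assume x: "fin x"
  have "form (letter_op (Elt a) x) (letter_op (Elt a) x) = (\<Sum>n | x n \<noteq> 0. (L ^^ n) (star (a * x n) * (a * x n)))"
    using x by (subst form_eq[of "{n. x n \<noteq> 0}"]) (auto simp: fin_def)
  moreover have "positive (\<Sum>n | x n \<noteq> 0. (L ^^ n) ((norm a)\<^sup>2 *\<^sub>R (star (x n) * x n)) - (L ^^ n) (star (a * x n) * (a * x n)))"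
    by (intro positive_sum Ln_mono star_mult_self_mult_le) simp
  ultimately show "form (letter_op (Elt a) x) (letter_op (Elt a) x) \<preceq> (norm a)\<^sup>2 *\<^sub>R form x x"
    by (simp only: form_def[of x] scaleR_sum_right sum_subtractf Ln_scaleR)
qed

text \<open>\<open>Gen_star\<close> after \<open>Gen\<close> is left multiplication by
  \<open>L 1\<close>, because \<open>L (\<alpha> a) = L 1 * a\<close>.\<close>

lemma bounded_by_Gen: "\<exists>C\<ge>0. bounded_by C (letter_op Gen)"
proof (intro exI conjI)
  show "bounded_by (sqrt (norm (L 1))) (letter_op Gen)"
    unfolding bounded_by_def
  proof (intro allI impI)
    fix x assume x: "fin x"
    have L1: "L 1 \<preceq> norm (L 1) *\<^sub>R 1"
      by (rule selfadjoint_le_norm) (simp_all add: star_1 flip: L_star)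
    have "positive (\<Sum>n | x n \<noteq> 0. (L ^^ n) (star (x n) * (norm (L 1) *\<^sub>R 1) * x n) - (L ^^ n) (star (x n) * L 1 * x n))"
      by (intro positive_sum Ln_mono positive_le_conj L1)
    then have "positive (norm (L 1) *\<^sub>R form x x - (\<Sum>n | x n \<noteq> 0. (L ^^ n) (star (x n) * L 1 * x n)))"
      by (simp add: form_def[of x] scaleR_sum_right sum_subtractf Ln_scaleR)
    moreover have "L (\<alpha> a) = L 1 * a" for a
      using L_alpha_right[of 1 a] by simp
    then have "form (letter_op Gen x) (letter_op Gen x) = (\<Sum>n | x n \<noteq> 0. (L ^^ n) (star (x n) * L 1 * x n))"
      using x by (simp only: form_Gen fin_letter_op) (simp add: form_def mult.assoc)
    ultimately show "form (letter_op Gen x) (letter_op Gen x) \<preceq> (sqrt (norm (L 1)))\<^sup>2 *\<^sub>R form x x"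
      by simp
  qed
qed simp

lemma bounded_by_letter_op: "\<exists>C\<ge>0. bounded_by C (letter_op l)"
proof (cases l)
  case (Elt a)
  then show ?thesis using bounded_by_Elt norm_ge_zero by blast
next
  case Gen
  then show ?thesis using bounded_by_Gen by simp
next
  case Gen_star
  then show ?thesis using bounded_by_Gen adj_bounded_by[OF adj_letter_op[of Gen]] by auto
qed

definition word_op :: "'a free_word \<Rightarrow> (nat \<Rightarrow> 'a) \<Rightarrow> nat \<Rightarrow> 'a" where
  "word_op w = foldr letter_op (letters w)"

lemma word_op_plus: "word_op (v + w) x = word_op v (word_op w x)"
  by (simp add: word_op_def plus_free_word_def)

lemma word_op_add: "word_op w (\<lambda>n. x n + y n) = (\<lambda>n. word_op w x n + word_op w y n)"
proof -
  have "foldr letter_op ls (\<lambda>n. x n + y n) = (\<lambda>n. foldr letter_op ls x n + foldr letter_op ls y n)" for ls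
    by (induction ls) (simp_all add: letter_op_add del: letter_op.simps)
  then show ?thesis by (simp add: word_op_def)
qed

lemma word_op_scaleC: "word_op w (\<lambda>n. c *\<^sub>C x n) = (\<lambda>n. c *\<^sub>C word_op w x n)"
proof -
  have "foldr letter_op ls (\<lambda>n. c *\<^sub>C x n) = (\<lambda>n. c *\<^sub>C foldr letter_op ls x n)" for ls
    by (induction ls) (simp_all add: letter_op_scaleC del: letter_op.simps)
  then show ?thesis by (simp add: word_op_def)
qed

lemma word_op_0: "word_op w (\<lambda>n. 0) = (\<lambda>n. 0)"
  using word_op_scaleC[of w 0 "\<lambda>n. 0"] by simp

lemma word_op_sum: "word_op w (\<lambda>n. \<Sum>i\<in>X. c i *\<^sub>C x i n) = (\<lambda>n. \<Sum>i\<in>X. c i *\<^sub>C word_op w (x i) n)"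
  by (induction X rule: infinite_finite_induct) (simp_all add: word_op_0 word_op_add word_op_scaleC)

lemma fin_word_op: "fin x \<Longrightarrow> fin (word_op w x)"
proof -
  have "fin x \<Longrightarrow> fin (foldr letter_op ls x)" for ls
    by (induction ls) (simp_all add: fin_letter_op del: letter_op.simps)
  then show "fin x \<Longrightarrow> fin (word_op w x)" by (simp add: word_op_def)
qed

lemma adj_word_op: "adj (word_op w) (word_op (star_word w))"
proof -
  have "form (foldr letter_op ls x) y = form x (foldr letter_op (rev (map star_letter ls)) y)"
    if "fin x" "fin y" for ls x y
    using that
  proof (induction ls arbitrary: y)
    case (Cons l ls)
    have "fin (foldr letter_op ls x)"
      using fin_word_op[of x "Word ls"] Cons.prems by (simp add: word_op_def)
    then have "form (letter_op l (foldr letter_op ls x)) y = form (foldr letter_op ls x) (letter_op (star_letter l) y)"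
      using adj_letter_op Cons.prems by (simp add: adj_def)
    then show ?case using Cons by (simp add: fin_letter_op del: letter_op.simps)
  qed simp
  then show ?thesis by (simp add: adj_def fin_word_op) (simp add: word_op_def star_word_def)
qed

lemma bounded_by_word_op: "\<exists>C\<ge>0. bounded_by C (word_op w)"
proof -
  have "\<exists>C\<ge>0. bounded_by C (foldr letter_op ls)" for ls
  proof (induction ls)
    case Nil
    have "bounded_by 1 (\<lambda>x. x)" by (simp add: bounded_by_def positive_0)
    then show ?case by (intro exI[of _ 1]) (simp add: id_def)
  next
    case (Cons l ls)
    then obtain C where C: "C \<ge> 0" "bounded_by C (foldr letter_op ls)" by blast
    obtain D where D: "D \<ge> 0" "bounded_by D (letter_op l)" using bounded_by_letter_op by blast
    have "bounded_by (D * C) (\<lambda>x. letter_op l (foldr letter_op ls x))"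
      using fin_word_op[of _ "Word ls"] by (intro bounded_by_comp C D) (simp add: word_op_def)
    then show ?case using C D by (intro exI[of _ "D * C"]) (simp add: comp_def)
  qed
  then show ?thesis by (simp add: word_op_def)
qed

section \<open>The Fock representation of the free *-algebra\<close>

definition fock :: "'a free_alg \<Rightarrow> (nat \<Rightarrow> 'a) \<Rightarrow> nat \<Rightarrow> 'a" where
  "fock f x = (\<lambda>n. \<Sum>w\<in>Poly_Mapping.keys f. Poly_Mapping.lookup f w *\<^sub>C word_op w x n)"

lemma fock_superset:
  assumes "finite X" "Poly_Mapping.keys f \<subseteq> X"
  shows "fock f x = (\<lambda>n. \<Sum>w\<in>X. Poly_Mapping.lookup f w *\<^sub>C word_op w x n)"
  unfolding fock_def using assms by (intro ext sum.mono_neutral_left) (auto simp: in_keys_iff)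

lemma fock_add: "fock (f + g) x = (\<lambda>n. fock f x n + fock g x n)"
proof -
  let ?X = "Poly_Mapping.keys f \<union> Poly_Mapping.keys g"
  have "finite ?X" by simp
  then show ?thesis
    using keys_add[of f g]
    by (simp add: fock_superset[of ?X] lookup_add scaleC_add_left sum.distrib)
qed

lemma fock_0: "fock 0 x = (\<lambda>n. 0)"
  by (simp add: fock_def)

lemma fock_sum: "fock (sum f X) x = (\<lambda>n. \<Sum>i\<in>X. fock (f i) x n)"
  by (induction X rule: infinite_finite_induct) (simp_all add: fock_0 fock_add)

lemma fock_diff: "fock (f - g) x = (\<lambda>n. fock f x n - fock g x n)"
  using fock_add[of "f - g" g x] by (simp add: fun_eq_iff)

lemma fock_monomial: "fock (Poly_Mapping.single w c) x = (\<lambda>n. c *\<^sub>C word_op w x n)"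
  by (simp add: fock_superset[of "{w}"])

lemma fock_mult: "fock (f * g) x = fock f (fock g x)"
proof -
  have "fock (f * g) x = (\<lambda>n. \<Sum>v\<in>Poly_Mapping.keys f. \<Sum>w\<in>Poly_Mapping.keys g.
         (Poly_Mapping.lookup f v * Poly_Mapping.lookup g w) *\<^sub>C word_op v (word_op w x) n)"
    by (subst (1) free_alg_expand[of f], subst (1) free_alg_expand[of g])
       (simp add: sum_product mult_single fock_sum fock_monomial word_op_plus)
  also have "\<dots> = fock f (fock g x)"
    by (simp add: fock_def word_op_sum complex_vector.scale_sum_right scaleC_scaleC)
  finally show ?thesis .
qed

lemma fock_gens:
  "fock (free_const c) x = (\<lambda>n. c *\<^sub>C x n)" "fock 1 x = x" "fock (free_elt a) x = (\<lambda>n. a * x n)"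
  "fock free_gen x = letter_op Gen x" "fock (star_free free_gen) x = letter_op Gen_star x"
proof -
  show c: "fock (free_const c) x = (\<lambda>n. c *\<^sub>C x n)" for c
    by (simp add: free_const_def fock_monomial word_op_def zero_free_word_def)
  show "fock 1 x = x"
    using c[of 1] by (simp add: free_const_def scaleC_one)
  show "fock (free_elt a) x = (\<lambda>n. a * x n)" "fock free_gen x = letter_op Gen x"
    by (simp_all add: free_elt_def free_gen_def fock_monomial word_op_def scaleC_one)
  show "fock (star_free free_gen) x = letter_op Gen_star x"
    by (simp add: star_free_def free_gen_def fock_monomial word_op_def scaleC_one star_word_def)
qed

lemma fin_fock: "fin x \<Longrightarrow> fin (fock f x)"
  by (simp add: fock_def fin_sum fin_scaleC fin_word_op)

lemma adj_fock: "adj (fock f) (fock (star_free f))"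
  unfolding adj_def
proof (intro conjI allI impI)
  fix x y assume x: "fin x" "fin y"
  have "form (fock f x) y = (\<Sum>w\<in>Poly_Mapping.keys f. cnj (Poly_Mapping.lookup f w) *\<^sub>C form (word_op w x) y)"
    using x by (simp add: fock_def form_sum_left fin_scaleC fin_word_op form_scaleC_left)
  also have "\<dots> = form x (fock (star_free f) y)"
    using x adj_word_op
    by (simp add: star_free_def fock_sum fock_monomial form_sum_right form_scaleC_right adj_def)
  finally show "form (fock f x) y = form x (fock (star_free f) y)" .
qed (simp_all add: fin_fock)

lemma bounded_by_fock: "\<exists>C\<ge>0. bounded_by C (fock f)"
proof -
  obtain C where C: "\<And>w. C w \<ge> 0" "\<And>w. bounded_by (C w) (word_op w)"
    using bounded_by_word_op by metis
  have "bounded_by (\<Sum>w\<in>Poly_Mapping.keys f. cmod (Poly_Mapping.lookup f w) * C w)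
    (\<lambda>x n. \<Sum>w\<in>Poly_Mapping.keys f. Poly_Mapping.lookup f w *\<^sub>C word_op w x n)"
    using C by (intro bounded_by_sum bounded_by_scaleC) (auto intro: fin_word_op fin_scaleC)
  then show ?thesis
    using C by (intro exI[of _ "\<Sum>w\<in>Poly_Mapping.keys f. cmod (Poly_Mapping.lookup f w) * C w"])
      (auto simp: fock_def[abs_def] intro: sum_nonneg)
qed

section \<open>The Fock seminorm\<close>

definition fock_norm :: "'a free_alg \<Rightarrow> real" where
  "fock_norm f = Inf {C. 0 \<le> C \<and> bounded_by C (fock f)}"

lemma fock_norm_le: "0 \<le> C \<Longrightarrow> bounded_by C (fock f) \<Longrightarrow> fock_norm f \<le> C"
  unfolding fock_norm_def by (intro cInf_lower bdd_belowI[of _ 0]) auto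

lemma fock_norm_nonneg: "0 \<le> fock_norm f"
  unfolding fock_norm_def using bounded_by_fock[of f] by (intro cInf_greatest) auto

lemma bounded_by_fock_norm: "bounded_by (fock_norm f) (fock f)"
proof (rule bounded_by_limit[OF fock_norm_nonneg])
  fix D assume "fock_norm f < D"
  then obtain C where "C < D" "0 \<le> C" "bounded_by C (fock f)"
    unfolding fock_norm_def using bounded_by_fock[of f] cInf_lessD[of "{C. 0 \<le> C \<and> bounded_by C (fock f)}" D] by blast
  then show "bounded_by D (fock f)" using bounded_by_mono by auto
qed

lemma fock_norm_scale_le: "fock_norm (free_const c * f) \<le> cmod c * fock_norm f"
  using bounded_by_scaleC[of "fock_norm f" "fock f" c, OF bounded_by_fock_norm fin_fock]
  by (intro fock_norm_le) (simp_all add: fock_mult[abs_def] fock_gens fock_norm_nonneg)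

lemma cstar_seminorm_fock_norm: "cstar_seminorm fock_norm"
  unfolding cstar_seminorm_def
proof (intro conjI allI)
  fix f g :: "'a free_alg" and c
  show "fock_norm (f + g) \<le> fock_norm f + fock_norm g"
    using bounded_by_add[OF bounded_by_fock_norm[of f] bounded_by_fock_norm[of g]]
    by (intro fock_norm_le) (simp_all add: fock_norm_nonneg fock_add[abs_def] fin_fock)
  show mult: "fock_norm (f * g) \<le> fock_norm f * fock_norm g" for f g
    using bounded_by_comp[OF bounded_by_fock_norm[of f] bounded_by_fock_norm[of g]]
    by (intro fock_norm_le) (simp_all add: fock_norm_nonneg fock_mult[abs_def] fin_fock)
  show "fock_norm (free_const c * f) = cmod c * fock_norm f"
  proof (cases "c = 0")
    case True
    then show ?thesis
      using fock_norm_scale_le[of c f] fock_norm_nonneg[of "free_const c * f"] by simp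
  next
    case False
    have "free_const (inverse c) * (free_const c * f) = f"
      using False by (simp add: free_const_def mult_single flip: mult.assoc)
    then have "fock_norm f \<le> cmod (inverse c) * fock_norm (free_const c * f)"
      using fock_norm_scale_le[of "inverse c" "free_const c * f"] by simp
    then have "cmod c * fock_norm f \<le> fock_norm (free_const c * f)"
      using False by (simp add: norm_inverse norm_divide field_simps)
    then show ?thesis using fock_norm_scale_le[of c f] by simp
  qed
  have star: "fock_norm (star_free f) \<le> fock_norm f"
    by (intro fock_norm_le fock_norm_nonneg adj_bounded_by[OF adj_fock bounded_by_fock_norm])
  have "fock_norm f \<le> sqrt (fock_norm (star_free f * f))"
    by (intro fock_norm_le adj_cstar_bound[OF adj_fock] real_sqrt_ge_zero fock_norm_nonneg)
      (simp add: fock_norm_nonneg bounded_by_fock_norm flip: fock_mult)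
  then have "(fock_norm f)\<^sup>2 \<le> fock_norm (star_free f * f)"
    using power_mono[OF _ fock_norm_nonneg, of f _ 2] fock_norm_nonneg by fastforce
  moreover have "fock_norm (star_free f * f) \<le> (fock_norm f)\<^sup>2"
    using mult[of "star_free f" f] mult_right_mono[OF star fock_norm_nonneg[of f]]
    by (simp add: power2_eq_square)
  ultimately show "fock_norm (star_free f * f) = (fock_norm f)\<^sup>2" by simp
qed

text \<open>The relations hold exactly on sequences, and not just modulo null vectors of the
  form.\<close>

lemma fock_norm_relation:
  assumes "r \<in> toeplitz_relations \<alpha> L"
  shows "fock_norm r = 0"
proof -
  have L1: "L (a * \<alpha> b) = L a * b" for a b by (rule L_alpha_right)
  have "fock r x n = 0" for x n
    using assms
    by (auto simp: toeplitz_relations_def fock_diff fock_add fock_mult fock_gens distrib_right mult.assoc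
        scaleC_mult_left star_hom_simps[OF star_hom] L1 split: nat.split)
  then have "fock r = (\<lambda>x n. 0)" by (simp add: fun_eq_iff)
  then have "bounded_by 0 (fock r)" by (simp add: bounded_by_def form_def positive_0)
  then show ?thesis using fock_norm_le[of 0 r] fock_norm_nonneg[of r] by simp
qed

text \<open>Tested at the vacuum vector 1, where the form is \<open>star x * y\<close> without any
  power of \<open>L\<close>. This is what makes \<open>i\<close> isometric.\<close>

lemma norm_le_fock_norm: "norm a \<le> fock_norm (free_elt a)"
proof -
  have "form (fock (free_elt a) (single 0 1)) (fock (free_elt a) (single 0 1)) \<preceq> (fock_norm (free_elt a))\<^sup>2 *\<^sub>R form (single 0 1) (single 0 1)"
    using bounded_by_fock_norm fin_single by (simp add: bounded_by_def)
  moreover have "(\<lambda>n. a * single 0 1 n) = single 0 a" by (auto simp: single_def)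
  ultimately have "star a * a \<preceq> (fock_norm (free_elt a))\<^sup>2 *\<^sub>R 1"
    by (simp add: fock_gens form_single) (simp add: single_def star_1)
  then have "norm (star a * a) \<le> (fock_norm (free_elt a))\<^sup>2"
    by (intro positive_norm_le positive_star_mult_self) simp_all
  then show ?thesis
    using fock_norm_nonneg by (simp add: cstar_identity)
qed

section \<open>Vectors supported in high degree\<close>

definition tail :: "nat \<Rightarrow> (nat \<Rightarrow> 'a) \<Rightarrow> bool" where
  "tail n x \<longleftrightarrow> (\<forall>m<n. x m = 0)"

lemma tail_letter_op: "tail (Suc n) x \<Longrightarrow> tail n (letter_op l x)"
  by (cases l) (auto simp: tail_def L_0 star_hom_0[OF star_hom] split: nat.split)

lemma tail_word_op: "tail (n + length (letters w)) x \<Longrightarrow> tail n (word_op w x)"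
proof -
  have "tail (n + length ls) x \<Longrightarrow> tail n (foldr letter_op ls x)" for ls
    by (induction ls arbitrary: n) (auto simp del: letter_op.simps intro!: tail_letter_op)
  then show "tail (n + length (letters w)) x \<Longrightarrow> tail n (word_op w x)"
    by (simp add: word_op_def)
qed

text \<open>A letter lowers the degree by at most one, so the total length of the words of
  \<open>f\<close> bounds the loss. Right multiplication therefore only shifts the degree from which
  a tail bound holds.\<close>

lemma tail_fock: "\<exists>d. \<forall>n x. tail (n + d) x \<longrightarrow> tail n (fock f x)"
proof (intro exI allI impI)
  fix n x
  assume t: "tail (n + (\<Sum>w\<in>Poly_Mapping.keys f. length (letters w))) x"
  have "tail n (word_op w x)" if "w \<in> Poly_Mapping.keys f" for w
  proof (rule tail_word_op)
    have "length (letters w) \<le> (\<Sum>w\<in>Poly_Mapping.keys f. length (letters w))"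
      using that by (intro member_le_sum) auto
    then show "tail (n + length (letters w)) x" using t by (auto simp: tail_def)
  qed
  then show "tail n (fock f x)"
    by (auto simp: tail_def fock_def intro!: sum.neutral)
qed

end

section \<open>Auxiliary bounds, closed subspaces and closed spans\<close>

lemma mult_less_half:
  fixes t a e :: real
  assumes "t < e / (2 * (a + 1))" "0 \<le> t" "0 \<le> a"
  shows "t * a < e / 2"
proof -
  have "t * (2 * (a + 1)) < e" using assms by (simp add: pos_less_divide_eq)
  then show ?thesis using assms by (simp add: algebra_simps)
qed

lemma ex_scaled_bound:
  fixes d e c :: real
  assumes "0 < d" "0 < e" "0 \<le> c"
  obtains t where "0 < t" "t \<le> d" "c * t \<le> e"
proof
  show "0 < min d (e / (c + 1))" using assms by simp
  have "c * min d (e / (c + 1)) \<le> (c + 1) * (e / (c + 1))"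
    using assms by (intro mult_mono) auto
  then show "c * min d (e / (c + 1)) \<le> e" using assms by simp
qed simp

lemma closedI:
  fixes V :: "'a::real_normed_vector set"
  assumes "\<And>x. (\<And>e. 0 < e \<Longrightarrow> \<exists>y\<in>V. norm (y - x) < e) \<Longrightarrow> x \<in> V"
  shows "closed V"
proof -
  have "closure V \<subseteq> V"
  proof
    fix x assume "x \<in> closure V"
    then show "x \<in> V" using assms[of x] by (auto simp: closure_approachable dist_norm)
  qed
  then show ?thesis using closure_subset_eq by blast
qed

lemma subspace_closure:
  fixes V :: "'a::complex_normed_vector set"
  assumes V: "complex_vector.subspace V"
  shows "complex_vector.subspace (closure V)"
proof -
  have cl: "x \<in> closure V" if "x \<in> V" for x
    using that closure_subset by blast
  have add1: "x + y \<in> closure V" if "x \<in> V" "y \<in> closure V" for x y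
  proof -
    have "(\<lambda>y. x + y) ` closure V \<subseteq> closure V"
      using that(1) V by (intro image_closure_subset) (auto intro!: continuous_intros cl complex_vector.subspace_add)
    then show ?thesis using that(2) by blast
  qed
  have add: "x + y \<in> closure V" if "x \<in> closure V" "y \<in> closure V" for x y
  proof -
    have "(\<lambda>x. x + y) ` closure V \<subseteq> closure V"
      using that(2) by (intro image_closure_subset) (auto intro!: continuous_intros add1)
    then show ?thesis using that(1) by blast
  qed
  have scale: "c *\<^sub>C x \<in> closure V" if "x \<in> closure V" for c x
  proof -
    have "(\<lambda>x. c *\<^sub>C x) ` closure V \<subseteq> closure V"
      using V by (intro image_closure_subset linear_continuous_on[OF bounded_linear_scaleC])
        (auto intro: cl complex_vector.subspace_scale)
    then show ?thesis using that by blast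
  qed
  show ?thesis
    unfolding complex_vector.subspace_def
    using add scale cl complex_vector.subspace_0[OF V] by blast
qed

lemma subspace_closed_span: "complex_vector.subspace (closed_span X)"
  unfolding closed_span_def by (intro subspace_closure complex_vector.subspace_span)

lemma closed_span_base: "x \<in> X \<Longrightarrow> x \<in> closed_span X"
  unfolding closed_span_def using closure_subset complex_vector.span_base by blast

lemma closed_closed_span: "closed (closed_span X)"
  by (simp add: closed_span_def)

lemma closed_span_minimal:
  "X \<subseteq> V \<Longrightarrow> complex_vector.subspace V \<Longrightarrow> closed V \<Longrightarrow> closed_span X \<subseteq> V"
  unfolding closed_span_def by (intro closure_minimal complex_vector.span_minimal)

lemma closed_span_mult_left:
  fixes X :: "'a::unital_cstar_algebra set"
  assumes "\<And>x. x \<in> X \<Longrightarrow> z * x \<in> closed_span X" "y \<in> closed_span X"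
  shows "z * y \<in> closed_span X"
proof -
  let ?V = "(\<lambda>y. z * y) -` closed_span X"
  have "closed ?V"
    by (intro closed_vimage closed_closed_span continuous_intros)
  moreover have "complex_vector.subspace ?V"
    using subspace_closed_span[of X]
    by (auto simp: complex_vector.subspace_def distrib_left scaleC_mult_right)
  ultimately have "closed_span X \<subseteq> ?V"
    using assms(1) by (intro closed_span_minimal) auto
  then show ?thesis using assms(2) by auto
qed

lemma closed_span_mult_right:
  fixes X :: "'a::unital_cstar_algebra set"
  assumes "\<And>x. x \<in> X \<Longrightarrow> x * z \<in> closed_span X" "y \<in> closed_span X"
  shows "y * z \<in> closed_span X"
proof -
  let ?V = "(\<lambda>y. y * z) -` closed_span X"
  have "closed ?V"
    by (intro closed_vimage closed_closed_span continuous_intros)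
  moreover have "complex_vector.subspace ?V"
    using subspace_closed_span[of X]
    by (auto simp: complex_vector.subspace_def distrib_right scaleC_mult_left)
  ultimately have "closed_span X \<subseteq> ?V"
    using assms(1) by (intro closed_span_minimal) auto
  then show ?thesis using assms(2) by auto
qed

lemma A_alpha_A_mult:
  assumes "x \<in> A_alpha_A \<alpha>"
  shows "z * x \<in> A_alpha_A \<alpha>" "x * z \<in> A_alpha_A \<alpha>"
proof -
  let ?X = "{a * \<alpha> b * c |a b c. True}"
  have gen: "z * (a * \<alpha> b * c) \<in> closed_span ?X" "(a * \<alpha> b * c) * z \<in> closed_span ?X" for a b c
  proof -
    have "z * (a * \<alpha> b * c) = (z * a) * \<alpha> b * c" "(a * \<alpha> b * c) * z = a * \<alpha> b * (c * z)"
      by (simp_all add: mult.assoc)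
    then show "z * (a * \<alpha> b * c) \<in> closed_span ?X" "(a * \<alpha> b * c) * z \<in> closed_span ?X"
      by (auto intro!: closed_span_base)
  qed
  show "z * x \<in> A_alpha_A \<alpha>"
    unfolding A_alpha_A_def
    by (rule closed_span_mult_left) (use gen(1) assms in \<open>auto simp: A_alpha_A_def\<close>)
  show "x * z \<in> A_alpha_A \<alpha>"
    unfolding A_alpha_A_def
    by (rule closed_span_mult_right) (use gen(2) assms in \<open>auto simp: A_alpha_A_def\<close>)
qed

section \<open>Redundancies\<close>

locale toeplitz_system = transfer_system \<alpha> L
  for \<alpha> L :: "'a::unital_cstar_algebra \<Rightarrow> 'a" +
  fixes i :: "'a \<Rightarrow> 't::unital_cstar_algebra" and S :: 't
  assumes toeplitz: "toeplitz_algebra \<alpha> L i S"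
begin

abbreviation eval :: "'a free_alg \<Rightarrow> 't" where
  "eval \<equiv> eval_free i S"

lemma unital_i: "unital_star_hom i" and i: "star_hom i" and i_1: "i 1 = 1"
  and S_i: "S * i a = i (\<alpha> a) * S" and i_L: "i (L a) = star S * i a * S"
  using toeplitz by (auto simp: toeplitz_algebra_def toeplitz_rep_def unital_star_hom_def)

lemma eval_dense: "0 < e \<Longrightarrow> \<exists>f. norm (eval f - x) < e"
  using toeplitz i closure_range_eval_free[OF i, of S] closure_approachable[of x "range eval"]
  by (auto simp: toeplitz_algebra_def dist_norm)

lemma fock_norm_le_eval: "fock_norm f \<le> norm (eval f)"
  using toeplitz cstar_seminorm_fock_norm fock_norm_relation by (auto simp: toeplitz_algebra_def)

lemma i_isometric: "norm (i a) = norm a"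
  using norm_le_fock_norm[of a] fock_norm_le_eval[of "free_elt a"] unital_star_hom_norm_le[OF unital_i, of a]
  by (simp add: eval_free_gens)

lemma i_reflects_positive: "positive (i a) \<Longrightarrow> positive a"
  by (rule isometric_star_hom_reflects_positive[OF unital_i i_isometric])

abbreviation dyads :: "'t set" where
  "dyads \<equiv> {i b * S * star S * i c | b c. True}"

lemma span_dyads:
  assumes "x \<in> complex_vector.span dyads"
  obtains n :: nat and B C where "x = (\<Sum>j<n. i (B j) * S * star S * i (C j))"
proof -
  have "\<exists>(n::nat) B C. x = (\<Sum>j<n. i (B j) * S * star S * i (C j))"
    using assms
  proof (induction rule: complex_vector.span_induct_alt)
    case base
    show ?case by (rule exI[of _ 0]) simp
  next
    case (step c x y)
    then obtain b d n B C where
      "x = i b * S * star S * i d" "y = (\<Sum>j<(n::nat). i (B j) * S * star S * i (C j))" by blast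
    then have "c *\<^sub>C x + y = (\<Sum>j<Suc n. i ((B(n := c *\<^sub>C b)) j) * S * star S * i ((C(n := d)) j))"
      by (simp add: star_hom_simps[OF i] scaleC_mult_left add.commute)
    then show ?case by blast
  qed
  then show ?thesis using that by blast
qed

text \<open>The difference of left multiplication by \<open>b\<close> and the sum of the rank one operators
  given by \<open>B j\<close> and \<open>C j\<close>, on \<open>A\<close> as a dense subspace of \<open>M\<^sub>L\<close>.\<close>

definition defect :: "nat \<Rightarrow> (nat \<Rightarrow> 'a) \<Rightarrow> (nat \<Rightarrow> 'a) \<Rightarrow> 'a \<Rightarrow> 'a \<Rightarrow> 'a" where
  "defect n B C b x = b * x - (\<Sum>j<n. B j * \<alpha> (L (C j * x)))"

text \<open>Covariance gives \<open>i (\<alpha> (L (C j * x))) * S = S * i (L (C j * x)) = S * star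
  S * i (C j * x) * S\<close>, so the rank one terms become dyads, and the redundancy condition
  replaces \<open>i b\<close> by \<open>k\<close>. The error of \<open>b\<close> against rank one
  operators is thus the error of \<open>k\<close> against dyads.\<close>

lemma i_defect:
  assumes "redundancy i S b k"
  shows "i (defect n B C b x) * S = (k - (\<Sum>j<n. i (B j) * S * star S * i (C j))) * (i x * S)"
proof -
  have "i (B j) * i (\<alpha> (L (C j * x))) * S = i (B j) * S * star S * i (C j) * (i x * S)" for j
    unfolding mult.assoc S_i[symmetric] by (simp add: i_L star_hom_simps[OF i] mult.assoc)
  then show ?thesis
    using assms
    by (simp add: defect_def star_hom_diff[OF i] star_hom_sum[OF i] star_hom_simps[OF i]
        left_diff_distrib sum_distrib_right redundancy_def mult.assoc)
qed

text \<open>Since \<open>i (L (star z * z)) = star (i z * S) * (i z * S)\<close>, the inequality is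
  an ordinary norm bound in the Toeplitz algebra; as \<open>i\<close> reflects positivity, it
  descends to \<open>A\<close>. It serves both the tail bound and compactness of the left
  action.\<close>

lemma L_defect:
  assumes "redundancy i S b k" "norm (k - (\<Sum>j<n. i (B j) * S * star S * i (C j))) \<le> e"
  shows "L (star (defect n B C b x) * defect n B C b x) \<preceq> e\<^sup>2 *\<^sub>R L (star x * x)"
proof (rule i_reflects_positive)
  let ?D = "k - (\<Sum>j<n. i (B j) * S * star S * i (C j))" and ?y = "defect n B C b x"
  have iL: "i (L (star z * z)) = star (i z * S) * (i z * S)" for z
    by (simp add: i_L star_hom_simps[OF i] star_simps mult.assoc)
  have "star (?D * (i x * S)) * (?D * (i x * S)) \<preceq> e\<^sup>2 *\<^sub>R (star (i x * S) * (i x * S))"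
    by (rule star_mult_self_mult_le[OF assms(2)])
  then show "positive (i (e\<^sup>2 *\<^sub>R L (star x * x) - L (star ?y * ?y)))"
    by (simp only: star_hom_diff[OF i] star_hom_scaleR[OF i] iL i_defect[OF assms(1)])
qed

definition redundant :: "'a set" where
  "redundant = {b \<in> A_alpha_A \<alpha>. \<exists>k. redundancy i S b k}"

lemma subspace_redundant: "complex_vector.subspace redundant"
proof -
  have V: "complex_vector.subspace (closed_span dyads)" "complex_vector.subspace (A_alpha_A \<alpha>)"
    unfolding A_alpha_A_def by (rule subspace_closed_span)+
  have "redundancy i S 0 0"
    using V(1) by (simp add: redundancy_def star_hom_0[OF i] complex_vector.subspace_0)
  moreover have "redundancy i S (b + c) (k + l)" if "redundancy i S b k" "redundancy i S c l" for b c k l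
    using that V(1)
    by (auto simp: redundancy_def star_hom_simps[OF i] distrib_right intro: complex_vector.subspace_add)
  moreover have "redundancy i S (z *\<^sub>C b) (z *\<^sub>C k)" if "redundancy i S b k" for b k z
    using that V(1)
    by (auto simp: redundancy_def star_hom_simps[OF i] scaleC_mult_left intro: complex_vector.subspace_scale)
  ultimately show ?thesis
    using V(2) unfolding complex_vector.subspace_def redundant_def by blast
qed

lemma redundant_mult:
  assumes "b \<in> redundant"
  shows "z * b \<in> redundant" "b * z \<in> redundant"
proof -
  obtain k where k: "redundancy i S b k" and b: "b \<in> A_alpha_A \<alpha>"
    using assms by (auto simp: redundant_def)
  have gen: "i z * x \<in> dyads" "x * i z \<in> dyads" if x: "x \<in> dyads" for x
  proof -
    obtain b c where "x = i b * S * star S * i c" using x by blast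
    then have "i z * x = i (z * b) * S * star S * i c" "x * i z = i b * S * star S * i (c * z)"
      by (simp_all add: star_hom_simps[OF i] mult.assoc)
    then show "i z * x \<in> dyads" "x * i z \<in> dyads" by blast+
  qed
  have kd: "k \<in> closed_span dyads" using k by (simp add: redundancy_def)
  have "i z * k \<in> closed_span dyads"
    by (rule closed_span_mult_left[OF closed_span_base[OF gen(1)] kd])
  then have "redundancy i S (z * b) (i z * k)"
    using k by (simp add: redundancy_def star_hom_simps[OF i] mult.assoc)
  then show "z * b \<in> redundant" using A_alpha_A_mult b by (auto simp: redundant_def)
  have "k * i z \<in> closed_span dyads"
    by (rule closed_span_mult_right[OF closed_span_base[OF gen(2)] kd])
  moreover have "i b * i z * i c * S = k * i z * i c * S" for c
    using k star_hom_simps(3)[OF i, of z c] by (simp add: redundancy_def mult.assoc) (metis mult.assoc)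
  ultimately have "redundancy i S (b * z) (k * i z)"
    by (simp add: redundancy_def star_hom_simps[OF i])
  then show "b * z \<in> redundant" using A_alpha_A_mult b by (auto simp: redundant_def)
qed

section \<open>Closed ideals of the Toeplitz algebra\<close>

text \<open>Scaling \<open>w\<close> by \<open>1/e\<close> before applying
  \<open>form_norm_le\<close> makes the estimate linear in \<open>e\<close>: operators with small
  bounds have small matrix coefficients.\<close>

lemma form_small:
  assumes "fin u" "fin v" "fin w" "form w w \<preceq> e\<^sup>2 *\<^sub>R form u u" "0 < e"
  shows "norm (form v w) \<le> e * (2 * (norm (form v v) + norm (form u u)))"
proof -
  let ?w = "\<lambda>n. (1/e) *\<^sub>R w n"
  have w: "fin ?w" using assms by (simp add: fin_scaleR)
  have "form ?w ?w \<preceq> form u u"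
    using positive_le_scaleR[OF assms(4), of "1/e\<^sup>2"] assms
    by (simp add: form_simps power2_eq_square)
  then have "norm (form ?w ?w) \<le> norm (form u u)"
    by (rule positive_norm_mono[OF form_positive])
  then have "norm (form v ?w) \<le> 2 * (norm (form v v) + norm (form u u))"
    using form_norm_le[OF assms(2) w] by simp
  then show ?thesis using assms by (simp add: form_simps field_simps)
qed

text \<open>The order of choices matters: \<open>g\<close> is fixed before \<open>f\<close>, and
  \<open>d\<close> works for all \<open>f\<close>. In the ideal proofs, \<open>fock g u\<close> can
  then serve as a test vector, or \<open>g\<close> as a fixed operator, while \<open>f\<close> is
  still to be chosen.\<close>

lemma approx_mult_right:
  assumes "0 < e"
  obtains g d where "0 < d" "\<And>f. norm (eval f - x) < d \<Longrightarrow> norm (eval (f * g) - x * y) < e"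
proof -
  obtain g where g: "norm (eval g - y) < e / (2 * (norm x + 1))"
    using eval_dense[of "e / (2 * (norm x + 1))" y] assms by (auto simp: add_nonneg_pos)
  show ?thesis
  proof (rule that[of "e / (2 * (norm (eval g) + 1))" g])
    show "0 < e / (2 * (norm (eval g) + 1))" using assms by (simp add: add_nonneg_pos)
    fix f assume f: "norm (eval f - x) < e / (2 * (norm (eval g) + 1))"
    have 1: "norm (eval f - x) * norm (eval g) < e / 2"
      using mult_less_half[OF f] by simp
    have 2: "norm x * norm (eval g - y) < e / 2"
      using mult_less_half[OF g] by (simp add: mult.commute)
    have "eval (f * g) - x * y = (eval f - x) * eval g + x * (eval g - y)"
      by (simp add: eval_free_mult algebra_simps)
    also have "norm \<dots> \<le> norm (eval f - x) * norm (eval g) + norm x * norm (eval g - y)"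
      by (intro order_trans[OF norm_triangle_ineq] add_mono norm_mult_ineq)
    finally show "norm (eval (f * g) - x * y) < e" using 1 2 by linarith
  qed
qed

lemma approx_mult_left:
  assumes "0 < e"
  obtains g d where "0 < d" "\<And>f. norm (eval f - x) < d \<Longrightarrow> norm (eval (g * f) - y * x) < e"
proof -
  obtain g d where gd: "0 < d" "\<And>f. norm (eval f - star x) < d \<Longrightarrow> norm (eval (f * g) - star x * star y) < e"
    using approx_mult_right[OF assms] by blast
  show ?thesis
  proof (rule that[of d "star_free g"])
    fix f assume "norm (eval f - x) < d"
    then have "norm (eval (star_free f) - star x) < d"
      by (simp add: eval_free_star[OF i] norm_star flip: star_diff)
    from gd(2)[OF this] have "norm (star (eval g) * eval f - y * x) < e"
      by (subst norm_star[symmetric])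
        (simp add: eval_free_mult eval_free_star[OF i] star_simps)
    then show "norm (eval (star_free g * f) - y * x) < e"
      by (simp add: eval_free_mult eval_free_star[OF i])
  qed (rule gd)
qed

text \<open>The Fock operators are defined for the free *-algebra only. The two ideals below are therefore
  described by approximants. An element lies in the first one if the matrix coefficients
  of its Fock operator lie in the closure of the redundant elements.\<close>

definition coefficient_ideal :: "'t set" where
  "coefficient_ideal = {x. \<forall>u v. fin u \<longrightarrow> fin v \<longrightarrow> (\<forall>e>0. \<exists>f. norm (eval f - x) < e \<and>
     (\<exists>d\<in>redundant. norm (form v (fock f u) - d) < e))}"

lemma coefficient_idealD:
  assumes "x \<in> coefficient_ideal" "fin u" "fin v" "0 < e"
  obtains f d where "norm (eval f - x) < e" "d \<in> redundant" "norm (form v (fock f u) - d) < e"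
  using assms unfolding coefficient_ideal_def by blast

text \<open>All test vectors are allowed, so multiplication is absorbed by them: on the right it
  replaces \<open>u\<close> by \<open>fock g u\<close>, on the left it replaces \<open>v\<close> by
  \<open>fock (star_free g) v\<close>.\<close>

lemma closed_ideal_coefficient_ideal: "closed_ideal coefficient_ideal"
  unfolding closed_ideal_def
proof (intro conjI ballI allI)
  show "closed coefficient_ideal"
  proof (rule closedI)
    fix x assume x: "\<And>e. 0 < e \<Longrightarrow> \<exists>y\<in>coefficient_ideal. norm (y - x) < e"
    show "x \<in> coefficient_ideal"
      unfolding coefficient_ideal_def
    proof (intro CollectI allI impI)
      fix u v and e :: real assume uv: "fin u" "fin v" and e: "0 < e"
      obtain y where y: "y \<in> coefficient_ideal" "norm (y - x) < e/2"
        using x[of "e/2"] e by auto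
      obtain f d where f: "norm (eval f - y) < e/2" "d \<in> redundant" "norm (form v (fock f u) - d) < e/2"
        using coefficient_idealD[OF y(1) uv, of "e/2"] e by auto
      have "norm (eval f - x) < e"
        using norm_triangle_ineq[of "eval f - y" "y - x"] f y by simp
      moreover have "norm (form v (fock f u) - d) < e" using f e by simp
      ultimately show "\<exists>f. norm (eval f - x) < e \<and> (\<exists>d\<in>redundant. norm (form v (fock f u) - d) < e)"
        using f(2) by blast
    qed
  qed
  show "complex_vector.subspace coefficient_ideal"
    unfolding complex_vector.subspace_def
  proof (intro conjI ballI allI)
    show "0 \<in> coefficient_ideal"
      unfolding coefficient_ideal_def
      by (auto intro!: exI[of _ 0] bexI[of _ 0] complex_vector.subspace_0[OF subspace_redundant]
          simp: eval_free_0 fock_0 form_def Ln_0)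
    show "x + y \<in> coefficient_ideal" if xy: "x \<in> coefficient_ideal" "y \<in> coefficient_ideal" for x y
      unfolding coefficient_ideal_def
    proof (intro CollectI allI impI)
      fix u v and e :: real assume uv: "fin u" "fin v" and e: "0 < e"
      obtain f d where f: "norm (eval f - x) < e/2" "d \<in> redundant" "norm (form v (fock f u) - d) < e/2"
        using coefficient_idealD[OF xy(1) uv, of "e/2"] e by auto
      obtain g c where g: "norm (eval g - y) < e/2" "c \<in> redundant" "norm (form v (fock g u) - c) < e/2"
        using coefficient_idealD[OF xy(2) uv, of "e/2"] e by auto
      have "norm (eval (f + g) - (x + y)) < e"
        using norm_triangle_ineq[of "eval f - x" "eval g - y"] f g by (simp add: eval_free_add algebra_simps)
      moreover have "norm (form v (fock (f + g) u) - (d + c)) < e"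
        using norm_triangle_ineq[of "form v (fock f u) - d" "form v (fock g u) - c"] f g
        by (simp add: fock_add form_add_right algebra_simps)
      ultimately show "\<exists>f. norm (eval f - (x + y)) < e \<and> (\<exists>d\<in>redundant. norm (form v (fock f u) - d) < e)"
        using complex_vector.subspace_add[OF subspace_redundant f(2) g(2)] by blast
    qed
    show "c *\<^sub>C x \<in> coefficient_ideal" if x: "x \<in> coefficient_ideal" for c x
      unfolding coefficient_ideal_def
    proof (intro CollectI allI impI)
      fix u v and e :: real assume uv: "fin u" "fin v" and e: "0 < e"
      define e' where "e' = e / (cmod c + 1)"
      have e': "0 < e'" "cmod c * t < e" if "t < e'" "0 \<le> t" for t
      proof -
        show "0 < e'" using e by (simp add: e'_def add_nonneg_pos)
        have "cmod c * t \<le> (cmod c + 1) * t" using that by (simp add: mult_right_mono)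
        also have "\<dots> < (cmod c + 1) * e'" using that by (simp add: add_nonneg_pos)
        also have "\<dots> = e" using norm_ge_zero[of c] unfolding e'_def by (simp add: add_nonneg_eq_0_iff)
        finally show "cmod c * t < e" .
      qed
      have "0 < e'" using e by (simp add: e'_def add_nonneg_pos)
      then obtain f d where f: "norm (eval f - x) < e'" "d \<in> redundant" "norm (form v (fock f u) - d) < e'"
        using coefficient_idealD[OF x uv] by blast
      have "norm (eval (free_const c * f) - c *\<^sub>C x) < e"
        using e'(2)[OF f(1)]
        by (simp add: eval_free_scaleC norm_scaleC flip: complex_vector.scale_right_diff_distrib)
      moreover have "norm (form v (fock (free_const c * f) u) - c *\<^sub>C d) < e"
        using e'(2)[OF f(3)]
        by (simp add: fock_mult fock_gens form_scaleC_right norm_scaleC flip: complex_vector.scale_right_diff_distrib)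
      ultimately show "\<exists>f. norm (eval f - c *\<^sub>C x) < e \<and> (\<exists>d\<in>redundant. norm (form v (fock f u) - d) < e)"
        using complex_vector.subspace_scale[OF subspace_redundant f(2)] by blast
    qed
  qed
  fix x y assume x: "x \<in> coefficient_ideal"
  show "x * y \<in> coefficient_ideal"
    unfolding coefficient_ideal_def
  proof (intro CollectI allI impI)
    fix u v and e :: real assume uv: "fin u" "fin v" and e: "0 < e"
    obtain g d where gd: "0 < d" "\<And>f. norm (eval f - x) < d \<Longrightarrow> norm (eval (f * g) - x * y) < e"
      using approx_mult_right[OF e] by blast
    obtain f c where "norm (eval f - x) < min d e" "c \<in> redundant" "norm (form v (fock f (fock g u)) - c) < min d e"
      using coefficient_idealD[OF x fin_fock[OF uv(1), of g] uv(2), of "min d e"] gd e by auto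
    then show "\<exists>f. norm (eval f - x * y) < e \<and> (\<exists>d\<in>redundant. norm (form v (fock f u) - d) < e)"
      using gd(2) by (intro exI[of _ "f * g"]) (auto simp: fock_mult)
  qed
  show "y * x \<in> coefficient_ideal"
    unfolding coefficient_ideal_def
  proof (intro CollectI allI impI)
    fix u v and e :: real assume uv: "fin u" "fin v" and e: "0 < e"
    obtain g d where gd: "0 < d" "\<And>f. norm (eval f - x) < d \<Longrightarrow> norm (eval (g * f) - y * x) < e"
      using approx_mult_left[OF e] by blast
    obtain f c where "norm (eval f - x) < min d e" "c \<in> redundant" "norm (form (fock (star_free g) v) (fock f u) - c) < min d e"
      using coefficient_idealD[OF x uv(1) fin_fock[OF uv(2), of "star_free g"], of "min d e"] gd e by auto
    moreover have "form (fock (star_free g) v) (fock f u) = form v (fock g (fock f u))"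
      using adj_sym[OF adj_fock[of g]] uv by (simp add: adj_def fin_fock)
    ultimately show "\<exists>f. norm (eval f - y * x) < e \<and> (\<exists>d\<in>redundant. norm (form v (fock f u) - d) < e)"
      using gd(2) by (intro exI[of _ "g * f"]) (auto simp: fock_mult)
  qed
qed

definition tail_bounded :: "real \<Rightarrow> nat \<Rightarrow> 'a free_alg \<Rightarrow> bool" where
  "tail_bounded e n f \<longleftrightarrow> (\<forall>u. fin u \<longrightarrow> tail n u \<longrightarrow> form (fock f u) (fock f u) \<preceq> e\<^sup>2 *\<^sub>R form u u)"

text \<open>The Fock operators tend to zero in norm on the summands of high degree.\<close>

definition tail_ideal :: "'t set" where
  "tail_ideal = {x. \<forall>e>0. \<exists>f n. norm (eval f - x) < e \<and> tail_bounded e n f}"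

lemma tail_idealD:
  assumes "x \<in> tail_ideal" "0 < e"
  obtains f n where "norm (eval f - x) < e" "tail_bounded e n f"
  using assms unfolding tail_ideal_def by blast

lemma tail_bounded_mono: "tail_bounded d n f \<Longrightarrow> 0 \<le> d \<Longrightarrow> d \<le> e \<Longrightarrow> tail_bounded e n f"
  unfolding tail_bounded_def
  by (meson form_positive positive_le_scaleR_left positive_le_trans power_mono)

lemma tail_mono: "tail n x \<Longrightarrow> m \<le> n \<Longrightarrow> tail m x"
  by (auto simp: tail_def)

lemma tail_bounded_add:
  assumes "tail_bounded (e/2) m f" "tail_bounded (e/2) n g"
  shows "tail_bounded e (max m n) (f + g)"
  unfolding tail_bounded_def
proof (intro allI impI)
  fix u assume u: "fin u" "tail (max m n) u"
  \<comment> \<open>Equal bounds \<open>e/2\<close> call for weight 1; the two factors 2 then add up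
    to exactly \<open>e\<^sup>2\<close>.\<close>
  have 1: "form (fock (f + g) u) (fock (f + g) u) \<preceq>
      (1 + 1) *\<^sub>R form (fock f u) (fock f u) + (1 + 1/1) *\<^sub>R form (fock g u) (fock g u)"
    unfolding fock_add by (rule form_triangle) (simp_all add: fin_fock u)
  have 2: "(1 + 1) *\<^sub>R form (fock f u) (fock f u) + (1 + 1/1) *\<^sub>R form (fock g u) (fock g u) \<preceq>
      (1 + 1) *\<^sub>R ((e/2)\<^sup>2 *\<^sub>R form u u) + (1 + 1/1) *\<^sub>R ((e/2)\<^sup>2 *\<^sub>R form u u)"
    using assms u tail_mono[OF u(2)]
    by (intro positive_le_add positive_le_scaleR) (auto simp: tail_bounded_def)
  have 3: "(1 + 1) *\<^sub>R ((e/2)\<^sup>2 *\<^sub>R form u u) + (1 + 1/1) *\<^sub>R ((e/2)\<^sup>2 *\<^sub>R form u u) = e\<^sup>2 *\<^sub>R form u u"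
    by (simp add: power_divide flip: scaleR_left_distrib)
  show "form (fock (f + g) u) (fock (f + g) u) \<preceq> e\<^sup>2 *\<^sub>R form u u"
    using positive_le_trans[OF 1 2] unfolding 3 .
qed

lemma tail_bounded_mult_left:
  assumes "tail_bounded e n f"
  shows "tail_bounded (fock_norm g * e) n (g * f)"
  unfolding tail_bounded_def
proof (intro allI impI)
  fix u assume u: "fin u" "tail n u"
  have 1: "form (fock (g * f) u) (fock (g * f) u) \<preceq> (fock_norm g)\<^sup>2 *\<^sub>R form (fock f u) (fock f u)"
    using bounded_by_fock_norm[of g] u by (simp add: bounded_by_def fin_fock fock_mult)
  have 2: "(fock_norm g)\<^sup>2 *\<^sub>R form (fock f u) (fock f u) \<preceq> (fock_norm g)\<^sup>2 *\<^sub>R (e\<^sup>2 *\<^sub>R form u u)"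
    using assms u by (intro positive_le_scaleR) (auto simp: tail_bounded_def)
  show "form (fock (g * f) u) (fock (g * f) u) \<preceq> (fock_norm g * e)\<^sup>2 *\<^sub>R form u u"
    using positive_le_trans[OF 1 2] by (simp add: power_mult_distrib)
qed

lemma tail_bounded_mult_right:
  assumes "tail_bounded e n f"
  shows "\<exists>m. tail_bounded (e * fock_norm g) m (f * g)"
proof -
  obtain d where d: "\<And>n x. tail (n + d) x \<Longrightarrow> tail n (fock g x)"
    using tail_fock by metis
  have "tail_bounded (e * fock_norm g) (n + d) (f * g)"
    unfolding tail_bounded_def
  proof (intro allI impI)
    fix u assume u: "fin u" "tail (n + d) u"
    have 1: "form (fock (f * g) u) (fock (f * g) u) \<preceq> e\<^sup>2 *\<^sub>R form (fock g u) (fock g u)"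
      using assms u d[of n u] by (simp add: tail_bounded_def fin_fock fock_mult)
    have 2: "e\<^sup>2 *\<^sub>R form (fock g u) (fock g u) \<preceq> e\<^sup>2 *\<^sub>R ((fock_norm g)\<^sup>2 *\<^sub>R form u u)"
      using bounded_by_fock_norm[of g] u by (intro positive_le_scaleR) (auto simp: bounded_by_def)
    show "form (fock (f * g) u) (fock (f * g) u) \<preceq> (e * fock_norm g)\<^sup>2 *\<^sub>R form u u"
      using positive_le_trans[OF 1 2] by (simp add: power_mult_distrib)
  qed
  then show ?thesis ..
qed

lemma closed_ideal_tail_ideal: "closed_ideal tail_ideal"
  unfolding closed_ideal_def
proof (intro conjI ballI allI)
  show "closed tail_ideal"
  proof (rule closedI)
    fix x assume x: "\<And>e. 0 < e \<Longrightarrow> \<exists>y\<in>tail_ideal. norm (y - x) < e"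
    show "x \<in> tail_ideal"
      unfolding tail_ideal_def
    proof (intro CollectI allI impI)
      fix e :: real assume e: "0 < e"
      obtain y where y: "y \<in> tail_ideal" "norm (y - x) < e/2"
        using x[of "e/2"] e by auto
      obtain f n where f: "norm (eval f - y) < e/2" "tail_bounded (e/2) n f"
        using tail_idealD[OF y(1), of "e/2"] e by auto
      have "norm (eval f - x) < e"
        using norm_triangle_ineq[of "eval f - y" "y - x"] f y by simp
      moreover have "tail_bounded e n f"
        using f(2) by (rule tail_bounded_mono) (use e in auto)
      ultimately show "\<exists>f n. norm (eval f - x) < e \<and> tail_bounded e n f" by blast
    qed
  qed
  have left: "y * x \<in> tail_ideal" if x: "x \<in> tail_ideal" for x y
    unfolding tail_ideal_def
  proof (intro CollectI allI impI)
    fix e :: real assume e: "0 < e"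
    obtain g d where gd: "0 < d" "\<And>f. norm (eval f - x) < d \<Longrightarrow> norm (eval (g * f) - y * x) < e"
      using approx_mult_left[OF e] by blast
    obtain t where t: "0 < t" "t \<le> d" "fock_norm g * t \<le> e"
      using ex_scaled_bound[OF gd(1) e fock_norm_nonneg] by blast
    obtain f n where f: "norm (eval f - x) < t" "tail_bounded t n f"
      using tail_idealD[OF x t(1)] by blast
    have "tail_bounded e n (g * f)"
      using tail_bounded_mult_left[OF f(2)] by (rule tail_bounded_mono) (use t fock_norm_nonneg in auto)
    then show "\<exists>f n. norm (eval f - y * x) < e \<and> tail_bounded e n f"
      using gd(2)[of f] f(1) t(2) by (meson less_le_trans)
  qed
  then show "y * x \<in> tail_ideal" if "x \<in> tail_ideal" for x y using that .
  show "x * y \<in> tail_ideal" if x: "x \<in> tail_ideal" for x y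
    unfolding tail_ideal_def
  proof (intro CollectI allI impI)
    fix e :: real assume e: "0 < e"
    obtain g d where gd: "0 < d" "\<And>f. norm (eval f - x) < d \<Longrightarrow> norm (eval (f * g) - x * y) < e"
      using approx_mult_right[OF e] by blast
    obtain t where t: "0 < t" "t \<le> d" "fock_norm g * t \<le> e"
      using ex_scaled_bound[OF gd(1) e fock_norm_nonneg] by blast
    obtain f n where f: "norm (eval f - x) < t" "tail_bounded t n f"
      using tail_idealD[OF x t(1)] by blast
    obtain m where m: "tail_bounded (t * fock_norm g) m (f * g)"
      using tail_bounded_mult_right[OF f(2)] by blast
    have "tail_bounded e m (f * g)"
      using m by (rule tail_bounded_mono) (use t fock_norm_nonneg in \<open>auto simp: mult.commute\<close>)
    then show "\<exists>f n. norm (eval f - x * y) < e \<and> tail_bounded e n f"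
      using gd(2)[of f] f(1) t(2) by (meson less_le_trans)
  qed
  show "complex_vector.subspace tail_ideal"
    unfolding complex_vector.subspace_def
  proof (intro conjI ballI allI)
    have "tail_bounded e 0 0" for e
      by (simp add: tail_bounded_def fock_0 positive_scaleR form_positive) (simp add: form_def positive_scaleR form_positive[unfolded form_def])
    then show "0 \<in> tail_ideal"
      unfolding tail_ideal_def by (auto intro!: exI[of _ 0] simp: eval_free_0)
    show "x + y \<in> tail_ideal" if xy: "x \<in> tail_ideal" "y \<in> tail_ideal" for x y
      unfolding tail_ideal_def
    proof (intro CollectI allI impI)
      fix e :: real assume e: "0 < e"
      obtain f m where f: "norm (eval f - x) < e/2" "tail_bounded (e/2) m f"
        using tail_idealD[OF xy(1), of "e/2"] e by auto
      obtain g n where g: "norm (eval g - y) < e/2" "tail_bounded (e/2) n g"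
        using tail_idealD[OF xy(2), of "e/2"] e by auto
      have "norm (eval (f + g) - (x + y)) < e"
        using norm_triangle_ineq[of "eval f - x" "eval g - y"] f g by (simp add: eval_free_add algebra_simps)
      then show "\<exists>f n. norm (eval f - (x + y)) < e \<and> tail_bounded e n f"
        using tail_bounded_add[OF f(2) g(2)] by blast
    qed
    show "c *\<^sub>C x \<in> tail_ideal" if "x \<in> tail_ideal" for c x
      using left[OF that, of "c *\<^sub>C 1"] by (simp add: scaleC_mult_left)
  qed
qed

section \<open>The generators of the redundancy ideal\<close>

text \<open>Approximate \<open>k\<close> by a sum of dyads and lift \<open>i b\<close> minus that
  sum to \<open>f\<close>. Its Fock operator preserves degrees: it is multiplication by
  \<open>b\<close> in degree zero, where dyads vanish, and the small \<open>defect\<close> in every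
  higher degree. So the tail bound already holds from degree 1, and a coefficient is
  \<open>star (v 0) * b * u 0\<close> up to a small error.\<close>

lemma redundancy_in_ideals:
  assumes k: "redundancy i S b k" and b: "b \<in> A_alpha_A \<alpha>"
  shows "i b - k \<in> coefficient_ideal" "i b - k \<in> tail_ideal"
proof -
  have approx: "\<exists>f. norm (eval f - (i b - k)) < e \<and> tail_bounded e 1 f \<and> (\<forall>u. fock f u 0 = b * u 0) \<and>
      (\<forall>u n. fock f (\<lambda>n. if n = 0 then 0 else u n) (Suc n) = fock f u (Suc n))" if e: "0 < e" for e
  proof -
    obtain \<kappa> where \<kappa>: "\<kappa> \<in> complex_vector.span dyads" "norm (k - \<kappa>) < e"
      using k e closure_approachable[of k "complex_vector.span dyads"]
      by (auto simp: redundancy_def closed_span_def dist_norm norm_minus_commute)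
    obtain n :: nat and B C where \<kappa>_eq: "\<kappa> = (\<Sum>j<n. i (B j) * S * star S * i (C j))"
      using span_dyads[OF \<kappa>(1)] by blast
    define f where "f = free_elt b - (\<Sum>j<n. free_elt (B j) * free_gen * star_free free_gen * free_elt (C j))"
    have ev: "eval f - (i b - k) = k - \<kappa>"
      by (simp add: f_def \<kappa>_eq eval_free_diff eval_free_sum eval_free_mult eval_free_gens eval_free_star[OF i])
    have f0: "fock f u 0 = b * u 0" for u
      by (simp add: f_def fock_diff fock_sum fock_mult fock_gens)
    have fS: "fock f u (Suc m) = defect n B C b (u (Suc m))" for u m
      by (simp add: f_def fock_diff fock_sum fock_mult fock_gens defect_def)
    have d0: "defect n B C b 0 = 0"
      by (simp add: defect_def L_0 star_hom_0[OF star_hom])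
    have "tail_bounded e 1 f"
      unfolding tail_bounded_def
    proof (intro allI impI)
      fix u assume u: "fin u" "tail 1 u"
      let ?N = "{n. u n \<noteq> 0}"
      have "fock f u m = 0" if "u m = 0" for m
        using that f0[of u] fS[of u] d0 by (cases m) auto
      then have "form (fock f u) (fock f u) = (\<Sum>m\<in>?N. (L ^^ m) (star (fock f u m) * fock f u m))"
        using u by (intro form_eq) (auto simp: fin_def)
      moreover have "positive (\<Sum>m\<in>?N. e\<^sup>2 *\<^sub>R (L ^^ m) (star (u m) * u m) - (L ^^ m) (star (fock f u m) * fock f u m))"
      proof (rule positive_sum)
        fix m assume "m \<in> ?N"
        \<comment> \<open>Positive degree provides one \<open>L\<close> to which
          \<open>L_defect\<close> applies; the remaining \<open>L ^^ l\<close> is monotone.\<close>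
        then obtain l where m: "m = Suc l" using u(2) by (cases m) (auto simp: tail_def)
        have "L (star (defect n B C b (u m)) * defect n B C b (u m)) \<preceq> e\<^sup>2 *\<^sub>R L (star (u m) * u m)"
          using \<kappa>(2) by (intro L_defect[OF k]) (simp add: \<kappa>_eq)
        from Ln_mono[OF this, of l]
        show "(L ^^ m) (star (fock f u m) * fock f u m) \<preceq> e\<^sup>2 *\<^sub>R (L ^^ m) (star (u m) * u m)"
          by (simp add: m fS Ln_scaleR funpow_swap1)
      qed
      ultimately show "form (fock f u) (fock f u) \<preceq> e\<^sup>2 *\<^sub>R form u u"
        by (simp only: form_def[of u] scaleR_sum_right sum_subtractf)
    qed
    then show ?thesis using \<kappa>(2) by (intro exI[of _ f]) (simp add: ev f0 fS)
  qed
  then show "i b - k \<in> tail_ideal"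
    unfolding tail_ideal_def by blast
  show "i b - k \<in> coefficient_ideal"
    unfolding coefficient_ideal_def
  proof (intro CollectI allI impI)
    fix u v and e :: real assume uv: "fin u" "fin v" and e: "0 < e"
    \<comment> \<open>Removing the vacuum component separates the exact action of \<open>b\<close>
      from the part that the tail bound controls.\<close>
    define u' where "u' = (\<lambda>n. if n = 0 then 0 else u n)"
    have u': "fin u'" "tail 1 u'" "u' 0 = 0"
      using uv(1) by (auto simp: u'_def tail_def intro: fin_map)
    obtain t where t: "0 < t" "t \<le> e/2" "(2 * (norm (form v v) + norm (form u' u'))) * t \<le> e/2"
      by (rule ex_scaled_bound[of "e/2" "e/2" "2 * (norm (form v v) + norm (form u' u'))"]) (use e in auto)
    obtain f where f: "norm (eval f - (i b - k)) < t" "tail_bounded t 1 f" "\<And>u. fock f u 0 = b * u 0"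
        "\<And>u n. fock f (\<lambda>n. if n = 0 then 0 else u n) (Suc n) = fock f u (Suc n)"
      using approx[OF t(1)] by blast
    have split: "fock f u = (\<lambda>n. single 0 (b * u 0) n + fock f u' n)"
    proof
      fix n show "fock f u n = single 0 (b * u 0) n + fock f u' n"
        by (cases n) (simp_all add: single_def f(3) u'(3), simp add: u'_def f(4))
    qed
    have "form v (single 0 (b * u 0)) = star (form (single 0 (b * u 0)) v)"
      using form_star[OF fin_single uv(2)] by simp
    then have d: "form v (single 0 (b * u 0)) = star (v 0) * b * u 0"
      by (simp add: form_single star_simps mult.assoc)
    have "b \<in> redundant" using k b by (auto simp: redundant_def)
    then have "form v (single 0 (b * u 0)) \<in> redundant"
      unfolding d by (intro redundant_mult)
    moreover have "norm (form v (fock f u')) \<le> t * (2 * (norm (form v v) + norm (form u' u')))"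
      using f(2) u' uv t by (intro form_small) (auto simp: tail_bounded_def fin_fock)
    then have "norm (form v (fock f u) - form v (single 0 (b * u 0))) < e"
      unfolding split form_add_right using t(3) e by (simp add: mult.commute)
    ultimately show "\<exists>f. norm (eval f - (i b - k)) < e \<and> (\<exists>d\<in>redundant. norm (form v (fock f u) - d) < e)"
      using f(1) t(2) e by (intro exI[of _ f]) auto
  qed
qed

lemma redundancy_ideal_subset: "redundancy_ideal \<alpha> i S \<subseteq> coefficient_ideal \<inter> tail_ideal"
  unfolding redundancy_ideal_def closed_ideal_generated_def
  using closed_ideal_coefficient_ideal closed_ideal_tail_ideal redundancy_in_ideals by blast

section \<open>Elements of the coefficient algebra in the two ideals\<close>

text \<open>The approximant \<open>f\<close> can be traded for \<open>free_elt a\<close>, because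
  \<open>fock_norm (f - free_elt a)\<close> is at most the distance of \<open>eval f\<close> from
  \<open>i a\<close>. Test vectors concentrated in degree \<open>n\<close> then pick out this
  coefficient.\<close>

lemma coefficient_idealD_i:
  assumes a: "i a \<in> coefficient_ideal"
  shows "(L ^^ n) (star v * a * u) \<in> closure redundant"
  unfolding closure_approachable
proof (intro allI impI)
  fix e :: real assume e: "0 < e"
  let ?u = "single n u" and ?v = "single n v"
  have form: "form ?v (\<lambda>n. a * ?u n) = (L ^^ n) (star v * a * u)"
    by (simp add: form_single mult.assoc) (simp add: single_def)
  obtain t where t: "0 < t" "t \<le> e/2" "(2 * (norm (form ?v ?v) + norm (form ?u ?u))) * t \<le> e/2"
    by (rule ex_scaled_bound[of "e/2" "e/2" "2 * (norm (form ?v ?v) + norm (form ?u ?u))"]) (use e in auto)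
  obtain f d where f: "norm (eval f - i a) < t" "d \<in> redundant" "norm (form ?v (fock f ?u) - d) < t"
    using coefficient_idealD[OF a fin_single fin_single t(1)] by blast
  let ?w = "fock (f - free_elt a) ?u"
  have "fock_norm (f - free_elt a) \<le> t"
    using fock_norm_le_eval[of "f - free_elt a"] f(1) by (simp add: eval_free_diff eval_free_gens)
  then have "bounded_by t (fock (f - free_elt a))"
    using bounded_by_fock_norm fock_norm_nonneg bounded_by_mono by blast
  then have "norm (form ?v ?w) \<le> t * (2 * (norm (form ?v ?v) + norm (form ?u ?u)))"
    using t(1) by (intro form_small fin_single fin_fock) (auto simp: bounded_by_def fin_single)
  then have "norm (form ?v (fock f ?u) - (L ^^ n) (star v * a * u)) \<le> e/2"
    using t(3) by (simp add: fock_diff fock_gens form_diff_right form mult.commute)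
  moreover have "norm (form ?v (fock f ?u) - d) < e/2" using f(3) t(2) by simp
  ultimately have "dist d ((L ^^ n) (star v * a * u)) < e"
    using norm_triangle_ineq4[of "form ?v (fock f ?u) - (L ^^ n) (star v * a * u)" "form ?v (fock f ?u) - d"]
    by (simp add: dist_norm)
  then show "\<exists>y\<in>redundant. dist y ((L ^^ n) (star v * a * u)) < e"
    using f(2) by blast
qed

text \<open>Half of \<open>s\<close> goes to the tail bound of the approximant and half to its
  difference from \<open>free_elt a\<close>, which is bounded in every degree.\<close>

lemma tail_idealD_i:
  assumes a: "i a \<in> tail_ideal" and s: "0 < s"
  obtains n where "\<And>b. (L ^^ n) (star (a * b) * (a * b)) \<preceq> s\<^sup>2 *\<^sub>R (L ^^ n) (star b * b)"
proof -
  obtain f n where f: "norm (eval f - i a) < s/2" "tail_bounded (s/2) n f"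
    using tail_idealD[OF a, of "s/2"] s by auto
  have "fock_norm (free_elt a - f) \<le> s/2"
    using fock_norm_le_eval[of "free_elt a - f"] f(1)
    by (simp add: eval_free_diff eval_free_gens norm_minus_commute)
  then have "bounded_by (s/2) (fock (free_elt a - f))"
    using bounded_by_fock_norm fock_norm_nonneg bounded_by_mono by blast
  then have "tail_bounded (s/2) n (free_elt a - f)"
    by (auto simp: bounded_by_def tail_bounded_def)
  from tail_bounded_add[OF f(2) this]
  have a: "tail_bounded s n (free_elt a)" by simp
  have "(L ^^ n) (star (a * b) * (a * b)) \<preceq> s\<^sup>2 *\<^sub>R (L ^^ n) (star b * b)" for b
  proof -
    have "tail n (single n b)" by (simp add: tail_def single_def)
    then have "form (fock (free_elt a) (single n b)) (fock (free_elt a) (single n b)) \<preceq> s\<^sup>2 *\<^sub>R form (single n b) (single n b)"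
      using a fin_single unfolding tail_bounded_def by blast
    moreover have "fock (free_elt a) (single n b) = single n (a * b)"
      by (auto simp: fock_gens single_def)
    ultimately show ?thesis by (simp add: form_single) (simp add: single_def)
  qed
  then show ?thesis using that by blast
qed

text \<open>Descent in \<open>n\<close>. The positive element
  \<open>d = (L ^^ n) (star (a * b) * (a * b))\<close> is a matrix coefficient, so almost
  faithfulness applies to it. Since \<open>d * d\<close> is at most \<open>norm d\<close> times
  \<open>d\<close>, it suffices that \<open>L (star c * d * c) = 0\<close>. Moving \<open>c\<close>
  inside \<open>L ^^ n\<close> replaces \<open>b\<close> by \<open>b * (\<alpha> ^^ n) c\<close>,
  and the hypothesis in degree \<open>n + 1\<close> applies. In degree zero, \<open>b = 1\<close>
  gives the claim.\<close>

lemma eq_0_if_Ln_eq_0: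
  assumes a: "i a \<in> coefficient_ideal"
    and faithful: "almost_faithful_on L (closure redundant)"
    and 0: "\<And>b. (L ^^ n) (star (a * b) * (a * b)) = 0"
  shows "a = 0"
  using 0
proof (induction n)
  case 0
  from 0[of 1] show ?case by (simp add: star_mult_self_eq_0)
next
  case (Suc n)
  have "(L ^^ n) (star (a * b) * (a * b)) = 0" for b
  proof -
    define d where "d = (L ^^ n) (star (a * b) * (a * b))"
    have "d \<in> closure redundant"
      unfolding d_def using coefficient_idealD_i[OF a, of n "a * b" b] by (simp add: mult.assoc)
    moreover have "L (star (d * c) * (d * c)) = 0" for c
    proof -
      have d: "positive d" unfolding d_def by (intro Ln_positive positive_star_mult_self)
      have sd: "star d = d" by (rule positive_selfadjoint[OF d])
      \<comment> \<open>Conjugating the bound of \<open>d\<close> by its norm with the root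
        \<open>r\<close> yields \<open>d * d \<preceq> norm d *\<^sub>R d\<close>.\<close>
      obtain r where r: "psd r" "r * r = d"
        using psd_sqrt[OF d[unfolded positive_iff_psd]] by blast
      have "star r * d * r \<preceq> star r * (norm d *\<^sub>R 1) * r"
        by (intro positive_le_conj selfadjoint_le_norm sd) simp
      then have "r * d * r \<preceq> norm d *\<^sub>R d"
        by (simp add: psd_selfadjoint[OF r(1)] r(2))
      moreover have "r * d * r = d * d" by (simp add: mult.assoc flip: r(2))
      ultimately have dd: "d * d \<preceq> norm d *\<^sub>R d" by simp
      have "star (d * c) * (d * c) \<preceq> norm d *\<^sub>R (star c * d * c)"
        using positive_le_conj[OF dd, of c] by (simp add: star_simps sd mult.assoc)
      then have 1: "positive (L (norm d *\<^sub>R (star c * d * c) - star (d * c) * (d * c)))"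
        by (rule L_positive)
      have "star c * d * c = (L ^^ n) ((\<alpha> ^^ n) (star c) * (star (a * b) * (a * b)) * (\<alpha> ^^ n) c)"
        by (simp only: d_def Ln_alpha Ln_alpha_right)
      also have "L \<dots> = (L ^^ Suc n) (star (a * (b * (\<alpha> ^^ n) c)) * (a * (b * (\<alpha> ^^ n) c)))"
        by (simp add: star_simps alphan_star mult.assoc)
      also have "\<dots> = 0" by (rule Suc.prems)
      finally have "positive (- L (star (d * c) * (d * c)))"
        using 1 by (simp add: L_diff L_scaleR)
      then show ?thesis
        using positive_le_antisym[of 0 "L (star (d * c) * (d * c))"]
        by (simp add: L_positive positive_star_mult_self)
    qed
    ultimately show ?thesis
      using faithful unfolding almost_faithful_on_def d_def by blast
  qed
  then show ?case by (rule Suc.IH)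
qed

theorem eq_0_if_in_redundancy_ideal:
  assumes a: "i a \<in> redundancy_ideal \<alpha> i S"
    and faithful: "almost_faithful_on L (closure redundant)"
  shows "a = 0"
proof (rule ccontr)
  assume "a \<noteq> 0"
  have a2: "i a \<in> coefficient_ideal" "i a \<in> tail_ideal"
    using a redundancy_ideal_subset by auto
  define h where "h = star a * a"
  \<comment> \<open>Any value strictly between 0 and \<open>norm h\<close> would do.\<close>
  define s where "s = norm h / 2"
  have h: "positive h" "star h = h" by (simp_all add: h_def positive_star_mult_self star_simps)
  have s: "0 < s" using \<open>a \<noteq> 0\<close> by (simp add: s_def h_def cstar_identity)
  have ih: "i (z * h * w) \<in> coefficient_ideal" "i (z * h * w) \<in> tail_ideal" for z w
    using a2 closed_ideal_coefficient_ideal closed_ideal_tail_ideal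
    by (simp_all add: h_def star_hom_simps[OF i] closed_ideal_def)
  obtain n where n: "\<And>b. (L ^^ n) (star (h * b) * (h * b)) \<preceq> s\<^sup>2 *\<^sub>R (L ^^ n) (star b * b)"
    using tail_idealD_i[OF _ s, of h] ih(2)[of 1 1] by auto
  have hs: "star (h - s *\<^sub>R 1) = h - s *\<^sub>R 1" by (simp add: star_simps h)
  obtain k p where kp: "psd k" "p = k + (h - s *\<^sub>R 1)" "(h - s *\<^sub>R 1) * p = p * (h - s *\<^sub>R 1)"
      "2 *\<^sub>R ((h - s *\<^sub>R 1) * p) = p * p" "star p = p" "psd (p * p * p)"
    using positive_part[OF hs] by blast
  have hp': "h * p = p * h" using kp(3) by (simp add: algebra_simps)
  have "h * p = (h - s *\<^sub>R 1) * p + s *\<^sub>R p" by (simp add: algebra_simps)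
  moreover have "(h - s *\<^sub>R 1) * p = (1/2) *\<^sub>R (p * p)" unfolding kp(4)[symmetric] by simp
  ultimately have hp: "h * p = (1/2) *\<^sub>R (p * p) + s *\<^sub>R p" by simp
  have "(L ^^ n) (star (p * p * b) * (p * p * b)) = 0" for b
  proof -
    let ?l = "\<lambda>x. (L ^^ n) (star b * x * b)"
    have "star (h * (p * b)) * (h * (p * b)) = star b * ((p * h) * (h * p)) * b"
      by (simp add: star_simps h kp(5) mult.assoc)
    also have "p * h = h * p" by (simp add: hp')
    also have "(h * p) * (h * p) = (1/4) *\<^sub>R (p * p * (p * p)) + s *\<^sub>R (p * p * p) + s\<^sup>2 *\<^sub>R (p * p)"
      unfolding hp by (simp add: algebra_simps power2_eq_square)
        (simp flip: scaleR_left_distrib)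
    finally have 1: "(L ^^ n) (star (h * (p * b)) * (h * (p * b))) =
        (1/4) *\<^sub>R ?l (p * p * (p * p)) + s *\<^sub>R ?l (p * p * p) + s\<^sup>2 *\<^sub>R ?l (p * p)"
      by (simp add: distrib_left distrib_right Ln_add Ln_scaleR)
    have 2: "(L ^^ n) (star (p * b) * (p * b)) = ?l (p * p)"
      by (simp add: star_simps kp(5) mult.assoc)
    \<comment> \<open>The term with \<open>p * p\<close> equals the upper bound and cancels. The
      other two terms are positive with a sum at most zero, so the fourth power can be
      isolated.\<close>
    have "positive (- ((1/4) *\<^sub>R ?l (p * p * (p * p)) + s *\<^sub>R ?l (p * p * p)))"
      using n[of "p * b"] unfolding 1 2 by (simp add: algebra_simps)
    moreover have "positive (s *\<^sub>R ?l (p * p * p))"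
      using kp(6) s by (intro positive_scaleR Ln_positive positive_conj) (auto simp: positive_iff_psd)
    ultimately have "positive (- ((1/4) *\<^sub>R ?l (p * p * (p * p)) + s *\<^sub>R ?l (p * p * p)) + s *\<^sub>R ?l (p * p * p))"
      by (rule positive_add)
    then have "positive (4 *\<^sub>R (- ((1/4) *\<^sub>R ?l (p * p * (p * p)))))"
      by (intro positive_scaleR) simp_all
    then have "positive (- ?l (p * p * (p * p)))" by simp
    moreover have eq: "star (p * p * b) * (p * p * b) = star b * (p * p * (p * p)) * b"
      by (simp add: star_simps kp(5) mult.assoc)
    ultimately have "positive (- (L ^^ n) (star (p * p * b) * (p * p * b)))" by (simp only: eq)
    then show ?thesis
      using positive_le_antisym[of 0 "(L ^^ n) (star (p * p * b) * (p * p * b))"]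
      by (simp add: Ln_positive positive_star_mult_self)
  qed
  then have "(L ^^ n) (star (p * p * h * b) * (p * p * h * b)) = 0" for b
    by (metis mult.assoc)
  \<comment> \<open>The square \<open>p * p\<close> alone need not lie in the ideal; the factor
    \<open>h\<close> puts it there.\<close>
  moreover have "i (p * p * h) \<in> coefficient_ideal" using ih(1)[of "p * p" 1] by simp
  ultimately have "p * p * h = 0"
    using eq_0_if_Ln_eq_0[OF _ faithful] by blast
  then have "p * (h * p) = 0" by (simp add: hp' mult.assoc)
  then have eq: "(1/2) *\<^sub>R (p * p * p) + s *\<^sub>R (p * p) = 0"
    unfolding hp by (simp add: algebra_simps)
  \<comment> \<open>Two positive elements with sum zero both vanish, so \<open>p = 0\<close>:
    nothing of \<open>h\<close> lies above \<open>s\<close>.\<close>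
  have "- (s *\<^sub>R (p * p)) = (1/2) *\<^sub>R (p * p * p)"
    using eq by (simp add: add_eq_0_iff2)
  then have "psd (- (s *\<^sub>R (p * p)))" using kp(6) psd_scaleR by (metis divide_nonneg_nonneg zero_le_one zero_le_numeral)
  then have "s *\<^sub>R (p * p) = 0"
    using s kp(5) by (intro psd_antisym psd_scaleR psd_square) auto
  then have "p = 0" using s selfadjoint_square_eq_0[OF kp(5)] by simp
  then have "k = s *\<^sub>R 1 - h" using kp(2) by (simp add: algebra_simps add_eq_0_iff2)
  then have "norm h \<le> s"
    using kp(1) h(1) s by (intro positive_norm_le) (auto simp: positive_iff_psd)
  then show False using s by (simp add: s_def)
qed

end

section \<open>The left action on \<open>M\<^sub>L\<close>\<close>

lemma dense_eq:
  fixes k l :: "'m::topological_space \<Rightarrow> 'n::t2_space"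
  assumes "closure (range q) = UNIV" "continuous_on UNIV k" "continuous_on UNIV l" "\<And>x. k (q x) = l (q x)"
  shows "k m = l m"
proof -
  have "closure (range q) \<subseteq> {m. k m = l m}"
    using assms closed_Collect_eq by (intro closure_minimal) auto
  then show ?thesis using assms(1) by auto
qed

lemma dense_le:
  fixes k l :: "'m::topological_space \<Rightarrow> real"
  assumes "closure (range q) = UNIV" "continuous_on UNIV k" "continuous_on UNIV l" "\<And>x. k (q x) \<le> l (q x)"
  shows "k m \<le> l m"
proof -
  have "closure (range q) \<subseteq> {m. k m \<le> l m}"
    using assms closed_Collect_le by (intro closure_minimal) auto
  then show ?thesis using assms(1) by auto
qed

text \<open>\<open>q\<close> need not be injective, but the bound makes \<open>g\<close> vanish on
  its kernel, so the choice of a preimage in \<open>h\<close> is immaterial.\<close>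

lemma blinfun_extension_dense:
  fixes q :: "'a::real_vector \<Rightarrow> 'm::real_normed_vector" and g :: "'a \<Rightarrow> 'n::banach"
  assumes q: "linear q" "closure (range q) = UNIV" and g: "linear g" "\<And>x. norm (g x) \<le> C * norm (q x)"
  obtains T where "\<And>x. blinfun_apply T (q x) = g x"
proof -
  define h where "h m = g (SOME x. q x = m)" for m
  have le: "norm (g x - g y) \<le> C * norm (q x - q y)" for x y
    using g(2)[of "x - y"] by (simp add: linear_diff[OF g(1)] linear_diff[OF q(1)])
  have h: "h (q x) = g x" for x
    using le[of "SOME y. q y = q x" x] someI[of "\<lambda>y. q y = q x" x] by (simp add: h_def)
  \<comment> \<open>The constant \<open>C\<close> carries no sign condition; this one is positive
    and can be divided by.\<close>
  have C: "norm (g x - g y) \<le> (\<bar>C\<bar> + 1) * norm (q x - q y)" for x y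
    by (rule order_trans[OF le mult_right_mono]) auto
  have "uniformly_continuous_on (range q) h"
    unfolding uniformly_continuous_on_def
  proof (intro allI impI)
    fix e :: real assume "0 < e"
    then show "\<exists>d>0. \<forall>x\<in>range q. \<forall>x'\<in>range q. dist x' x < d \<longrightarrow> dist (h x') (h x) < e"
      using C by (intro exI[of _ "e / (\<bar>C\<bar> + 1)"])
        (auto simp: dist_norm h pos_less_divide_eq mult.commute intro: le_less_trans)
  qed
  from uniformly_continuous_on_extension_on_closure[OF this]
  obtain T where "uniformly_continuous_on UNIV T" and T': "\<And>m. m \<in> range q \<Longrightarrow> h m = T m"
    using q(2) by metis
  then have cont: "continuous_on UNIV T"
    by (simp add: uniformly_continuous_imp_continuous)
  have cont': "continuous_on UNIV (\<lambda>x. T (k x))" if "continuous_on UNIV k" for k :: "'m \<Rightarrow> 'm"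
    using continuous_on_compose2[OF cont that] by simp
  have T: "T (q x) = g x" for x
    using T'[of "q x"] h by simp
  have add1: "T (q x + m) = T (q x) + T m" for x m
    by (rule dense_eq[OF q(2), of "\<lambda>m. T (q x + m)" "\<lambda>m. T (q x) + T m"])
       (auto intro!: continuous_intros cont cont' simp: T linear_add[OF g(1)] simp flip: linear_add[OF q(1)])
  have add: "T (m + n) = T m + T n" for m n
    by (rule dense_eq[OF q(2), of "\<lambda>m. T (m + n)" "\<lambda>m. T m + T n"])
       (auto intro!: continuous_intros cont cont' simp: add1)
  have scale: "T (r *\<^sub>R m) = r *\<^sub>R T m" for r m
    by (rule dense_eq[OF q(2), of "\<lambda>m. T (r *\<^sub>R m)" "\<lambda>m. r *\<^sub>R T m"])
       (auto intro!: continuous_intros cont cont' simp: T linear_scale[OF g(1)] simp flip: linear_scale[OF q(1)])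
  have bound: "norm (T m) \<le> C * norm m" for m
    by (rule dense_le[OF q(2), of "\<lambda>m. norm (T m)" "\<lambda>m. C * norm m"])
       (auto intro!: continuous_intros cont simp: T g)
  have "bounded_linear T"
    by (rule bounded_linear_intro[where K = C]) (simp_all add: add scale bound mult.commute)
  then show ?thesis using that[of "Blinfun T"] T by (simp add: bounded_linear_Blinfun_apply)
qed

section \<open>Continuity in Hilbert modules\<close>

context hilbert_module
begin

lemma ip_add_right: "ip x (y + z) = ip x y + ip x z"
  and ip_scaleC_right: "ip x (c *\<^sub>C y) = c *\<^sub>C ip x y"
  using ip_linear by (auto simp: Vector_Spaces.linear_iff)

lemma ip_scaleR_right: "ip x (r *\<^sub>R y) = r *\<^sub>R ip x y"
  by (simp add: scaleR_scaleC ip_scaleC_right)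

lemma ip_add_left: "ip (x + y) z = ip x z + ip y z"
  by (metis star_ip star_add ip_add_right)

lemma ip_scaleC_left: "ip (c *\<^sub>C x) y = cnj c *\<^sub>C ip x y"
  by (metis star_ip star_scaleC ip_scaleC_right)

lemma ip_diff_right: "ip x (y - z) = ip x y - ip x z"
  using ip_add_right[of x "y - z" z] by simp

lemma ip_diff_left: "ip (x - y) z = ip x z - ip y z"
  using ip_add_left[of "x - y" y z] by simp

lemma ip_act_left: "ip (act x a) y = star a * ip x y"
  by (metis star_ip star_mult ip_act)

lemma norm_square_ip: "norm (ip x x) = (norm x)\<^sup>2"
  using norm_ip[of x] by simp

text \<open>Polarisation bounds the form by \<open>(norm x + norm y)\<^sup>2\<close>; normalising
  \<open>y\<close> gives linearity in \<open>norm y\<close>. The crude constant is enough for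
  continuity.\<close>

lemma norm_ip_le: "norm (ip x y) \<le> (norm x + 1)\<^sup>2 * norm y"
proof -
  have le: "norm (ip x y) \<le> (norm x + norm y)\<^sup>2" for x y
  proof -
    let ?f = "\<lambda>c. ip (x + c *\<^sub>C y) (x + c *\<^sub>C y)"
    have fle: "norm (?f c) \<le> (norm x + norm y)\<^sup>2" if "cmod c = 1" for c
      unfolding norm_square_ip
      using norm_triangle_ineq[of x "c *\<^sub>C y"] that by (intro power_mono) (simp_all add: norm_scaleC)
    have "4 *\<^sub>R ip x y = ?f 1 + (-1) *\<^sub>C ?f (-1) + (- \<i>) *\<^sub>C ?f \<i> + \<i> *\<^sub>C ?f (- \<i>)"
      by (simp add: ip_add_left ip_add_right ip_diff_left ip_diff_right ip_scaleC_left ip_scaleC_right algebra_simps scaleC_scaleC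
          scaleC_one complex_vector.scale_minus_left scaleC_add_right scaleR_4)
    then have "norm (4 *\<^sub>R ip x y) \<le> norm (?f 1) + norm (?f (-1)) + norm (?f \<i>) + norm (?f (- \<i>))"
      by (simp only:) (intro order_trans[OF norm_triangle_ineq] add_mono; simp add: norm_scaleC)
    moreover have "norm (?f 1) \<le> (norm x + norm y)\<^sup>2" "norm (?f (-1)) \<le> (norm x + norm y)\<^sup>2"
      "norm (?f \<i>) \<le> (norm x + norm y)\<^sup>2" "norm (?f (- \<i>)) \<le> (norm x + norm y)\<^sup>2"
      by (rule fle, simp)+
    ultimately show ?thesis unfolding norm_scaleR by linarith
  qed
  show ?thesis
  proof (cases "y = 0")
    case True
    then show ?thesis using ip_scaleR_right[of x 0 0] by simp
  next
    case False
    then show ?thesis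
      using le[of x "(1 / norm y) *\<^sub>R y"] by (simp add: ip_scaleR_right field_simps)
  qed
qed

lemma bounded_linear_ip: "bounded_linear (ip x)"
  by (rule bounded_linear_intro[where K = "(norm x + 1)\<^sup>2"])
    (simp_all add: ip_add_right ip_scaleR_right norm_ip_le mult.commute[of _ "(norm x + 1)\<^sup>2"])

lemma continuous_ip_right: "continuous_on X (ip x)"
  by (rule linear_continuous_on[OF bounded_linear_ip])

lemma continuous_ip_left: "continuous_on X (\<lambda>x. ip x y)"
proof -
  have "continuous_on X (\<lambda>x. star (ip y x))"
    by (rule continuous_on_compose2[OF continuous_star[of UNIV] continuous_ip_right]) simp
  then show ?thesis by (simp add: star_ip)
qed

lemma bounded_linear_act: "bounded_linear (act x)"
proof (rule bounded_linear_intro)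
  show "act x (a + b) = act x a + act x b" "act x (r *\<^sub>R a) = r *\<^sub>R act x a" for a b r
    using act_linear_right[of x] by (auto simp: Vector_Spaces.linear_iff scaleR_scaleC)
  show "norm (act x a) \<le> norm a * norm x" for a
  proof -
    have "(norm (act x a))\<^sup>2 = norm (star a * ip x x * a)"
      by (simp add: ip_act ip_act_left flip: norm_square_ip)
    also have "\<dots> \<le> norm (star a) * norm (ip x x) * norm a"
      by (intro order_trans[OF norm_mult_ineq] mult_right_mono norm_mult_ineq) simp
    also have "\<dots> = (norm a * norm x)\<^sup>2"
      by (simp add: norm_star norm_square_ip power2_eq_square)
    finally show ?thesis by (rule power2_le_imp_le) simp
  qed
qed

lemma rank_one_apply: "blinfun_apply (rank_one ip act x y) z = act x (ip y z)"
  unfolding rank_one_def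
  by (simp add: bounded_linear_Blinfun_apply bounded_linear_compose[OF bounded_linear_act bounded_linear_ip])

end

section \<open>Left multiplication as an adjointable operator\<close>

locale transfer_module_system = transfer_system \<alpha> L + transfer_module ip act \<alpha> L q
  for \<alpha> L :: "'a::unital_cstar_algebra \<Rightarrow> 'a"
    and ip :: "'m::complex_banach \<Rightarrow> 'm \<Rightarrow> 'a" and act :: "'m \<Rightarrow> 'a \<Rightarrow> 'm" and q :: "'a \<Rightarrow> 'm"
begin

lemma q_add: "q (x + y) = q x + q y" and q_scaleC: "q (c *\<^sub>C x) = c *\<^sub>C q x"
  using q_linear by (auto simp: Vector_Spaces.linear_iff)

lemma linear_q: "linear q"
  by (rule linearI) (simp_all add: q_add scaleR_scaleC q_scaleC)

lemma norm_q: "(norm (q x))\<^sup>2 = norm (L (star x * x))"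
  using norm_square_ip[of "q x"] by (simp add: ip_q)

lemma norm_q_le:
  assumes "L (star y * y) \<preceq> C\<^sup>2 *\<^sub>R L (star x * x)" "0 \<le> C"
  shows "norm (q y) \<le> C * norm (q x)"
proof -
  have "norm (L (star y * y)) \<le> norm (C\<^sup>2 *\<^sub>R L (star x * x))"
    by (intro positive_norm_mono L_positive positive_star_mult_self assms)
  then have "(norm (q y))\<^sup>2 \<le> (C * norm (q x))\<^sup>2"
    by (simp add: norm_q power_mult_distrib)
  then show ?thesis by (rule power2_le_imp_le) (simp add: assms)
qed

lemma blinfun_dense_le:
  fixes T :: "'m \<Rightarrow>\<^sub>L 'm"
  assumes "\<And>x. norm (blinfun_apply T (q x)) \<le> C * norm (q x)" "0 \<le> C"
  shows "norm T \<le> C"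
proof (rule norm_blinfun_bound[OF assms(2)])
  show "norm (blinfun_apply T m) \<le> C * norm m" for m
    by (rule dense_le[OF dense_q, of "\<lambda>m. norm (blinfun_apply T m)" "\<lambda>m. C * norm m"])
      (auto intro!: continuous_intros assms)
qed

lemma norm_q_mult_le: "norm (q (a * x)) \<le> norm a * norm (q x)"
  using L_positive[OF star_mult_self_mult_le[of a "norm a" x]]
  by (intro norm_q_le) (simp_all add: L_diff L_scaleR)

lemma ex_left_mult: "\<exists>T :: 'm \<Rightarrow>\<^sub>L 'm. \<forall>x. blinfun_apply T (q x) = q (a * x)"
proof -
  have "linear (\<lambda>x. q (a * x))"
    by (rule linearI) (simp_all add: q_add distrib_left linear_scale[OF linear_q])
  then show ?thesis
    using blinfun_extension_dense[OF linear_q dense_q _ norm_q_mult_le] by metis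
qed

text \<open>Justifies the definite description: multiplication by \<open>a\<close> extends from the
  range of \<open>q\<close>, the extension for \<open>star a\<close> is its adjoint, and density
  gives uniqueness.\<close>

lemma left_action: "blinfun_apply (left_action ip q a) (q x) = q (a * x)"
proof -
  obtain T :: "'a \<Rightarrow> 'm \<Rightarrow>\<^sub>L 'm" where T: "\<And>a x. blinfun_apply (T a) (q x) = q (a * x)"
    using ex_left_mult by metis
  have cont: "continuous_on UNIV (blinfun_apply U)" for U :: "'m \<Rightarrow>\<^sub>L 'm"
    by (rule linear_continuous_on[OF blinfun.bounded_linear_right])
  have cont_right: "continuous_on UNIV (\<lambda>n. ip m (blinfun_apply U n))" for m and U :: "'m \<Rightarrow>\<^sub>L 'm"
    by (rule continuous_on_compose2[OF continuous_ip_right[of UNIV] cont subset_UNIV])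
  have cont_left: "continuous_on UNIV (\<lambda>m. ip (blinfun_apply U m) n)" for n and U :: "'m \<Rightarrow>\<^sub>L 'm"
    by (rule continuous_on_compose2[OF continuous_ip_left[of UNIV] cont subset_UNIV])
  have 1: "ip (T a (q x)) (q y) = ip (q x) (T (star a) (q y))" for x y
    by (simp add: T ip_q star_simps mult.assoc)
  have 2: "ip (T a (q x)) n = ip (q x) (T (star a) n)" for x n
    by (rule dense_eq[OF dense_q continuous_ip_right cont_right 1])
  have "ip (T a m) n = ip m (T (star a) n)" for m n
    by (rule dense_eq[OF dense_q cont_left continuous_ip_left 2])
  then have "adjointable ip (T a)" unfolding adjointable_def by blast
  moreover have "T' = T a" if "\<forall>x. blinfun_apply T' (q x) = q (a * x)" for T'
  proof (rule blinfun_eqI)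
    show "blinfun_apply T' m = T a m" for m
      by (rule dense_eq[OF dense_q, of "blinfun_apply T'" "blinfun_apply (T a)"])
        (simp_all add: cont T that)
  qed
  ultimately have "left_action ip q a = T a"
    unfolding left_action_def using T by (intro the_equality) blast+
  then show ?thesis by (simp add: T)
qed

lemma norm_left_action_diff: "norm (left_action ip q a - left_action ip q b) \<le> norm (a - b)"
  using norm_q_mult_le[of "a - b"]
  by (intro blinfun_dense_le)
    (simp_all add: blinfun.diff_left left_action left_diff_distrib linear_diff[OF linear_q])

end

section \<open>Redundant elements act as compact operators\<close>

locale toeplitz_module_system = toeplitz_system \<alpha> L i S + transfer_module_system \<alpha> L ip act q
  for \<alpha> L :: "'a::unital_cstar_algebra \<Rightarrow> 'a"
    and ip :: "'m::complex_banach \<Rightarrow> 'm \<Rightarrow> 'a" and act :: "'m \<Rightarrow> 'a \<Rightarrow> 'm" and q :: "'a \<Rightarrow> 'm"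
    and i :: "'a \<Rightarrow> 't::unital_cstar_algebra" and S :: 't
begin

text \<open>The dyad of \<open>B j\<close> and \<open>C j\<close> corresponds to the rank one
  operator of \<open>q (B j)\<close> and \<open>q (star (C j))\<close>, with a star because the form
  is conjugate linear in its first variable. The error is the \<open>defect\<close> once
  more.\<close>

lemma redundancy_compact:
  assumes k: "redundancy i S b k" and e: "0 < e"
  obtains \<Theta> where "\<Theta> \<in> complex_vector.span {rank_one ip act x y |x y. True}" "norm (left_action ip q b - \<Theta>) \<le> e"
proof -
  obtain \<kappa> where \<kappa>: "\<kappa> \<in> complex_vector.span dyads" "norm (k - \<kappa>) < e"
    using k e closure_approachable[of k "complex_vector.span dyads"]
    by (auto simp: redundancy_def closed_span_def dist_norm norm_minus_commute)
  obtain n :: nat and B C where \<kappa>_eq: "\<kappa> = (\<Sum>j<n. i (B j) * S * star S * i (C j))"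
    using span_dyads[OF \<kappa>(1)] by blast
  define \<Theta> where "\<Theta> = (\<Sum>j<n. rank_one ip act (q (B j)) (q (star (C j))))"
  have "\<Theta> \<in> complex_vector.span {rank_one ip act x y |x y. True}"
    unfolding \<Theta>_def by (intro complex_vector.span_sum complex_vector.span_base) blast
  moreover have "norm (left_action ip q b - \<Theta>) \<le> e"
  proof (rule blinfun_dense_le)
    fix x
    have "blinfun_apply (left_action ip q b - \<Theta>) (q x) = q (defect n B C b x)"
      by (simp add: \<Theta>_def blinfun.diff_left blinfun.sum_left left_action rank_one_apply ip_q act_q star_star
          defect_def linear_diff[OF linear_q] linear_sum[OF linear_q])
    moreover have "L (star (defect n B C b x) * defect n B C b x) \<preceq> e\<^sup>2 *\<^sub>R L (star x * x)"
      by (rule L_defect[OF k]) (use \<kappa>(2) in \<open>simp add: \<kappa>_eq\<close>)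
    ultimately show "norm (blinfun_apply (left_action ip q b - \<Theta>) (q x)) \<le> e * norm (q x)"
      using e by (simp add: norm_q_le)
  qed (use e in simp)
  ultimately show ?thesis using that by blast
qed

lemma closure_redundant_subset: "closure redundant \<subseteq> K_alpha \<alpha> ip act q"
proof
  fix a assume a: "a \<in> closure redundant"
  have "redundant \<subseteq> A_alpha_A \<alpha>" by (auto simp: redundant_def)
  then have "a \<in> A_alpha_A \<alpha>"
    using a closure_minimal closed_closed_span unfolding A_alpha_A_def by blast
  moreover have "left_action ip q a \<in> closure (complex_vector.span {rank_one ip act x y |x y. True})"
    unfolding closure_approachable
  proof (intro allI impI)
    fix e :: real assume e: "0 < e"
    obtain b where b: "b \<in> redundant" "norm (a - b) < e/2"
      using a e closure_approachable[of a redundant] by (auto simp: dist_norm norm_minus_commute dest!: spec[of _ "e/2"])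
    obtain k where "redundancy i S b k" using b by (auto simp: redundant_def)
    then obtain \<Theta> where \<Theta>: "\<Theta> \<in> complex_vector.span {rank_one ip act x y |x y. True}" "norm (left_action ip q b - \<Theta>) \<le> e/2"
      using redundancy_compact[of b k "e/2"] e by auto
    have "norm (left_action ip q a - \<Theta>) < e"
      using norm_triangle_ineq[of "left_action ip q a - left_action ip q b" "left_action ip q b - \<Theta>"]
        norm_left_action_diff[of a b] b(2) \<Theta>(2) by simp
    then show "\<exists>y\<in>complex_vector.span {rank_one ip act x y |x y. True}. dist y (left_action ip q a) < e"
      using \<Theta>(1) by (auto simp: dist_norm norm_minus_commute)
  qed
  ultimately show "a \<in> K_alpha \<alpha> ip act q"
    by (simp add: K_alpha_def J_ideal_def compact_operators_def closed_span_def)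
qed

end

section \<open>The criterion for injectivity\<close>

lemma almost_faithful_on_subset: "almost_faithful_on L J \<Longrightarrow> I \<subseteq> J \<Longrightarrow> almost_faithful_on L I"
  unfolding almost_faithful_on_def by blast

theorem theorem4p2:
  fixes \<alpha> L :: "'a::unital_cstar_algebra \<Rightarrow> 'a"
    and ip :: "'m::complex_banach \<Rightarrow> 'm \<Rightarrow> 'a" and act :: "'m \<Rightarrow> 'a \<Rightarrow> 'm" and q :: "'a \<Rightarrow> 'm"
    and i\<^sub>A :: "'a \<Rightarrow> 't::unital_cstar_algebra" and S :: 't
    and Q :: "'t \<Rightarrow> 'c::unital_cstar_algebra"
  assumes "star_hom \<alpha>"
    and "transfer_operator \<alpha> L"
    and "transfer_module ip act \<alpha> L q"
    and "toeplitz_algebra \<alpha> L i\<^sub>A S"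
    and "exel_quotient \<alpha> i\<^sub>A S Q"
  shows "inj (Q \<circ> i\<^sub>A) \<longleftrightarrow> almost_faithful_on L (K_alpha \<alpha> ip act q)"
proof -
  interpret transfer_module ip act \<alpha> L q by fact
  interpret toeplitz_module_system \<alpha> L ip act q i\<^sub>A S
    by unfold_locales (fact assms)+
  have Q: "star_hom Q" and ker: "\<And>x. Q x = 0 \<longleftrightarrow> x \<in> redundancy_ideal \<alpha> i\<^sub>A S"
    using assms(5) by (auto simp: exel_quotient_def unital_star_hom_def)
  have inj: "inj (Q \<circ> i\<^sub>A) \<longleftrightarrow> (\<forall>a. i\<^sub>A a \<in> redundancy_ideal \<alpha> i\<^sub>A S \<longrightarrow> a = 0)"
  proof
    assume "inj (Q \<circ> i\<^sub>A)"
    then show "\<forall>a. i\<^sub>A a \<in> redundancy_ideal \<alpha> i\<^sub>A S \<longrightarrow> a = 0"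
      using injD[of "Q \<circ> i\<^sub>A" _ 0] by (auto simp: star_hom_0[OF i] star_hom_0[OF Q] simp flip: ker)
  next
    assume 0: "\<forall>a. i\<^sub>A a \<in> redundancy_ideal \<alpha> i\<^sub>A S \<longrightarrow> a = 0"
    show "inj (Q \<circ> i\<^sub>A)"
    proof (rule injI)
      fix a b assume "(Q \<circ> i\<^sub>A) a = (Q \<circ> i\<^sub>A) b"
      then have "Q (i\<^sub>A (a - b)) = 0" by (simp add: star_hom_diff[OF i] star_hom_diff[OF Q])
      then show "a = b" using 0 ker[of "i\<^sub>A (a - b)"] by auto
    qed
  qed
  show ?thesis
  proof
    assume "almost_faithful_on L (K_alpha \<alpha> ip act q)"
    then show "inj (Q \<circ> i\<^sub>A)"
      unfolding inj using eq_0_if_in_redundancy_ideal almost_faithful_on_subset closure_redundant_subset by blast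
  next
    assume inj': "inj (Q \<circ> i\<^sub>A)"
    show "almost_faithful_on L (K_alpha \<alpha> ip act q)"
      unfolding almost_faithful_on_def
    proof (intro ballI impI)
      fix a assume a: "a \<in> K_alpha \<alpha> ip act q" and 0: "\<forall>b. L (star (a * b) * (a * b)) = 0"
      have "i\<^sub>A a * i\<^sub>A b * S = 0" for b
      proof -
        \<comment> \<open>By the C*-identity, vanishing on \<open>M_L\<close> becomes vanishing of
          \<open>i\<^sub>A a * i\<^sub>A b * S\<close>, which is the redundancy condition for
          \<open>k = 0\<close>.\<close>
        have "star (i\<^sub>A a * i\<^sub>A b * S) * (i\<^sub>A a * i\<^sub>A b * S) = i\<^sub>A (L (star (a * b) * (a * b)))"
          by (simp add: i_L star_hom_simps[OF i] star_simps mult.assoc)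
        then show ?thesis using 0 star_hom_0[OF i] star_mult_self_eq_0 by metis
      qed
      then have "redundancy i\<^sub>A S a 0"
        by (simp add: redundancy_def complex_vector.subspace_0[OF subspace_closed_span])
      then have "i\<^sub>A a - 0 \<in> redundancy_ideal \<alpha> i\<^sub>A S"
        using a unfolding redundancy_ideal_def closed_ideal_generated_def K_alpha_def by blast
      then show "a = 0" using inj' unfolding inj by simp
    qed
  qed
qed

end
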